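(* Let $h\in\mathrm{End}(\xi)$ be a strictly positive, invertible bundle map with $Rh=h$. Then the set $\mathfrak H=\{a\in \mathrm{End}(\xi) : Ra=a\}$ of continuous harmonic functions for the transfer operator $R$ forms a finite dimensional $C^*$-algebra with the usual addition, adjoint and multiplication by scalars, with the product $h_1*h_2:=T_1(h_1h^{-1}h_2)$ and with the norm $\|a\|_h:=\|h^{-1/2}ah^{-1/2}\|_\infty$.
   Context: Geometric setting. $\tilde X$ is a locally compact metric space with metric $\mathrm{dist}$; a discrete group $G$ acts on $\tilde X$ isometrically and properly discontinuously (freely, so that the quotient map is a covering map); $X:=\tilde X/G$ is compact, $p:\tilde X\to X$ is the quotient covering map. $\tilde r:\tilde X\to\tilde X$ is a homeomorphism such that for some $0<\theta<1$, $\mathrm{dist}(x,y)\le\theta\,\mathrm{dist}(\tilde rx,\tilde ry)$ for all $x,y$; $\tilde x_0$ is the fixed point of $\tilde r$ and $x_0=p(\tilde x_0)$. There is $A\in\mathrm{End}(G)$ with $AG$ a normal subgroup of $G$ and $\tilde r(gx)=(Ag)\tilde r(x)$ for all $g\in G$, $x\in\tilde X$. $r:X\to X$ is defined by $r(p(x))=p(\tilde r(x))$. $g_1=1,g_2,\dots,g_q$ is a (finite) complete system of representatives of the right cosets of $AG$ in $G$, and $\psi_i=\tilde r^{-1}\circ g_i$; thus $\{p\psi_1x,\dots,p\psi_qx\}=r^{-1}(px)$. Bundle. $\xi\to X$ is a Lipschitz continuous $d$-dimensional complex vector bundle with a hermitian metric $\langle\cdot,\cdot\rangle$ (conjugate linear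 in the first variable); $S$ is the $C(X)$-module of continuous sections; $\mathrm{End}(\xi)$ is the $C^*$-algebra of continuous bundle maps $\xi\to\xi$ over the identity with norm $\|F\|_\infty=\sup_{x\in X}\|F(x)\|$ and pointwise adjoint. The pullback $p^*\xi$ is assumed trivial and is identified, by a fiberwise isometric Lipschitz isomorphism, with $\tilde X\times\mathbb C^d$ (standard inner product); so for a section $s$ of $\xi$, $p^*s$ is a function $\tilde X\to\mathbb C^d$, and for $h\in\mathrm{End}(\xi)$, $p^*h$ is a function $\tilde X\to M_d(\mathbb C)$. $S_1$ is the set of $s\in S$ with $p^*s$ Lipschitz, normed by $\|s\|_1=\sup_x\|s(x)\|+\sup_{x\ne y}\|p^*s(x)-p^*s(y)\|/\mathrm{dist}(x,y)$; $L$ is the Banach algebra of endomorphisms of the $\mathrm{Lip}_1(X)$-module $S_1$ with operator norm $\|\cdot\|_1$. In this setting $S_1$ is a finite rank projective $\mathrm{Lip}_1(X)$-module and $L$ is dense in $\mathrm{End}(\xi)$. Transfer operator. $m:r^*\xi\to\xi$ is a bundle map, i.e. linear maps $m(y):\xi_{r(y)}\to\xi_y$, with adjoint $m^*(y):\xi_y\to\xi_{r(y)}$. The transfer operator $R$ acts on $h\in\mathrm{End}(\xi)$ by $(Rh)(px)=\sum_{i=1}^q m^*(p\psi_ix)h(p\psi_ix)m(p\psi_ix)$, $x\in\tilde X$. An element $h\in\mathrm{End}(\xi)$ is harmonic if $Rh=h$. Standing assumptions: $m$ is Lipschitz continuous (i.e. $p^*m$, viewed as a function $\tilde X\to M_d(\mathbb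 C)$, is Lipschitz) and $\sup_k\|R^k\|_\infty<\infty$, where $\|R^k\|_\infty$ is the operator norm on $(\mathrm{End}(\xi),\|\cdot\|_\infty)$. $T_1:\mathrm{End}(\xi)\to\mathrm{End}(\xi)$ is $T_1g=\lim_{k\to\infty}k^{-1}\sum_{j=1}^kR^jg$ (limit in $\|\cdot\|_\infty$, which exists for every $g$). *)

theory Defs
  imports "HOL-Analysis.Analysis" "HOL-Algebra.Group_Action" "HOL-Algebra.FiniteProduct"
begin

section \<open>Complex vector spaces and C*-algebras on a carrier set\<close>

locale complex_vector_space_on =
  fixes V :: "'v set" and add :: "'v \<Rightarrow> 'v \<Rightarrow> 'v" and zero :: 'v and scale :: "complex \<Rightarrow> 'v \<Rightarrow> 'v"
  assumes add_group: "comm_group \<lparr>carrier = V, monoid.mult = add, one = zero\<rparr>"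
    and scale_closed: "v \<in> V \<Longrightarrow> scale c v \<in> V"
    and scale_add_right: "v \<in> V \<Longrightarrow> w \<in> V \<Longrightarrow> scale c (add v w) = add (scale c v) (scale c w)"
    and scale_add_left: "v \<in> V \<Longrightarrow> scale (c + c') v = add (scale c v) (scale c' v)"
    and scale_scale: "v \<in> V \<Longrightarrow> scale c (scale c' v) = scale (c * c') v"
    and scale_one: "v \<in> V \<Longrightarrow> scale 1 v = v"

locale cstar_algebra_on = complex_vector_space_on V add zero scale
  for V :: "'v set" and add zero scale +
  fixes mult :: "'v \<Rightarrow> 'v \<Rightarrow> 'v" and star :: "'v \<Rightarrow> 'v" and nrm :: "'v \<Rightarrow> real"
  assumes mult_closed: "a \<in> V \<Longrightarrow> b \<in> V \<Longrightarrow> mult a b \<in> V"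
    and mult_assoc: "a \<in> V \<Longrightarrow> b \<in> V \<Longrightarrow> c \<in> V \<Longrightarrow> mult (mult a b) c = mult a (mult b c)"
    and mult_add_left: "a \<in> V \<Longrightarrow> b \<in> V \<Longrightarrow> c \<in> V \<Longrightarrow> mult (add a b) c = add (mult a c) (mult b c)"
    and mult_add_right: "a \<in> V \<Longrightarrow> b \<in> V \<Longrightarrow> c \<in> V \<Longrightarrow> mult a (add b c) = add (mult a b) (mult a c)"
    and mult_scale_left: "a \<in> V \<Longrightarrow> b \<in> V \<Longrightarrow> mult (scale z a) b = scale z (mult a b)"
    and mult_scale_right: "a \<in> V \<Longrightarrow> b \<in> V \<Longrightarrow> mult a (scale z b) = scale z (mult a b)"
    and star_closed: "a \<in> V \<Longrightarrow> star a \<in> V"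
    and star_star: "a \<in> V \<Longrightarrow> star (star a) = a"
    and star_add: "a \<in> V \<Longrightarrow> b \<in> V \<Longrightarrow> star (add a b) = add (star a) (star b)"
    and star_scale: "a \<in> V \<Longrightarrow> star (scale z a) = scale (cnj z) (star a)"
    and star_mult: "a \<in> V \<Longrightarrow> b \<in> V \<Longrightarrow> star (mult a b) = mult (star b) (star a)"
    and norm_nonneg: "a \<in> V \<Longrightarrow> 0 \<le> nrm a"
    and norm_eq_zero: "a \<in> V \<Longrightarrow> nrm a = 0 \<longleftrightarrow> a = zero"
    and norm_triangle: "a \<in> V \<Longrightarrow> b \<in> V \<Longrightarrow> nrm (add a b) \<le> nrm a + nrm b"
    and norm_scale: "a \<in> V \<Longrightarrow> nrm (scale z a) = cmod z * nrm a"
    and norm_mult: "a \<in> V \<Longrightarrow> b \<in> V \<Longrightarrow> nrm (mult a b) \<le> nrm a * nrm b"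
    and cstar_identity: "a \<in> V \<Longrightarrow> nrm (mult (star a) a) = (nrm a)\<^sup>2"
    and norm_complete:
      "\<lbrakk>\<And>n :: nat. s n \<in> V;
        \<And>e. e > 0 \<Longrightarrow> \<exists>N. \<forall>m\<ge>N. \<forall>n\<ge>N. nrm (add (s m) (scale (-1) (s n))) < e\<rbrakk>
       \<Longrightarrow> \<exists>l\<in>V. (\<lambda>n. nrm (add (s n) (scale (-1) l))) \<longlonglongrightarrow> 0"

locale finite_dim_cstar_algebra_on = cstar_algebra_on V add zero scale mult star nrm
  for V :: "'v set" and add zero scale mult star nrm +
  assumes finite_dim:
    "\<exists>B. finite B \<and> B \<subseteq> V \<and>
       (\<forall>v\<in>V. \<exists>c. v = finprod \<lparr>carrier = V, monoid.mult = add, one = zero\<rparr> (\<lambda>b. scale (c b) b) B)"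


section \<open>The covering \<open>p\<close> and the expanding map upstairs\<close>

text \<open>
  The compact space \<open>X\<close> is a type \<open>'b\<close> together with a quotient map \<open>p\<close> from the type \<open>'x\<close>
  whose fibres are the \<open>G\<close>-orbits; this determines \<open>X\<close> as the orbit space up to a unique
  homeomorphism.  The indices of the coset representatives \<open>gs\<close> run over \<open>{1..q}\<close>.
\<close>

locale expanding_covering =
  fixes G :: "'g monoid" and act :: "'g \<Rightarrow> 'x::metric_space \<Rightarrow> 'x"
    and p :: "'x \<Rightarrow> 'b::topological_space"
    and rt :: "'x \<Rightarrow> 'x" and \<theta> :: real and xt0 :: 'x
    and A :: "'g \<Rightarrow> 'g" and q :: nat and gs :: "nat \<Rightarrow> 'g" and r :: "'b \<Rightarrow> 'b"
  assumes locally_compact: "locally compact (UNIV :: 'x set)"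
    and action: "group_action G UNIV act"
    and isometric: "g \<in> carrier G \<Longrightarrow> dist (act g x) (act g y) = dist x y"
    and properly_discontinuous: "compact K \<Longrightarrow> finite {g \<in> carrier G. act g ` K \<inter> K \<noteq> {}}"
    and free: "g \<in> carrier G \<Longrightarrow> act g x = x \<Longrightarrow> g = \<one>\<^bsub>G\<^esub>"
    and quotient: "quotient_map euclidean euclidean p"
    and fibres: "p x = p y \<longleftrightarrow> y \<in> orbit G act x"
    and compact_base: "compact (UNIV :: 'b set)"
    and rt_homeo: "homeomorphism UNIV UNIV rt (inv_into UNIV rt)"
    and \<theta>: "0 < \<theta>" "\<theta> < 1"
    and expanding: "dist x y \<le> \<theta> * dist (rt x) (rt y)"
    and fixed_point: "rt xt0 = xt0"
    and A_hom: "A \<in> hom G G"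
    and A_normal: "A ` carrier G \<lhd> G"
    and equivariant: "g \<in> carrier G \<Longrightarrow> rt (act g x) = act (A g) (rt x)"
    and r: "r (p x) = p (rt x)"
    and q_pos: "1 \<le> q"
    and gs_carrier: "i \<in> {1..q} \<Longrightarrow> gs i \<in> carrier G"
    and gs_one: "gs 1 = \<one>\<^bsub>G\<^esub>"
    and gs_cosets: "bij_betw (\<lambda>i. (A ` carrier G) #>\<^bsub>G\<^esub> gs i) {1..q} (rcosets\<^bsub>G\<^esub> (A ` carrier G))"

definition inverse_branch :: "('g \<Rightarrow> 'x \<Rightarrow> 'x) \<Rightarrow> ('x \<Rightarrow> 'x) \<Rightarrow> (nat \<Rightarrow> 'g) \<Rightarrow> nat \<Rightarrow> 'x \<Rightarrow> 'x" where
  "inverse_branch act rt gs i = inv_into UNIV rt \<circ> act (gs i)"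


section \<open>Hermitian Lipschitz vector bundles\<close>

text \<open>
  The total space is a type \<open>'e\<close>.  The linear operations are only meaningful on vectors in the
  same fibre.  A chart is a pair of an open set \<open>U\<close> of the base and the fibre coordinate
  of a local trivialization over \<open>U\<close>.  The rank is \<open>CARD('n)\<close>.
\<close>

record ('b, 'e, 'n::finite) hbundle =
  proj :: "'e \<Rightarrow> 'b"
  vadd :: "'e \<Rightarrow> 'e \<Rightarrow> 'e"
  vzero :: "'b \<Rightarrow> 'e"
  vscale :: "complex \<Rightarrow> 'e \<Rightarrow> 'e"
  herm :: "'e \<Rightarrow> 'e \<Rightarrow> complex"
  atlas :: "('b set \<times> ('e \<Rightarrow> complex^'n)) set"

definition fibre :: "('b, 'e, 'n::finite) hbundle \<Rightarrow> 'b \<Rightarrow> 'e set" where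
  "fibre \<xi> y = {e. proj \<xi> e = y}"

definition fibre_group :: "('b, 'e, 'n::finite) hbundle \<Rightarrow> 'b \<Rightarrow> 'e monoid" where
  "fibre_group \<xi> y = \<lparr>carrier = fibre \<xi> y, monoid.mult = vadd \<xi>, one = vzero \<xi> y\<rparr>"

definition fibre_norm :: "('b, 'e, 'n::finite) hbundle \<Rightarrow> 'e \<Rightarrow> real" where
  "fibre_norm \<xi> e = sqrt (Re (herm \<xi> e e))"

text \<open>Standard inner product on \<open>complex^'n\<close>, conjugate linear in the first variable.\<close>

definition cinner :: "complex^'n \<Rightarrow> complex^'n \<Rightarrow> complex" where
  "cinner u v = (\<Sum>i\<in>UNIV. cnj (u $ i) * v $ i)"

locale hermitian_vector_bundle =
  fixes \<xi> :: "('b::topological_space, 'e::topological_space, 'n::finite) hbundle"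
  assumes proj_continuous: "continuous_on UNIV (proj \<xi>)"
    and fibre_vector_space:
      "complex_vector_space_on (fibre \<xi> y) (vadd \<xi>) (vzero \<xi> y) (vscale \<xi>)"
    and atlas_cover: "(\<Union>(U, \<phi>)\<in>atlas \<xi>. U) = UNIV"
    and chart_open: "(U, \<phi>) \<in> atlas \<xi> \<Longrightarrow> open U"
    and chart_homeo: "(U, \<phi>) \<in> atlas \<xi> \<Longrightarrow>
      \<exists>k. homeomorphism (proj \<xi> -` U) (U \<times> UNIV) (\<lambda>e. (proj \<xi> e, \<phi> e)) k"
    and chart_add: "(U, \<phi>) \<in> atlas \<xi> \<Longrightarrow> y \<in> U \<Longrightarrow> e \<in> fibre \<xi> y \<Longrightarrow> f \<in> fibre \<xi> y \<Longrightarrow>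
      \<phi> (vadd \<xi> e f) = \<phi> e + \<phi> f"
    and chart_scale: "(U, \<phi>) \<in> atlas \<xi> \<Longrightarrow> y \<in> U \<Longrightarrow> e \<in> fibre \<xi> y \<Longrightarrow>
      \<phi> (vscale \<xi> c e) = c *s \<phi> e"
    and herm_add: "e \<in> fibre \<xi> y \<Longrightarrow> f \<in> fibre \<xi> y \<Longrightarrow> g \<in> fibre \<xi> y \<Longrightarrow>
      herm \<xi> e (vadd \<xi> f g) = herm \<xi> e f + herm \<xi> e g"
    and herm_scale: "e \<in> fibre \<xi> y \<Longrightarrow> f \<in> fibre \<xi> y \<Longrightarrow>
      herm \<xi> e (vscale \<xi> c f) = c * herm \<xi> e f"
    and herm_cnj: "e \<in> fibre \<xi> y \<Longrightarrow> f \<in> fibre \<xi> y \<Longrightarrow> herm \<xi> f e = cnj (herm \<xi> e f)"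
    and herm_pos: "e \<in> fibre \<xi> y \<Longrightarrow> e \<noteq> vzero \<xi> y \<Longrightarrow> 0 < Re (herm \<xi> e e)"
    and herm_continuous:
      "continuous_on {(e, f). proj \<xi> e = proj \<xi> f} (\<lambda>(e, f). herm \<xi> e f)"

text \<open>
  Lipschitz conditions on the base are imposed on lifts along \<open>p\<close>. For the quotient metric
  \<open>(p x, p y) \<mapsto> inf\<^sub>g dist x (g y)\<close>, a function on a subset \<open>U\<close> of the base is
  \<open>C\<close>-Lipschitz if and only if its lift to \<open>p -` U\<close> is.
\<close>

locale lipschitz_hermitian_bundle = hermitian_vector_bundle \<xi>
  for p :: "'x::metric_space \<Rightarrow> 'b::topological_space"
    and \<xi> :: "('b, 'e::topological_space, 'n::finite) hbundle" +
  assumes transition_lipschitz: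
    "(U, \<phi>) \<in> atlas \<xi> \<Longrightarrow> (U', \<phi>') \<in> atlas \<xi> \<Longrightarrow>
      \<exists>M :: 'b \<Rightarrow> complex^'n^'n. \<exists>C.
        (\<forall>e\<in>proj \<xi> -` (U \<inter> U'). \<phi>' e = M (proj \<xi> e) *v \<phi> e) \<and>
        C-lipschitz_on (p -` (U \<inter> U')) (\<lambda>x. M (p x))"

text \<open>
  \<open>\<Phi>\<close> is a fibrewise isometric Lipschitz isomorphism from the product bundle onto the pullback
  bundle \<open>{(x, e). proj \<xi> e = p x}\<close>; the Lipschitz conditions, for the isomorphism and
  for its inverse, are read off in the pulled back charts.
\<close>

locale lipschitz_pullback_trivialization = lipschitz_hermitian_bundle p \<xi>
  for p :: "'x::metric_space \<Rightarrow> 'b::topological_space"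
    and \<xi> :: "('b, 'e::topological_space, 'n::finite) hbundle" +
  fixes \<Phi> :: "'x \<Rightarrow> complex^'n \<Rightarrow> 'e"
  assumes \<Phi>_homeo: "\<exists>k. homeomorphism UNIV {(x, e). proj \<xi> e = p x} (\<lambda>(x, v). (x, \<Phi> x v)) k"
    and \<Phi>_add: "\<Phi> x (u + v) = vadd \<xi> (\<Phi> x u) (\<Phi> x v)"
    and \<Phi>_scale: "\<Phi> x (c *s v) = vscale \<xi> c (\<Phi> x v)"
    and \<Phi>_isometric: "herm \<xi> (\<Phi> x u) (\<Phi> x v) = cinner u v"
    and \<Phi>_lipschitz: "(U, \<phi>) \<in> atlas \<xi> \<Longrightarrow>
      \<exists>M N :: 'x \<Rightarrow> complex^'n^'n. \<exists>C.
        (\<forall>x\<in>p -` U. \<forall>v. \<phi> (\<Phi> x v) = M x *v v \<and> N x *v \<phi> (\<Phi> x v) = v) \<and>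
        C-lipschitz_on (p -` U) M \<and> C-lipschitz_on (p -` U) N"


section \<open>The algebra of bundle endomorphisms\<close>

definition fibre_linear :: "('b, 'e, 'n::finite) hbundle \<Rightarrow> 'b \<Rightarrow> 'b \<Rightarrow> ('e \<Rightarrow> 'e) \<Rightarrow> bool" where
  "fibre_linear \<xi> y z T \<longleftrightarrow>
     (\<forall>e\<in>fibre \<xi> y. T e \<in> fibre \<xi> z) \<and>
     (\<forall>e\<in>fibre \<xi> y. \<forall>f\<in>fibre \<xi> y. T (vadd \<xi> e f) = vadd \<xi> (T e) (T f)) \<and>
     (\<forall>c. \<forall>e\<in>fibre \<xi> y. T (vscale \<xi> c e) = vscale \<xi> c (T e))"

text \<open>The adjoint of a linear map \<open>T\<close> defined on the fibre over \<open>y\<close>.\<close>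

definition fibre_adjoint :: "('b, 'e, 'n::finite) hbundle \<Rightarrow> 'b \<Rightarrow> ('e \<Rightarrow> 'e) \<Rightarrow> 'e \<Rightarrow> 'e" where
  "fibre_adjoint \<xi> y T e =
     (THE u. u \<in> fibre \<xi> y \<and> (\<forall>f\<in>fibre \<xi> y. herm \<xi> u f = herm \<xi> e (T f)))"

definition bundle_End :: "('b, 'e::topological_space, 'n::finite) hbundle \<Rightarrow> ('e \<Rightarrow> 'e) set" where
  "bundle_End \<xi> = {F. continuous_on UNIV F \<and> (\<forall>y. fibre_linear \<xi> y y F)}"

definition End_add :: "('b, 'e, 'n::finite) hbundle \<Rightarrow> ('e \<Rightarrow> 'e) \<Rightarrow> ('e \<Rightarrow> 'e) \<Rightarrow> 'e \<Rightarrow> 'e" where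
  "End_add \<xi> F K = (\<lambda>e. vadd \<xi> (F e) (K e))"

definition End_zero :: "('b, 'e, 'n::finite) hbundle \<Rightarrow> 'e \<Rightarrow> 'e" where
  "End_zero \<xi> = (\<lambda>e. vzero \<xi> (proj \<xi> e))"

definition End_scale :: "('b, 'e, 'n::finite) hbundle \<Rightarrow> complex \<Rightarrow> ('e \<Rightarrow> 'e) \<Rightarrow> 'e \<Rightarrow> 'e" where
  "End_scale \<xi> c F = (\<lambda>e. vscale \<xi> c (F e))"

definition End_adjoint :: "('b, 'e, 'n::finite) hbundle \<Rightarrow> ('e \<Rightarrow> 'e) \<Rightarrow> 'e \<Rightarrow> 'e" where
  "End_adjoint \<xi> F = (\<lambda>e. fibre_adjoint \<xi> (proj \<xi> e) F e)"

definition End_norm :: "('b, 'e, 'n::finite) hbundle \<Rightarrow> ('e \<Rightarrow> 'e) \<Rightarrow> real" where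
  "End_norm \<xi> F = (SUP y. SUP e\<in>{e \<in> fibre \<xi> y. fibre_norm \<xi> e \<le> 1}. fibre_norm \<xi> (F e))"

definition End_nonneg :: "('b, 'e, 'n::finite) hbundle \<Rightarrow> ('e \<Rightarrow> 'e) \<Rightarrow> bool" where
  "End_nonneg \<xi> F \<longleftrightarrow> (\<forall>e. Im (herm \<xi> e (F e)) = 0 \<and> 0 \<le> Re (herm \<xi> e (F e)))"

definition End_strictly_pos :: "('b, 'e, 'n::finite) hbundle \<Rightarrow> ('e \<Rightarrow> 'e) \<Rightarrow> bool" where
  "End_strictly_pos \<xi> F \<longleftrightarrow>
     (\<forall>e. e \<noteq> vzero \<xi> (proj \<xi> e) \<longrightarrow> Im (herm \<xi> e (F e)) = 0 \<and> 0 < Re (herm \<xi> e (F e)))"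

definition End_invertible :: "('b, 'e::topological_space, 'n::finite) hbundle \<Rightarrow> ('e \<Rightarrow> 'e) \<Rightarrow> bool" where
  "End_invertible \<xi> F \<longleftrightarrow> (\<exists>K\<in>bundle_End \<xi>. K \<circ> F = id \<and> F \<circ> K = id)"

definition End_inverse :: "('e \<Rightarrow> 'e) \<Rightarrow> 'e \<Rightarrow> 'e" where
  "End_inverse F = inv_into UNIV F"

definition End_sqrt :: "('b, 'e::topological_space, 'n::finite) hbundle \<Rightarrow> ('e \<Rightarrow> 'e) \<Rightarrow> 'e \<Rightarrow> 'e" where
  "End_sqrt \<xi> F = (THE K. K \<in> bundle_End \<xi> \<and> End_nonneg \<xi> K \<and> K \<circ> K = F)"


section \<open>The transfer operator\<close>

text \<open>
  A bundle map \<open>m\<close> from the pullback of \<open>\<xi>\<close> along \<open>r\<close> to \<open>\<xi>\<close> maps the fibre over \<open>r y\<close> to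
  the fibre over \<open>y\<close>.  Its pullback along \<open>p\<close> is, in the trivialization \<open>\<Phi>\<close>,
  the matrix function below.
\<close>

definition pullback_matrix ::
  "('x \<Rightarrow> complex^'n \<Rightarrow> 'e) \<Rightarrow> ('x \<Rightarrow> 'b) \<Rightarrow> ('x \<Rightarrow> 'x) \<Rightarrow> ('b \<Rightarrow> 'e \<Rightarrow> 'e) \<Rightarrow> 'x \<Rightarrow> complex^'n^'n" where
  "pullback_matrix \<Phi> p rt m x = matrix (\<lambda>v. inv_into UNIV (\<Phi> x) (m (p x) (\<Phi> (rt x) v)))"

locale lipschitz_bundle_map =
  fixes p :: "'x::metric_space \<Rightarrow> 'b::topological_space" and rt :: "'x \<Rightarrow> 'x" and r :: "'b \<Rightarrow> 'b"
    and \<xi> :: "('b, 'e::topological_space, 'n::finite) hbundle"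
    and \<Phi> :: "'x \<Rightarrow> complex^'n \<Rightarrow> 'e"
    and m :: "'b \<Rightarrow> 'e \<Rightarrow> 'e"
  assumes m_linear: "fibre_linear \<xi> (r y) y (m y)"
    and m_continuous: "continuous_on {(y, e). proj \<xi> e = r y} (\<lambda>(y, e). m y e)"
    and m_lipschitz: "\<exists>C. C-lipschitz_on UNIV (pullback_matrix \<Phi> p rt m)"

text \<open>
  The value at \<open>e\<close> in the fibre over \<open>p x\<close> is computed with some lift \<open>x\<close> of the base point of
  \<open>e\<close>; another lift only permutes the summands.
\<close>

definition transfer ::
  "('b, 'e, 'n::finite) hbundle \<Rightarrow> ('x \<Rightarrow> 'b) \<Rightarrow> ('b \<Rightarrow> 'b) \<Rightarrow> nat \<Rightarrow> (nat \<Rightarrow> 'x \<Rightarrow> 'x) \<Rightarrow> ('b \<Rightarrow> 'e \<Rightarrow> 'e)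
    \<Rightarrow> ('e \<Rightarrow> 'e) \<Rightarrow> 'e \<Rightarrow> 'e" where
  "transfer \<xi> p r q \<psi> m h e =
     (let x = (SOME x. p x = proj \<xi> e) in
      finprod (fibre_group \<xi> (p x))
        (\<lambda>i. let y = p (\<psi> i x) in fibre_adjoint \<xi> (r y) (m y) (h (m y e))) {1..q})"

definition power_bounded :: "('b, 'e::topological_space, 'n::finite) hbundle \<Rightarrow> (('e \<Rightarrow> 'e) \<Rightarrow> 'e \<Rightarrow> 'e) \<Rightarrow> bool" where
  "power_bounded \<xi> R \<longleftrightarrow>
     (\<exists>C. \<forall>k. \<forall>F\<in>bundle_End \<xi>. End_norm \<xi> ((R ^^ k) F) \<le> C * End_norm \<xi> F)"

definition cesaro_mean ::
  "('b, 'e, 'n::finite) hbundle \<Rightarrow> (('e \<Rightarrow> 'e) \<Rightarrow> 'e \<Rightarrow> 'e) \<Rightarrow> nat \<Rightarrow> ('e \<Rightarrow> 'e) \<Rightarrow> 'e \<Rightarrow> 'e" where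
  "cesaro_mean \<xi> R k F =
     End_scale \<xi> (1 / of_nat k)
       (\<lambda>e. finprod (fibre_group \<xi> (proj \<xi> e)) (\<lambda>j. (R ^^ j) F e) {1..k})"

definition ergodic_limit ::
  "('b, 'e::topological_space, 'n::finite) hbundle \<Rightarrow> (('e \<Rightarrow> 'e) \<Rightarrow> 'e \<Rightarrow> 'e) \<Rightarrow> ('e \<Rightarrow> 'e) \<Rightarrow> 'e \<Rightarrow> 'e" where
  "ergodic_limit \<xi> R F =
     (THE T. T \<in> bundle_End \<xi> \<and>
        (\<lambda>k. End_norm \<xi> (End_add \<xi> (cesaro_mean \<xi> R k F) (End_scale \<xi> (-1) T))) \<longlonglongrightarrow> 0)"

definition harmonic :: "('b, 'e::topological_space, 'n::finite) hbundle \<Rightarrow> (('e \<Rightarrow> 'e) \<Rightarrow> 'e \<Rightarrow> 'e) \<Rightarrow> ('e \<Rightarrow> 'e) set" where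
  "harmonic \<xi> R = {F \<in> bundle_End \<xi>. R F = F}"

end

theory Submission
  imports Defs
begin

text \<open>
  Over the covering, bundle endomorphisms become bounded continuous matrix functions, and
  \<open>R f x\<close> becomes a sum of terms \<open>\<mu> i x\<^sup>* f (\<psi> i x) \<mu> i x\<close> with contractions \<open>\<psi> i\<close> and Lipschitz \<open>\<mu> i\<close>.
  Since \<open>R\<close> is power bounded, the iterates \<open>R\<^sup>n f\<close> are equicontinuous, so that the averages of the
  \<open>R\<^sup>n f\<close> have cluster points and hence converge to some \<open>T f\<close>. A harmonic \<open>f\<close> is Lipschitz
  with constant \<open>K \<parallel>f\<parallel>\<close>, so that it is determined by its values on a finite net; this gives finite dimension.

  The map \<open>T\<close> is a completely positive projection onto the harmonic functions which fixes \<open>h\<close>. As for the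
  Choi-Effros product, the Schwarz inequality \<open>T (z)\<^sup>* h\<^sup>-\<^sup>1 T (z) \<le> T (z\<^sup>* h\<^sup>-\<^sup>1 z)\<close> gives
  \<open>T (c h\<^sup>-\<^sup>1 T (y)) = T (c h\<^sup>-\<^sup>1 y)\<close> for harmonic \<open>c\<close>, which yields associativity, and also the lower bound in
  the C*-identity. The upper bound holds because \<open>T\<close> does not increase \<open>\<parallel>h\<^sup>-\<^sup>1\<^sup>/\<^sup>2 a h\<^sup>-\<^sup>1\<^sup>/\<^sup>2\<parallel>\<close>.
\<close>

section \<open>Adjoints and bounded continuous operator-valued functions\<close>

text \<open>The analysis is done over real inner product spaces: \<open>adj\<close> is the real
  adjoint, which agrees with the hermitian one for complex linear maps, and complex scalars return
  only as central elements \<open>J c\<close>.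

  Two obstacles shape the proof. The cover is not compact, and the lift of an endomorphism is not
  invariant under \<open>G\<close>: the frames \<open>\<Phi> x\<close> and
  \<open>\<Phi> (act g x)\<close> of one fibre differ by a unitary, so only the norm of the lift
  descends. Compactness of the base is therefore used only through norms and through a Lipschitz
  bound on these unitaries that is uniform in \<open>g\<close>. Moreover
  \<open>R f x - R f y\<close> is not a value of \<open>R\<close>; it is governed by an operator on
  functions of two points, which is compared with \<open>R\<close> through estimates of bilinear
  forms and not of norms.

  The identity need not be harmonic, so \<open>h\<close> takes its place: it occupies the corner of
  the matrix inequalities that belongs to the unit for unital maps, and its inverse \<open>k\<close>
  stands between the factors of a product.\<close>

definition adj :: "('v::euclidean_space \<Rightarrow>\<^sub>L 'v) \<Rightarrow> ('v \<Rightarrow>\<^sub>L 'v)" where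
  "adj A = Blinfun (adjoint (blinfun_apply A))"

lemma adj_inner_right: "inner v (adj A u) = inner (A v) u"
proof -
  have l: "linear (blinfun_apply A)"
    by (simp add: blinfun.bounded_linear_right bounded_linear.linear)
  have "bounded_linear (adjoint (blinfun_apply A))"
    using adjoint_linear[OF l] by (simp add: linear_conv_bounded_linear)
  then show ?thesis
    by (simp add: adj_def bounded_linear_Blinfun_apply adjoint_works[OF l])
qed

lemma adj_inner_left: "inner (adj A u) v = inner u (A v)"
  by (metis adj_inner_right inner_commute)

lemma blinfun_inner_eqI: "(\<And>u v. inner u (blinfun_apply A v) = inner u (blinfun_apply B v)) \<Longrightarrow> A = B"
  by (intro blinfun_eqI) (metis vector_eq_ldot)

lemma adj_eqI: "(\<And>u v. inner u (blinfun_apply B v) = inner (blinfun_apply A u) v) \<Longrightarrow> adj A = B"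
  by (rule blinfun_inner_eqI) (simp add: adj_inner_right)

lemma adj_adj [simp]: "adj (adj A) = A"
  by (rule adj_eqI) (simp add: adj_inner_left)

lemma adj_add: "adj (A + B) = adj A + adj B"
  by (rule adj_eqI) (simp add: adj_inner_right blinfun.add_left inner_add_left inner_add_right)

lemma adj_scaleR: "adj (c *\<^sub>R A) = c *\<^sub>R adj A"
  by (rule adj_eqI) (simp add: adj_inner_right blinfun.scaleR_left)

lemma adj_compose: "adj (A o\<^sub>L B) = adj B o\<^sub>L adj A"
  by (rule adj_eqI) (simp add: adj_inner_right)

lemma norm_adj_le: "norm (adj A) \<le> norm A"
proof (rule norm_blinfun_bound)
  fix u
  let ?w = "adj A u"
  have "norm ?w * norm ?w = inner (A ?w) u"
    by (metis adj_inner_right dot_square_norm power2_eq_square)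
  also have "\<dots> \<le> norm (A ?w) * norm u"
    by (rule norm_cauchy_schwarz)
  also have "\<dots> \<le> norm A * norm ?w * norm u"
    by (intro mult_right_mono norm_blinfun) auto
  finally have "norm ?w * norm ?w \<le> (norm A * norm u) * norm ?w"
    by (simp add: ac_simps)
  then show "norm ?w \<le> norm A * norm u"
    by (cases "norm ?w = 0") auto
qed auto

lemma norm_adj [simp]: "norm (adj A) = norm A"
  by (metis adj_adj norm_adj_le order_antisym)

lemma bounded_linear_adj: "bounded_linear adj"
  by (rule bounded_linear_intro[where K = 1]) (auto simp: adj_add adj_scaleR)

lemma adj_diff: "adj (A - B) = adj A - adj B"
  by (rule linear_diff[OF bounded_linear.linear[OF bounded_linear_adj]])

interpretation blinfun_compose: bounded_bilinear "(o\<^sub>L)"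
  by (rule bounded_bilinear_blinfun_compose)

lemma blinfun_compose_assoc: "(A o\<^sub>L B) o\<^sub>L D = A o\<^sub>L (B o\<^sub>L D)"
  by (rule blinfun_eqI) simp

lemma norm_compose3_le:
  assumes "norm A \<le> a" "norm B \<le> b" "norm D \<le> d"
  shows "norm (A o\<^sub>L (B o\<^sub>L D)) \<le> a * (b * d)"
proof -
  have nonneg: "0 \<le> a" "0 \<le> b" "0 \<le> d" using assms norm_ge_zero order_trans by blast+
  have BD: "norm (B o\<^sub>L D) \<le> b * d"
    by (rule order_trans[OF norm_blinfun_compose]) (intro mult_mono assms nonneg norm_ge_zero)
  show ?thesis
    by (rule order_trans[OF norm_blinfun_compose])
      (intro mult_mono assms BD nonneg norm_ge_zero mult_nonneg_nonneg)
qed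

text \<open>Tested at \<open>A v\<close> rescaled to the length of \<open>v\<close>. Bounds in this
  additive form survive sums over branches, in which \<open>u\<close> and \<open>v\<close> are
  replaced by their images under \<open>\<mu> i x\<close>; plain norm bounds would lose a factor at
  every step.\<close>

lemma norm_blinfun_le_form:
  fixes A :: "'v::real_inner \<Rightarrow>\<^sub>L 'v"
  assumes "\<And>u v. 2 * inner u (A v) \<le> c * (inner u u + inner v v)" and "0 \<le> c"
  shows "norm A \<le> c"
proof (rule norm_blinfun_bound)
  fix v
  show "norm (A v) \<le> c * norm v"
  proof (cases "v = 0 \<or> A v = 0")
    case False
    define u where "u = (norm v / norm (A v)) *\<^sub>R A v"
    have u: "inner u u = norm v * norm v"
      using False by (simp add: u_def dot_square_norm power2_eq_square)
    have "inner u (A v) = norm v * norm (A v)"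
      using False by (simp add: u_def dot_square_norm power2_eq_square)
    with assms(1)[of u v] have "norm (A v) * norm v \<le> (c * norm v) * norm v"
      unfolding u by (simp add: dot_square_norm power2_eq_square ac_simps)
    then show ?thesis using False by simp
  qed (use assms in \<open>auto simp: blinfun.zero_right\<close>)
qed fact

lemma inner_blinfun_le:
  fixes A :: "'v::real_inner \<Rightarrow>\<^sub>L 'v"
  shows "2 * \<bar>inner u (A v)\<bar> \<le> norm A * (inner u u + inner v v)"
proof -
  have "\<bar>inner u (A v)\<bar> \<le> norm u * (norm A * norm v)"
    by (meson Cauchy_Schwarz_ineq2 norm_blinfun mult_left_mono norm_ge_zero order_trans)
  moreover have "2 * (norm u * norm v) \<le> inner u u + inner v v"
    using sum_squares_bound[of "norm u" "norm v"] by (simp add: dot_square_norm)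
  then have "norm A * (2 * (norm u * norm v)) \<le> norm A * (inner u u + inner v v)"
    by (intro mult_left_mono) auto
  ultimately show ?thesis by (simp add: algebra_simps)
qed

text \<open>Polarization: symmetry of \<open>A\<close> turns the mixed form into a difference of two
  values of the diagonal form.\<close>

lemma norm_selfadjoint_le:
  fixes A :: "'v::euclidean_space \<Rightarrow>\<^sub>L 'v"
  assumes sa: "adj A = A" and A: "\<And>v. \<bar>inner v (A v)\<bar> \<le> c * inner v v" and "0 \<le> c"
  shows "norm A \<le> c"
proof (rule norm_blinfun_le_form)
  fix u v
  have sym: "inner v (A u) = inner u (A v)"
    by (metis adj_inner_right inner_commute sa)
  have "4 * inner u (A v) = inner (u + v) (A (u + v)) - inner (u - v) (A (u - v))"
    by (simp add: blinfun.add_right blinfun.diff_right inner_add_left inner_add_right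
        inner_diff_left inner_diff_right sym)
  also have "\<dots> \<le> c * inner (u + v) (u + v) + c * inner (u - v) (u - v)"
    using A[of "u + v"] A[of "u - v"] by linarith
  also have "\<dots> = 2 * (c * (inner u u + inner v v))"
    by (simp add: inner_add_left inner_add_right inner_diff_left inner_diff_right algebra_simps)
  finally show "2 * inner u (A v) \<le> c * (inner u u + inner v v)" by simp
qed fact

section \<open>Operator-valued functions under pointwise composition\<close>

definition bcomp :: "('x::topological_space \<Rightarrow>\<^sub>C ('v::real_normed_vector \<Rightarrow>\<^sub>L 'v)) \<Rightarrow>
    ('x \<Rightarrow>\<^sub>C ('v \<Rightarrow>\<^sub>L 'v)) \<Rightarrow> ('x \<Rightarrow>\<^sub>C ('v \<Rightarrow>\<^sub>L 'v))" (infixl "\<odot>" 70)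
  where "f \<odot> g = Bcontfun (\<lambda>x. f x o\<^sub>L g x)"

lemma bcomp_apply [simp]: "apply_bcontfun (f \<odot> g) x = f x o\<^sub>L g x"
proof -
  have "(\<lambda>x. f x o\<^sub>L g x) \<in> bcontfun"
  proof (rule bcontfun_normI)
    show "continuous_on UNIV (\<lambda>x. f x o\<^sub>L g x)"
      by (intro continuous_intros) auto
    show "norm (f x o\<^sub>L g x) \<le> norm f * norm g" for x
      by (rule order_trans[OF norm_blinfun_compose]) (intro mult_mono norm_bounded norm_ge_zero)
  qed
  then show ?thesis
    by (simp add: bcomp_def Bcontfun_inverse)
qed

definition badj :: "('x::topological_space \<Rightarrow>\<^sub>C ('v::euclidean_space \<Rightarrow>\<^sub>L 'v)) \<Rightarrow> ('x \<Rightarrow>\<^sub>C ('v \<Rightarrow>\<^sub>L 'v))"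
  where "badj f = Bcontfun (\<lambda>x. adj (f x))"

lemma badj_apply [simp]: "apply_bcontfun (badj f) x = adj (f x)"
proof -
  have "(\<lambda>x. adj (f x)) \<in> bcontfun"
    by (intro bcontfun_normI[where b = "norm f"]
        bounded_linear.continuous_on[OF bounded_linear_adj]) (auto simp: norm_bounded)
  then show ?thesis
    by (simp add: badj_def Bcontfun_inverse)
qed

abbreviation bid :: "'x::topological_space \<Rightarrow>\<^sub>C ('v::real_normed_vector \<Rightarrow>\<^sub>L 'v)" where
  "bid \<equiv> const_bcontfun id_blinfun"

declare const_bcontfun.rep_eq [simp]

lemma norm_bcomp: "norm (f \<odot> g) \<le> norm f * norm g"
proof (rule norm_bound)
  fix x
  show "norm ((f \<odot> g) x) \<le> norm f * norm g"
    unfolding bcomp_apply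
    by (rule order_trans[OF norm_blinfun_compose]) (intro mult_mono norm_bounded norm_ge_zero)
qed

lemma bounded_bilinear_bcomp: "bounded_bilinear (\<odot>)"
proof
  show "\<exists>K. \<forall>a b. norm (a \<odot> b) \<le> norm a * norm b * K"
    by (rule exI[of _ 1]) (simp add: norm_bcomp)
qed (auto intro!: bcontfun_eqI blinfun_eqI simp: blinfun.bilinear_simps)

interpretation bcomp: bounded_bilinear "(\<odot>)"
  by (rule bounded_bilinear_bcomp)

lemma bcomp_assoc: "f \<odot> g \<odot> k = f \<odot> (g \<odot> k)"
  by (auto intro!: bcontfun_eqI blinfun_eqI)

lemma bcomp_bid [simp]: "f \<odot> bid = f" "bid \<odot> f = f"
  by (auto intro!: bcontfun_eqI blinfun_eqI)

lemma badj_badj [simp]: "badj (badj f) = f"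
  by (auto intro!: bcontfun_eqI)

lemma badj_bcomp: "badj (f \<odot> g) = badj g \<odot> badj f"
  by (auto intro!: bcontfun_eqI simp: adj_compose)

lemma norm_badj [simp]: "norm (badj f) = norm f"
proof -
  have le: "norm (badj f) \<le> norm f" for f :: "'a \<Rightarrow>\<^sub>C ('b \<Rightarrow>\<^sub>L 'b)"
    by (rule norm_bound) (simp add: norm_bounded)
  show ?thesis
    using le[of f] le[of "badj f"] by simp
qed

lemma bounded_linear_badj: "bounded_linear badj"
  by (rule bounded_linear_intro[where K = 1])
    (auto intro!: bcontfun_eqI simp: adj_add adj_scaleR)

lemmas linear_badj = bounded_linear.linear[OF bounded_linear_badj]

lemmas badj_add = linear_add[OF linear_badj]
  and badj_diff = linear_diff[OF linear_badj]
  and badj_scaleR = linear_scale[OF linear_badj]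

lemma bounded_linear_apply_bcontfun:
  "bounded_linear (\<lambda>f::'x::topological_space \<Rightarrow>\<^sub>C 'b::real_normed_vector. f x)"
  by (rule bounded_linear_intro[where K = 1]) (auto simp: norm_bounded)

lemma apply_bcontfun_sum:
  fixes f :: "'i \<Rightarrow> 'x::topological_space \<Rightarrow>\<^sub>C 'b::real_normed_vector"
  shows "apply_bcontfun (sum f I) x = (\<Sum>i\<in>I. f i x)"
  by (rule Real_Vector_Spaces.linear_sum)
    (rule bounded_linear.linear[OF bounded_linear_apply_bcontfun])

lemma badj_bid [simp]: "badj bid = bid"
  by (intro bcontfun_eqI) (auto intro: adj_eqI)

section \<open>Mean ergodic averages, finite dimensionality, square roots\<close>

text \<open>The carrier \<open>E\<close> is a closed subspace of a larger type because it will
  consist of those functions on the cover that descend to the bundle. One constant \<open>C\<close>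
  bounds all powers.\<close>

locale power_bounded_operator =
  fixes E :: "'a::real_normed_vector set" and R :: "'a \<Rightarrow> 'a" and C :: real
  assumes subspace_E: "subspace E" and closed_E: "closed E"
    and R_in: "f \<in> E \<Longrightarrow> R f \<in> E"
    and R_add: "f \<in> E \<Longrightarrow> g \<in> E \<Longrightarrow> R (f + g) = R f + R g"
    and R_scaleR: "f \<in> E \<Longrightarrow> R (c *\<^sub>R f) = c *\<^sub>R R f"
    and C_nonneg: "0 \<le> C"
    and R_pow_bound: "f \<in> E \<Longrightarrow> norm ((R ^^ n) f) \<le> C * norm f"
begin

lemma E_add: "f \<in> E \<Longrightarrow> g \<in> E \<Longrightarrow> f + g \<in> E"
  and E_diff: "f \<in> E \<Longrightarrow> g \<in> E \<Longrightarrow> f - g \<in> E"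
  and E_scaleR: "f \<in> E \<Longrightarrow> c *\<^sub>R f \<in> E"
  and E_zero: "0 \<in> E"
  and E_sum: "(\<And>i. i \<in> I \<Longrightarrow> F i \<in> E) \<Longrightarrow> sum F I \<in> E"
  using subspace_E subspace_sum by (auto simp: subspace_def subspace_diff)

lemma E_uminus: "f \<in> E \<Longrightarrow> - f \<in> E"
  using E_scaleR[of f "-1"] by simp

lemma E_limit: "(\<And>n::nat. F n \<in> E) \<Longrightarrow> F \<longlonglongrightarrow> g \<Longrightarrow> g \<in> E"
  using closed_E closed_sequential_limits by blast

lemma R_zero: "R 0 = 0"
  using R_scaleR[OF E_zero, of 0] by simp

lemma R_diff: "f \<in> E \<Longrightarrow> g \<in> E \<Longrightarrow> R (f - g) = R f - R g"
  using R_add[of f "- g"] R_scaleR[of g "-1"] E_uminus by simp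

lemma R_sum: "(\<And>i. i \<in> I \<Longrightarrow> F i \<in> E) \<Longrightarrow> R (sum F I) = (\<Sum>i\<in>I. R (F i))"
  by (induction I rule: infinite_finite_induct) (simp_all add: R_zero R_add E_sum)

lemma R_pow_in: "f \<in> E \<Longrightarrow> (R ^^ n) f \<in> E"
  by (induction n) (auto simp: R_in)

lemma R_pow_add: "f \<in> E \<Longrightarrow> g \<in> E \<Longrightarrow> (R ^^ n) (f + g) = (R ^^ n) f + (R ^^ n) g"
  by (induction n) (auto simp: R_add R_pow_in)

lemma R_pow_scaleR: "f \<in> E \<Longrightarrow> (R ^^ n) (c *\<^sub>R f) = c *\<^sub>R (R ^^ n) f"
  by (induction n) (auto simp: R_scaleR R_pow_in)

lemma R_pow_fixed: "R f = f \<Longrightarrow> (R ^^ n) f = f"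
  by (induction n) auto

lemma R_norm: "f \<in> E \<Longrightarrow> norm (R f) \<le> C * norm f"
  using R_pow_bound[of f 1] by simp

lemma R_tendsto:
  assumes F: "\<And>n::nat. F n \<in> E" and lim: "F \<longlonglongrightarrow> g"
  shows "(\<lambda>n. R (F n)) \<longlonglongrightarrow> R g"
proof -
  have g: "g \<in> E" using F lim by (rule E_limit)
  have "(\<lambda>n. F n - g) \<longlonglongrightarrow> 0"
    using lim by (simp add: LIM_zero)
  then have "(\<lambda>n. C * norm (F n - g)) \<longlonglongrightarrow> 0"
    by (intro tendsto_mult_right_zero tendsto_norm_zero)
  then have "(\<lambda>n. R (F n - g)) \<longlonglongrightarrow> 0"
    by (rule Lim_null_comparison[rotated]) (use R_norm E_diff F g in auto)
  then show ?thesis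
    by (simp add: R_diff F g LIM_zero_iff)
qed

definition cesaro :: "nat \<Rightarrow> 'a \<Rightarrow> 'a" where
  "cesaro n f = (1 / real n) *\<^sub>R (\<Sum>j=1..n. (R ^^ j) f)"

lemma cesaro_in: "f \<in> E \<Longrightarrow> cesaro n f \<in> E"
  by (auto simp: cesaro_def intro!: E_scaleR E_sum R_pow_in)

lemma cesaro_add: "f \<in> E \<Longrightarrow> g \<in> E \<Longrightarrow> cesaro n (f + g) = cesaro n f + cesaro n g"
  by (simp add: cesaro_def R_pow_add sum.distrib scaleR_right_distrib)

lemma cesaro_scaleR: "f \<in> E \<Longrightarrow> cesaro n (c *\<^sub>R f) = c *\<^sub>R cesaro n f"
  by (simp add: cesaro_def R_pow_scaleR scaleR_sum_right mult.commute)

lemma cesaro_fixed: "R f = f \<Longrightarrow> 0 < n \<Longrightarrow> cesaro n f = f"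
  by (simp add: cesaro_def R_pow_fixed flip: scaleR_left.sum)
    (simp add: sum_constant_scaleR)

lemma cesaro_norm:
  assumes f: "f \<in> E" shows "norm (cesaro n f) \<le> C * norm f"
proof (cases "n = 0")
  case False
  have "norm (\<Sum>j=1..n. (R ^^ j) f) \<le> (\<Sum>j=1..n. C * norm f)"
    using R_pow_bound[OF f] by (intro sum_norm_le) auto
  then have "norm (\<Sum>j=1..n. (R ^^ j) f) \<le> n * (C * norm f)" by simp
  then show ?thesis using False by (simp add: cesaro_def field_simps)
qed (simp add: cesaro_def C_nonneg)

lemma cesaro_R: "f \<in> E \<Longrightarrow> R (cesaro n f) = cesaro n (R f)"
  by (simp add: cesaro_def R_scaleR R_sum E_sum R_pow_in funpow_swap1)

text \<open>The sum telescopes to \<open>R f - (R ^^ Suc n) f\<close>, so the averages of a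
  coboundary decay like \<open>1 / n\<close>.\<close>

lemma cesaro_coboundary_norm:
  assumes f: "f \<in> E"
  shows "norm (cesaro n (f - R f)) \<le> 2 * C * norm f / n"
proof (cases "n = 0")
  case False
  have "(\<Sum>j=1..n. (R ^^ j) (f - R f)) = (\<Sum>j=1..n. (R ^^ j) f - (R ^^ Suc j) f)"
    using R_pow_add[of f "- R f"] R_pow_scaleR[of "R f" _ "-1"] f
    by (intro sum.cong) (auto simp: R_in E_uminus funpow_swap1)
  also have "\<dots> = R f - (R ^^ Suc n) f"
    by (induction n) (auto simp: sum.cl_ivl_Suc)
  finally have "norm (\<Sum>j=1..n. (R ^^ j) (f - R f)) \<le> norm (R f) + norm ((R ^^ Suc n) f)"
    by (simp only: norm_triangle_ineq4)
  also have "\<dots> \<le> 2 * C * norm f"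
    using R_norm[OF f] R_pow_bound[OF f, of "Suc n"] by simp
  finally show ?thesis using False by (simp add: cesaro_def divide_right_mono)
qed (simp add: cesaro_def)

lemma diff_pow_coboundary:
  assumes f: "f \<in> E" shows "\<exists>b\<in>E. f - (R ^^ n) f = b - R b"
proof (induction n)
  case (Suc n)
  then obtain b where b: "b \<in> E" "f - (R ^^ n) f = b - R b" by auto
  have "f - (R ^^ Suc n) f = (b + (R ^^ n) f) - R (b + (R ^^ n) f)"
    using b by (simp add: R_add R_pow_in f algebra_simps)
  then show ?case
    using b(1) f by (intro bexI[of _ "b + (R ^^ n) f"]) (auto intro: E_add R_pow_in)
qed (auto intro!: bexI[of _ 0] simp: E_zero R_zero)

text \<open>An exact decomposition without error term, which lets a single index of a convergent
  subsequence control all later averages.\<close>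

lemma diff_cesaro_coboundary:
  assumes f: "f \<in> E" and n: "0 < n" shows "\<exists>b\<in>E. f - cesaro n f = b - R b"
proof -
  obtain b where b: "\<And>j. b j \<in> E" "\<And>j. f - (R ^^ j) f = b j - R (b j)"
    using diff_pow_coboundary[OF f] by metis
  have "f - cesaro n f = (1 / real n) *\<^sub>R (\<Sum>j=1..n. f - (R ^^ j) f)"
    using n by (simp add: cesaro_def sum_subtractf scaleR_right_diff_distrib sum_constant_scaleR)
  also have "\<dots> = (1 / real n) *\<^sub>R (\<Sum>j=1..n. b j) - R ((1 / real n) *\<^sub>R (\<Sum>j=1..n. b j))"
    by (simp add: b R_scaleR R_sum E_sum sum_subtractf scaleR_right_diff_distrib)
  finally show ?thesis
    using b(1) by (intro bexI) (auto intro!: E_scaleR E_sum)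
qed

text \<open>A cluster point \<open>g\<close> of the averages is fixed, and \<open>f - g\<close> is a limit of coboundaries
  \<open>b - R b\<close>, whose averages tend to zero.\<close>

lemma cesaro_convergent:
  assumes f: "f \<in> E" and s: "strict_mono (s :: nat \<Rightarrow> nat)" and lim: "(\<lambda>k. cesaro (s k) f) \<longlonglongrightarrow> g"
  shows "g \<in> E" "R g = g" "(\<lambda>n. cesaro n f) \<longlonglongrightarrow> g"
proof -
  show g: "g \<in> E"
    using lim by (rule E_limit[rotated]) (rule cesaro_in[OF f])
  have "(\<lambda>k. 2 * C * norm f / real k) \<longlonglongrightarrow> 0"
    by (rule lim_const_over_n)
  then have "(\<lambda>k. cesaro k (f - R f)) \<longlonglongrightarrow> 0"
    by (rule Lim_null_comparison[rotated]) (use cesaro_coboundary_norm[OF f] in auto)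
  then have "(\<lambda>k. cesaro (s k) (f - R f)) \<longlonglongrightarrow> 0"
    using LIMSEQ_subseq_LIMSEQ[OF _ s] by (fastforce simp: o_def)
  moreover have "cesaro n (f - R f) = cesaro n f - R (cesaro n f)" for n
    using cesaro_add[of f "- R f" n] cesaro_scaleR[of "R f" n "-1"] f
    by (simp add: R_in E_uminus cesaro_R)
  moreover have "(\<lambda>k. cesaro (s k) f - R (cesaro (s k) f)) \<longlonglongrightarrow> g - R g"
    by (intro tendsto_diff lim R_tendsto cesaro_in f)
  ultimately have "g - R g = 0"
    using LIMSEQ_unique by fastforce
  then show Rg: "R g = g" by simp
  show "(\<lambda>n. cesaro n f) \<longlonglongrightarrow> g"
  proof (rule LIMSEQ_I)
    fix e :: real assume e: "0 < e"
    \<comment> \<open>Averaging can enlarge the error by the factor \<open>C\<close>; the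
      \<open>1\<close> keeps the denominator positive when \<open>C = 0\<close>.\<close>
    define d where "d = e / (2 * (C + 1))"
    have d: "0 < d" "C * d < e / 2"
      using e C_nonneg by (auto simp: d_def field_simps)
    obtain k0 where k0: "\<And>k. k \<ge> k0 \<Longrightarrow> norm (cesaro (s k) f - g) < d"
      using LIMSEQ_D[OF lim d(1)] by blast
    \<comment> \<open>The successor makes the index positive: \<open>cesaro 0 f\<close> is the
      default value \<open>0\<close>, to which \<open>diff_cesaro_coboundary\<close> does not
      apply.\<close>
    define m where "m = s (Suc k0)"
    have m: "0 < m" "norm (cesaro m f - g) < d"
      using seq_suble[OF s, of "Suc k0"] k0[of "Suc k0"] by (auto simp: m_def)
    obtain b where b: "b \<in> E" "f - cesaro m f = b - R b"
      using diff_cesaro_coboundary[OF f m(1)] by blast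
    obtain N where N: "\<And>n. n \<ge> N \<Longrightarrow> 2 * C * norm b / real n < e / 2"
      using LIMSEQ_D[OF lim_const_over_n[of "2 * C * norm b"], of "e / 2"] e C_nonneg by auto
    have "norm (cesaro n f - g) < e" if n: "n \<ge> Suc N" for n
    proof -
      have f_eq: "f = (b - R b) + ((cesaro m f - g) + g)"
        by (simp flip: b(2))
      have "cesaro n f = cesaro n (b - R b) + (cesaro n (cesaro m f - g) + cesaro n g)"
        by (subst f_eq) (simp only: cesaro_add E_add E_diff R_in b(1) cesaro_in f g)
      then have "cesaro n f - g = cesaro n (b - R b) + cesaro n (cesaro m f - g)"
        using n by (simp add: cesaro_fixed[OF Rg])
      then have "norm (cesaro n f - g) \<le> norm (cesaro n (b - R b)) + norm (cesaro n (cesaro m f - g))"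
        by (simp add: norm_triangle_ineq)
      also have "\<dots> \<le> 2 * C * norm b / n + C * norm (cesaro m f - g)"
        by (intro add_mono cesaro_coboundary_norm cesaro_norm b E_diff cesaro_in f g)
      also have "\<dots> < e / 2 + e / 2"
        using N[of n] n d m mult_left_mono[OF less_imp_le[OF m(2)] C_nonneg] by (intro add_strict_mono) auto
      finally show ?thesis by simp
    qed
    then show "\<exists>n0. \<forall>n\<ge>n0. norm (cesaro n f - g) < e" by blast
  qed
qed

end

text \<open>The mean ergodic theorem in the form of Yosida and Kakutani: one cluster point for the
  averages of each element already forces convergence. The cluster points come later from an
  Arzela-Ascoli argument.\<close>

locale mean_ergodic = power_bounded_operator +
  assumes cesaro_cluster: "f \<in> E \<Longrightarrow> \<exists>s g. strict_mono (s :: nat \<Rightarrow> nat) \<and> (\<lambda>k. cesaro (s k) f) \<longlonglongrightarrow> g"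
begin

definition T :: "'a \<Rightarrow> 'a" where "T f = lim (\<lambda>n. cesaro n f)"

lemma assumes "f \<in> E"
  shows T_in: "T f \<in> E" and R_T: "R (T f) = T f" and cesaro_T: "(\<lambda>n. cesaro n f) \<longlonglongrightarrow> T f"
proof -
  obtain s g where s: "strict_mono (s :: nat \<Rightarrow> nat)" and "(\<lambda>k. cesaro (s k) f) \<longlonglongrightarrow> g"
    using cesaro_cluster[OF assms] by blast
  note g = cesaro_convergent[OF assms this]
  then have "T f = g" by (auto simp: T_def intro: limI)
  with g show "T f \<in> E" "R (T f) = T f" "(\<lambda>n. cesaro n f) \<longlonglongrightarrow> T f" by auto
qed

lemma T_fixed: "f \<in> E \<Longrightarrow> R f = f \<Longrightarrow> T f = f"
  by (rule LIMSEQ_unique[OF cesaro_T])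
    (auto intro!: tendsto_eventually eventually_mono[OF eventually_gt_at_top[of 0]] cesaro_fixed)

lemma T_add: "f \<in> E \<Longrightarrow> g \<in> E \<Longrightarrow> T (f + g) = T f + T g"
  by (rule LIMSEQ_unique[OF cesaro_T]) (auto simp: cesaro_add E_add intro!: tendsto_add cesaro_T)

lemma T_scaleR: "f \<in> E \<Longrightarrow> T (c *\<^sub>R f) = c *\<^sub>R T f"
  by (rule LIMSEQ_unique[OF cesaro_T]) (auto simp: cesaro_scaleR E_scaleR intro!: tendsto_scaleR cesaro_T)

lemma T_diff: "f \<in> E \<Longrightarrow> g \<in> E \<Longrightarrow> T (f - g) = T f - T g"
  using T_add[of f "- g"] T_scaleR[of g "-1"] E_uminus by simp

text \<open>\<open>Z\<close> is only real linear, which covers both \<open>badj\<close>, conjugate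
  linear over the complex numbers, and multiplication by \<open>J c\<close>.\<close>

lemma T_commute:
  assumes Z: "bounded_linear Z" and ZE: "\<And>f. f \<in> E \<Longrightarrow> Z f \<in> E"
    and ZR: "\<And>f. f \<in> E \<Longrightarrow> Z (R f) = R (Z f)" and f: "f \<in> E"
  shows "T (Z f) = Z (T f)"
proof -
  interpret Z: bounded_linear Z by fact
  have "Z ((R ^^ n) f) = (R ^^ n) (Z f)" for n
    by (induction n) (auto simp: ZR R_pow_in f)
  then have "cesaro n (Z f) = Z (cesaro n f)" for n
    by (simp add: cesaro_def Z.scaleR Z.sum)
  then have "(\<lambda>n. cesaro n (Z f)) \<longlonglongrightarrow> Z (T f)"
    using Z.tendsto[OF cesaro_T[OF f]] by simp
  then show ?thesis
    using LIMSEQ_unique[OF cesaro_T[OF ZE[OF f]]] by simp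
qed

end

text \<open>Induction on the functionals: the kernel of one of them in \<open>H\<close> has
  codimension at most one, so one further vector \<open>b\<close> completes a finite spanning set of
  the kernel.\<close>

lemma finite_span_of_separating_functionals:
  fixes H :: "'a::real_vector set"
  assumes "finite L" "\<And>l. l \<in> L \<Longrightarrow> linear (l :: 'a \<Rightarrow> real)" "subspace H"
    and "\<And>f. f \<in> H \<Longrightarrow> (\<forall>l\<in>L. l f = 0) \<Longrightarrow> f = 0"
  shows "\<exists>B. finite B \<and> B \<subseteq> H \<and> H \<subseteq> span B"
  using assms
proof (induction L arbitrary: H rule: finite_induct)
  case empty
  then have "H \<subseteq> {0}" by auto
  then show ?case by (intro exI[of _ "{}"]) auto
next
  case (insert l L)
  have l: "linear l" using insert.prems by auto
  let ?K = "{f \<in> H. l f = 0}"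
  have "subspace ?K"
    using insert.prems(2) l by (auto simp: subspace_def linear_0 linear_add linear_scale)
  then have "\<exists>B. finite B \<and> B \<subseteq> ?K \<and> ?K \<subseteq> span B"
    using insert.prems by (intro insert.IH) auto
  then obtain B where B: "finite B" "B \<subseteq> ?K" "?K \<subseteq> span B" by blast
  show ?case
  proof (cases "\<exists>b\<in>H. l b \<noteq> 0")
    case True
    then obtain b where b: "b \<in> H" "l b \<noteq> 0" by blast
    have "f \<in> span (insert b B)" if f: "f \<in> H" for f
    proof -
      have "f - (l f / l b) *\<^sub>R b \<in> ?K"
        using f b insert.prems(2) l by (simp add: subspace_diff subspace_scale linear_diff linear_scale)
      then have "f - (l f / l b) *\<^sub>R b \<in> span B" using B by blast
      then show ?thesis by (auto simp: span_insert)
    qed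
    then show ?thesis using B b by (intro exI[of _ "insert b B"]) auto
  next
    case False
    then show ?thesis using B by (intro exI[of _ B]) auto
  qed
qed

text \<open>Write \<open>k\<close> as \<open>c\<close> times \<open>bid - X\<close> with
  \<open>norm X < 1\<close>. A root of \<open>bid - X\<close> is \<open>bid - Y\<close> for a fixed
  point \<open>Y\<close> of the map sending \<open>Y\<close> to half of
  \<open>X + Y \<odot> Y\<close>, a contraction on a small ball. The fixed point stays in the closed
  subalgebra \<open>E\<close>, whereas uniqueness is proved against all nonnegative self-adjoint
  roots.\<close>

lemma positive_sqrt:
  fixes E :: "('x::metric_space \<Rightarrow>\<^sub>C ('v::euclidean_space \<Rightarrow>\<^sub>L 'v)) set"
  assumes E: "subspace E" "closed E" "bid \<in> E" "\<And>f g. f \<in> E \<Longrightarrow> g \<in> E \<Longrightarrow> f \<odot> g \<in> E"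
    and k: "k \<in> E" "badj k = k"
    and lower: "\<And>x v. e * inner v v \<le> inner v (k x v)"
    and upper: "\<And>x v. inner v (k x v) \<le> c * inner v v"
    and ec: "0 < e" "e \<le> c"
  shows "\<exists>s\<in>E. badj s = s \<and> (\<forall>x v. 0 \<le> inner v (s x v)) \<and> s \<odot> s = k \<and>
    (\<forall>t. badj t = t \<longrightarrow> (\<forall>x v. 0 \<le> inner v (t x v)) \<longrightarrow> t \<odot> t = k \<longrightarrow> t = s)"
proof -
  have c: "0 < c" using ec by simp
  define X where "X = bid - (1 / c) *\<^sub>R k"
  define \<rho> where "\<rho> = 1 - e / c"
  have \<rho>: "0 \<le> \<rho>" "\<rho> < 1" using ec by (auto simp: \<rho>_def)
  have X: "X \<in> E" "badj X = X"
    using E k by (auto simp: X_def subspace_diff subspace_scale badj_diff badj_scaleR)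
  have "norm X \<le> \<rho>"
  proof (rule norm_bound)
    fix x
    show "norm (X x) \<le> \<rho>"
    proof (rule norm_selfadjoint_le)
      show "adj (X x) = X x"
        using X(2) by (metis badj_apply)
      fix v
      have "inner v (X x v) = inner v v - inner v (k x v) / c"
        by (simp add: X_def blinfun.diff_left blinfun.scaleR_left inner_diff_right)
      moreover have "inner v (k x v) / c \<le> inner v v"
        using upper[of v x] c by (simp add: field_simps)
      moreover have "e / c * inner v v \<le> inner v (k x v) / c"
        using lower[of v x] c by (simp add: field_simps)
      ultimately show "\<bar>inner v (X x v)\<bar> \<le> \<rho> * inner v v"
        by (simp add: \<rho>_def algebra_simps)
    qed fact
  qed
  define \<Psi> where "\<Psi> Y = (1/2) *\<^sub>R (X + Y \<odot> Y)" for Y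
  define S where "S = {Y \<in> E. badj Y = Y \<and> norm Y \<le> \<rho>}"
  have "closed {Y :: 'x \<Rightarrow>\<^sub>C ('v \<Rightarrow>\<^sub>L 'v). badj Y = Y}"
    by (intro closed_Collect_eq bounded_linear.continuous_on[OF bounded_linear_badj] continuous_on_id)
  moreover have "closed {Y :: 'x \<Rightarrow>\<^sub>C ('v \<Rightarrow>\<^sub>L 'v). norm Y \<le> \<rho>}"
    by (intro closed_Collect_le continuous_intros)
  moreover have "S = E \<inter> {Y. badj Y = Y} \<inter> {Y. norm Y \<le> \<rho>}"
    by (auto simp: S_def)
  ultimately have "complete S"
    using E(2) by (simp add: complete_eq_closed closed_Int)
  have contr: "norm (\<Psi> Y - \<Psi> Z) \<le> (norm Y + norm Z) / 2 * norm (Y - Z)" for Y Z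
  proof -
    have "\<Psi> Y - \<Psi> Z = (1/2) *\<^sub>R (Y \<odot> (Y - Z) + (Y - Z) \<odot> Z)"
      by (simp add: \<Psi>_def bcomp.diff_left bcomp.diff_right algebra_simps flip: scaleR_diff_right)
    then have "norm (\<Psi> Y - \<Psi> Z) \<le> (norm (Y \<odot> (Y - Z)) + norm ((Y - Z) \<odot> Z)) / 2"
      by (simp add: norm_triangle_ineq)
    also have "\<dots> \<le> (norm Y * norm (Y - Z) + norm (Y - Z) * norm Z) / 2"
      by (intro divide_right_mono add_mono norm_bcomp) auto
    finally show ?thesis by (simp add: algebra_simps)
  qed
  have "\<exists>!Y\<in>S. \<Psi> Y = Y"
  proof (rule Banach_fix)
    show "S \<noteq> {}"
      using X \<open>norm X \<le> \<rho>\<close> by (auto simp: S_def)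
    show "\<Psi> ` S \<subseteq> S"
    proof clarify
      fix Y assume "Y \<in> S"
      then have Y: "Y \<in> E" "badj Y = Y" "norm Y \<le> \<rho>" by (auto simp: S_def)
      have "norm (Y \<odot> Y) \<le> \<rho> * \<rho>"
        by (rule order_trans[OF norm_bcomp]) (intro mult_mono Y \<rho> norm_ge_zero)
      also have "\<dots> \<le> \<rho>" using \<rho> by (simp add: mult_left_le)
      finally have "norm (\<Psi> Y) \<le> \<rho>"
        using \<open>norm X \<le> \<rho>\<close> norm_triangle_ineq[of X "Y \<odot> Y"] by (simp add: \<Psi>_def)
      then show "\<Psi> Y \<in> S"
        using X Y E by (auto simp: S_def \<Psi>_def badj_scaleR badj_add badj_bcomp subspace_scale subspace_add)
    qed
    fix Y Z assume "Y \<in> S" "Z \<in> S"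
    then have "(norm Y + norm Z) / 2 \<le> \<rho>" by (auto simp: S_def)
    then show "dist (\<Psi> Y) (\<Psi> Z) \<le> \<rho> * dist Y Z"
      unfolding dist_norm by (rule order_trans[OF contr mult_right_mono]) simp
  qed fact+
  then obtain Y where "Y \<in> S" and fix_Y: "\<Psi> Y = Y" by auto
  then have Y: "Y \<in> E" "badj Y = Y" "norm Y \<le> \<rho>" by (auto simp: S_def)
  have square: "(bid - Z) \<odot> (bid - Z) = bid - X \<longleftrightarrow> \<Psi> Z = Z" for Z
  proof -
    have "(bid - Z) \<odot> (bid - Z) = bid - 2 *\<^sub>R Z + Z \<odot> Z"
      by (simp add: bcomp.diff_left bcomp.diff_right scaleR_2)
    also have "\<dots> = bid - X \<longleftrightarrow> X + Z \<odot> Z = 2 *\<^sub>R Z"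
      by (auto simp: algebra_simps)
    also have "\<dots> \<longleftrightarrow> \<Psi> Z = Z"
      unfolding \<Psi>_def by (metis (no_types) divide_self_if numeral_One scaleR_half_double scaleR_scaleR
          scaleR_one zero_neq_numeral times_divide_eq_right mult.right_neutral)
    finally show ?thesis .
  qed
  have k_eq: "k = c *\<^sub>R (bid - X)"
    using c by (simp add: X_def)
  define s where "s = sqrt c *\<^sub>R (bid - Y)"
  have "s \<in> E" "badj s = s"
    using E Y by (auto simp: s_def subspace_scale subspace_diff badj_scaleR badj_diff)
  moreover have "s \<odot> s = k"
    using fix_Y c unfolding square[symmetric] k_eq by (simp add: s_def bcomp.scaleR_left bcomp.scaleR_right)
  moreover have "0 \<le> inner v (s x v)" for x v
  proof -
    have "norm (Y x) \<le> 1" using Y(3) \<rho> norm_bounded[of Y x] by linarith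
    then have le: "norm (Y x) * (inner v v + inner v v) \<le> 1 * (inner v v + inner v v)"
      by (intro mult_right_mono) auto
    have "2 * \<bar>inner v (Y x v)\<bar> \<le> 2 * inner v v"
      using order_trans[OF inner_blinfun_le le] by simp
    then have "0 \<le> inner v v - inner v (Y x v)" by linarith
    then show ?thesis
      using c by (simp add: s_def blinfun.diff_left blinfun.scaleR_left inner_diff_right)
  qed
  moreover have "t = s" if t: "badj t = t" "\<And>x v. 0 \<le> inner v (t x v)" "t \<odot> t = k" for t
  proof -
    \<comment> \<open>The square of a root \<open>t\<close> is at most \<open>c\<close>, so
      \<open>Z\<close> lies between \<open>0\<close> and \<open>1\<close>; its norm may reach
      \<open>1\<close>, outside the ball on which \<open>\<Psi>\<close> is a contraction.\<close>
    define Z where "Z = bid - (1 / sqrt c) *\<^sub>R t"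
    have t_eq: "t = sqrt c *\<^sub>R (bid - Z)" using c by (simp add: Z_def)
    have "c *\<^sub>R ((bid - Z) \<odot> (bid - Z)) = c *\<^sub>R (bid - X)"
      using t(3) c unfolding t_eq k_eq by (simp add: bcomp.scaleR_left bcomp.scaleR_right)
    then have fix_Z: "\<Psi> Z = Z"
      using c unfolding square[symmetric] by simp
    have "norm Z \<le> 1"
    proof (rule norm_bound)
      fix x
      show "norm (Z x) \<le> 1"
      proof (rule norm_selfadjoint_le)
        show "adj (Z x) = Z x"
        proof -
          have "badj Z = Z" using t(1) by (simp add: Z_def badj_diff badj_scaleR)
          then show ?thesis by (metis badj_apply)
        qed
        fix v
        have "(norm (t x v))\<^sup>2 = inner v (t x (t x v))"
          using t(1) badj_apply[of t x] adj_inner_left[of "t x" v "t x v"]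
          by (simp add: power2_norm_eq_inner)
        also have "\<dots> = inner v (k x v)"
          using t(3) bcomp_apply[of t t x] by simp
        also have "\<dots> \<le> c * inner v v" by (rule upper)
        also have "\<dots> = (sqrt c * norm v)\<^sup>2"
          using c by (simp add: power_mult_distrib dot_square_norm)
        finally have "norm (t x v) \<le> sqrt c * norm v"
          by (rule power2_le_imp_le) (use c in simp)
        then have "norm v * norm (t x v) \<le> norm v * (sqrt c * norm v)"
          by (intro mult_left_mono) auto
        then have "inner v (t x v) \<le> sqrt c * inner v v"
          using order_trans[OF norm_cauchy_schwarz[of v "t x v"]]
          by (simp add: dot_square_norm power2_eq_square mult.left_commute)
        moreover have "inner v (Z x v) = inner v v - inner v (t x v) / sqrt c"
          by (simp add: Z_def blinfun.diff_left blinfun.scaleR_left inner_diff_right)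
        moreover have "0 \<le> inner v (t x v) / sqrt c"
          using t(2)[of v x] c by simp
        moreover have "inner v (t x v) / sqrt c \<le> inner v v"
          using calculation(1) c by (simp add: divide_le_eq mult.commute)
        ultimately show "\<bar>inner v (Z x v)\<bar> \<le> 1 * inner v v"
          by simp
      qed simp
    qed
    \<comment> \<open>\<open>\<Psi>\<close> scales distances by at most the mean of the two norms,
      so it is enough that \<open>Y\<close> alone has norm below \<open>1\<close>.\<close>
    then have le: "(norm Y + norm Z) / 2 \<le> (1 + \<rho>) / 2"
      using Y(3) by simp
    have "norm (Y - Z) \<le> (1 + \<rho>) / 2 * norm (Y - Z)"
      using order_trans[OF contr[of Y Z] mult_right_mono[OF le norm_ge_zero]] fix_Y fix_Z by simp
    then have "(1 - (1 + \<rho>) / 2) * norm (Y - Z) \<le> 0"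
      by (simp only: left_diff_distrib mult_1_left diff_le_0_iff_le)
    then have "norm (Y - Z) = 0"
      using \<rho> by (simp add: mult_le_0_iff)
    then show ?thesis by (simp add: t_eq s_def)
  qed
  ultimately show ?thesis by blast
qed

section \<open>Transfer operators along contractions\<close>

text \<open>\<open>nets\<close> expresses compactness of the base: up to a translate
  \<open>x'\<close>, at which all functions of \<open>E\<close> have the same norm as at
  \<open>x\<close>, every point is near a finite set. The functions themselves may differ at
  \<open>x\<close> and \<open>x'\<close>.\<close>

locale contracting_transfer = power_bounded_operator E R C
  for E :: "('x::metric_space \<Rightarrow>\<^sub>C ('v::euclidean_space \<Rightarrow>\<^sub>L 'v)) set" and R and C :: real +
  fixes I :: "'i set" and \<psi> :: "'i \<Rightarrow> 'x \<Rightarrow> 'x" and \<mu> :: "'i \<Rightarrow> 'x \<Rightarrow> 'v \<Rightarrow>\<^sub>L 'v" and \<theta> L :: real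
  assumes finite_I: "finite I"
    and R_apply: "f \<in> E \<Longrightarrow> R f x = (\<Sum>i\<in>I. adj (\<mu> i x) o\<^sub>L (f (\<psi> i x) o\<^sub>L \<mu> i x))"
    and bid_in: "bid \<in> E"
    and bcomp_in: "f \<in> E \<Longrightarrow> g \<in> E \<Longrightarrow> f \<odot> g \<in> E"
    and badj_in: "f \<in> E \<Longrightarrow> badj f \<in> E"
    and \<theta>: "0 < \<theta>" "\<theta> < 1"
    and \<psi>_contract: "i \<in> I \<Longrightarrow> dist (\<psi> i x) (\<psi> i y) \<le> \<theta> * dist x y"
    and \<mu>_lipschitz: "i \<in> I \<Longrightarrow> norm (\<mu> i x - \<mu> i y) \<le> L * dist x y"
    and \<mu>_bound: "i \<in> I \<Longrightarrow> norm (\<mu> i x) \<le> L"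
    and L_nonneg: "0 \<le> L"
    and uniformly_continuous: "f \<in> E \<Longrightarrow> 0 < e \<Longrightarrow> \<exists>d>0. \<forall>x y. dist x y \<le> d \<longrightarrow> norm (f x - f y) \<le> e"
    and nets: "0 < d \<Longrightarrow> \<exists>P. finite P \<and>
      (\<forall>x. \<exists>y\<in>P. \<exists>x'. dist y x' \<le> d \<and> (\<forall>f\<in>E. norm (f x) = norm (f x')))"
begin

text \<open>The analogue of \<open>R\<close> for functions of two points. Both coefficients are
  taken at the first point, so that the weights are those of \<open>R\<close> at \<open>x\<close>;
  \<open>defect\<close> collects the cost of exchanging \<open>\<mu> i y\<close> for
  \<open>\<mu> i x\<close>.\<close>

definition twopoint :: "('x \<Rightarrow> 'x \<Rightarrow> 'v \<Rightarrow>\<^sub>L 'v) \<Rightarrow> 'x \<Rightarrow> 'x \<Rightarrow> 'v \<Rightarrow>\<^sub>L 'v" where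
  "twopoint g x y = (\<Sum>i\<in>I. adj (\<mu> i x) o\<^sub>L (g (\<psi> i x) (\<psi> i y) o\<^sub>L \<mu> i x))"

definition defect :: "('x \<Rightarrow>\<^sub>C ('v \<Rightarrow>\<^sub>L 'v)) \<Rightarrow> 'x \<Rightarrow> 'x \<Rightarrow> 'v \<Rightarrow>\<^sub>L 'v" where
  "defect f x y = (\<Sum>i\<in>I. (adj (\<mu> i x) o\<^sub>L (f (\<psi> i y) o\<^sub>L \<mu> i x)) -
      (adj (\<mu> i y) o\<^sub>L (f (\<psi> i y) o\<^sub>L \<mu> i y)))"

definition defect_const :: real where "defect_const = card I * (2 * L * L)"

text \<open>The geometric sum over \<open>j\<close> of the defects seen at distance
  \<open>\<theta> ^ j * dist x y\<close>, each carried along at the price of a factor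
  \<open>C\<close>.\<close>

definition lip_const :: real where "lip_const = C * defect_const / (1 - \<theta>)"

lemma defect_const_nonneg: "0 \<le> defect_const"
  and lip_const_nonneg: "0 \<le> lip_const"
  using L_nonneg C_nonneg \<theta> by (auto simp: defect_const_def lip_const_def)

lemma defect_norm: "norm (defect f x y) \<le> defect_const * dist x y * norm f"
proof -
  have "norm ((adj (\<mu> i x) o\<^sub>L (f (\<psi> i y) o\<^sub>L \<mu> i x)) - (adj (\<mu> i y) o\<^sub>L (f (\<psi> i y) o\<^sub>L \<mu> i y)))
      \<le> (2 * L * L) * dist x y * norm f" (is "norm (?a - ?b) \<le> _") if i: "i \<in> I" for i
  proof -
    have eq: "?a - ?b = (adj (\<mu> i x) o\<^sub>L (f (\<psi> i y) o\<^sub>L (\<mu> i x - \<mu> i y))) +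
        (adj (\<mu> i x - \<mu> i y) o\<^sub>L (f (\<psi> i y) o\<^sub>L \<mu> i y))"
      by (simp add: adj_diff blinfun_compose.diff_left blinfun_compose.diff_right)
    have "norm (?a - ?b) \<le> L * (norm f * (L * dist x y)) + (L * dist x y) * (norm f * L)"
      unfolding eq using i
      by (intro norm_triangle_le add_mono norm_compose3_le norm_bounded) (auto simp: \<mu>_bound \<mu>_lipschitz)
    then show ?thesis by (simp add: algebra_simps)
  qed
  then have "norm (defect f x y) \<le> card I * ((2 * L * L) * dist x y * norm f)"
    unfolding defect_def by (intro sum_norm_bound)
  then show ?thesis by (simp add: defect_const_def algebra_simps)
qed

lemma R_difference:
  "f \<in> E \<Longrightarrow> (\<lambda>x y. R f x - R f y) = (\<lambda>x y. twopoint (\<lambda>x y. f x - f y) x y + defect f x y)"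
  by (intro ext) (simp add: R_apply twopoint_def defect_def blinfun_compose.diff_left
      blinfun_compose.diff_right flip: sum_subtractf sum.distrib)

lemma twopoint_add: "twopoint (\<lambda>x y. g x y + k x y) = (\<lambda>x y. twopoint g x y + twopoint k x y)"
  by (intro ext) (simp add: twopoint_def blinfun_compose.add_left blinfun_compose.add_right sum.distrib)

lemma twopoint_pow_add:
  "(twopoint ^^ n) (\<lambda>x y. g x y + k x y) = (\<lambda>x y. (twopoint ^^ n) g x y + (twopoint ^^ n) k x y)"
  by (induction n) (simp_all add: twopoint_add)

text \<open>By positivity the iterates of \<open>twopoint\<close> are dominated by those of \<open>R\<close> on the identity.\<close>

lemma twopoint_pow_form:
  assumes "\<And>x y. dist x y \<le> \<theta> ^ n * d \<Longrightarrow> norm (g x y) \<le> b" and "dist x y \<le> d"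
  shows "2 * \<bar>inner u ((twopoint ^^ n) g x y v)\<bar> \<le>
    b * (inner u ((R ^^ n) bid x u) + inner v ((R ^^ n) bid x v))"
  using assms
proof (induction n arbitrary: x y d u v)
  case 0
  then have "norm (g x y) \<le> b" by simp
  then have "norm (g x y) * (inner u u + inner v v) \<le> b * (inner u u + inner v v)"
    by (intro mult_right_mono) auto
  then show ?case
    using inner_blinfun_le[of u "g x y" v] by (simp add: algebra_simps)
next
  case (Suc n)
  let ?w = "(R ^^ n) bid"
  have 1: "2 * \<bar>inner u' ((twopoint ^^ n) g (\<psi> i x) (\<psi> i y) v')\<bar> \<le>
      b * (inner u' (?w (\<psi> i x) u') + inner v' (?w (\<psi> i x) v'))" if i: "i \<in> I" for i u' v'
  proof -
    have "dist (\<psi> i x) (\<psi> i y) \<le> \<theta> * d"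
      using order_trans[OF \<psi>_contract[OF i, of x y] mult_left_mono[OF Suc.prems(2), of \<theta>]] \<theta> by simp
    from Suc.IH[OF _ this, of u' v'] Suc.prems(1) show ?thesis
      by (simp add: algebra_simps)
  qed
  have "2 * \<bar>inner u ((twopoint ^^ Suc n) g x y v)\<bar> =
      2 * \<bar>\<Sum>i\<in>I. inner (\<mu> i x u) ((twopoint ^^ n) g (\<psi> i x) (\<psi> i y) (\<mu> i x v))\<bar>"
    by (simp add: twopoint_def blinfun.sum_left inner_sum_right adj_inner_right)
  also have "\<dots> \<le> (\<Sum>i\<in>I. 2 * \<bar>inner (\<mu> i x u) ((twopoint ^^ n) g (\<psi> i x) (\<psi> i y) (\<mu> i x v))\<bar>)"
    using sum_abs[of "\<lambda>i. inner (\<mu> i x u) ((twopoint ^^ n) g (\<psi> i x) (\<psi> i y) (\<mu> i x v))" I]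
    by (simp flip: sum_distrib_left)
  also have "\<dots> \<le> (\<Sum>i\<in>I. b * (inner (\<mu> i x u) (?w (\<psi> i x) (\<mu> i x u)) +
      inner (\<mu> i x v) (?w (\<psi> i x) (\<mu> i x v))))"
    by (intro sum_mono 1)
  also have "\<dots> = b * (inner u (R ?w x u) + inner v (R ?w x v))"
    by (simp add: R_apply R_pow_in bid_in blinfun.sum_left inner_sum_right adj_inner_right
        sum.distrib flip: sum_distrib_left)
  finally show ?case by (simp add: algebra_simps)
qed

text \<open>The bound does not grow with \<open>n\<close> because the weights add up to
  \<open>(R ^^ n) bid\<close>, of norm at most \<open>C\<close>. Smallness of \<open>g\<close> is
  required only at scale \<open>\<theta> ^ n * d\<close>, since the branches have contracted the
  pair by then.\<close>

lemma twopoint_pow_norm: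
  assumes g: "\<And>x y. dist x y \<le> \<theta> ^ n * d \<Longrightarrow> norm (g x y) \<le> b" and xy: "dist x y \<le> d" and b: "0 \<le> b"
  shows "norm ((twopoint ^^ n) g x y) \<le> C * b"
proof (rule norm_blinfun_le_form)
  fix u v
  have w: "inner u ((R ^^ n) bid x u) \<le> C * inner u u" for u
  proof -
    have "norm ((R ^^ n) bid x) \<le> C * 1"
      by (rule order_trans[OF order_trans[OF norm_bounded R_pow_bound[OF bid_in]] mult_left_mono])
        (auto intro: norm_bound norm_blinfun_id_le C_nonneg)
    then have le: "norm ((R ^^ n) bid x) * (inner u u + inner u u) \<le> (C * 1) * (inner u u + inner u u)"
      by (intro mult_right_mono) auto
    from order_trans[OF inner_blinfun_le le] show ?thesis by simp
  qed
  have "2 * inner u ((twopoint ^^ n) g x y v) \<le>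
      b * (inner u ((R ^^ n) bid x u) + inner v ((R ^^ n) bid x v))"
    using twopoint_pow_form[of n d g b x y u v] g xy by (simp add: algebra_simps)
  also have "\<dots> \<le> b * (C * inner u u + C * inner v v)"
    by (intro mult_left_mono add_mono w b)
  finally show "2 * inner u ((twopoint ^^ n) g x y v) \<le> C * b * (inner u u + inner v v)"
    by (simp add: algebra_simps)
qed (use C_nonneg b in auto)

text \<open>A Duhamel expansion: each step from \<open>R\<close> to \<open>twopoint\<close> leaves a
  defect, which the remaining \<open>j\<close> iterates of \<open>twopoint\<close> evaluate at pairs
  at distance at most \<open>\<theta> ^ j * d\<close>. The bound \<open>M\<close> is assumed for all
  iterates so that it passes from \<open>f\<close> to \<open>R f\<close> in the induction.\<close>

lemma pow_difference:
  assumes "f \<in> E" "\<And>k. norm ((R ^^ k) f) \<le> M" "dist x y \<le> d"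
  shows "norm (((R ^^ n) f x - (R ^^ n) f y) - (twopoint ^^ n) (\<lambda>x y. f x - f y) x y)
    \<le> (\<Sum>j<n. C * (defect_const * (\<theta> ^ j * d) * M))"
  using assms
proof (induction n arbitrary: f)
  case (Suc n)
  have M: "0 \<le> M" using Suc.prems(2) norm_ge_zero order_trans by blast
  have d: "0 \<le> d" using Suc.prems(3) zero_le_dist order_trans by blast
  let ?D = "\<lambda>f x y. apply_bcontfun f x - apply_bcontfun f y"
  have IH: "norm (((R ^^ n) (R f) x - (R ^^ n) (R f) y) - (twopoint ^^ n) (?D (R f)) x y)
      \<le> (\<Sum>j<n. C * (defect_const * (\<theta> ^ j * d) * M))"
    using Suc.prems Suc.prems(2)[of "Suc k" for k]
    by (intro Suc.IH) (auto simp: R_in funpow_Suc_right simp del: funpow.simps)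
  have "(twopoint ^^ n) (?D (R f)) x y = (twopoint ^^ Suc n) (?D f) x y + (twopoint ^^ n) (defect f) x y"
    unfolding R_difference[OF Suc.prems(1)] twopoint_pow_add by (simp add: funpow_swap1)
  moreover have "norm ((twopoint ^^ n) (defect f) x y) \<le> C * (defect_const * (\<theta> ^ n * d) * M)"
  proof (rule twopoint_pow_norm[OF _ Suc.prems(3)])
    fix x' y' :: 'x assume "dist x' y' \<le> \<theta> ^ n * d"
    then show "norm (defect f x' y') \<le> defect_const * (\<theta> ^ n * d) * M"
      using Suc.prems(2)[of 0] M defect_const_nonneg d \<theta>
      by (intro order_trans[OF defect_norm] mult_mono) auto
  qed (use M d \<theta> defect_const_nonneg in auto)
  ultimately show ?case
    using IH norm_triangle_ineq4 by (simp add: funpow_swap1)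
      (smt (verit, best) add_diff_cancel_right' diff_diff_eq2 norm_triangle_ineq diff_add_eq norm_triangle_sub)
qed simp

text \<open>An inequality of Doeblin-Fortet (Lasota-Yorke) type: the oscillation of \<open>f\<close>
  enters only at scale \<open>\<theta> ^ n * d\<close>, and the Lipschitz term is uniform in
  \<open>n\<close>.\<close>

lemma pow_modulus:
  assumes f: "f \<in> E" and g: "\<And>x y. dist x y \<le> \<theta> ^ n * d \<Longrightarrow> norm (f x - f y) \<le> b"
    and xy: "dist x y \<le> d" and b: "0 \<le> b"
  shows "norm ((R ^^ n) f x - (R ^^ n) f y) \<le> C * b + lip_const * (C * norm f) * d"
proof -
  have d: "0 \<le> d" using xy zero_le_dist order_trans by blast
  let ?S = "(twopoint ^^ n) (\<lambda>x y. f x - f y) x y"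
  have "norm (((R ^^ n) f x - (R ^^ n) f y) - ?S)
      \<le> (\<Sum>j<n. C * (defect_const * (\<theta> ^ j * d) * (C * norm f)))"
    by (rule pow_difference[OF f R_pow_bound[OF f] xy])
  also have "\<dots> = (C * defect_const * (C * norm f) * d) * (\<Sum>j<n. \<theta> ^ j)"
    by (simp add: sum_distrib_left ac_simps)
  also have "\<dots> \<le> (C * defect_const * (C * norm f) * d) * (1 / (1 - \<theta>))"
    using \<theta> C_nonneg defect_const_nonneg d
    by (intro mult_left_mono) (auto simp: sum_gp_strict divide_right_mono)
  also have "\<dots> = lip_const * (C * norm f) * d"
    by (simp add: lip_const_def)
  finally have "norm (((R ^^ n) f x - (R ^^ n) f y) - ?S) \<le> lip_const * (C * norm f) * d" .
  moreover have "norm ?S \<le> C * b"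
    by (rule twopoint_pow_norm[OF g xy b])
  ultimately show ?thesis
    using norm_triangle_sub[of "(R ^^ n) f x - (R ^^ n) f y" ?S] by linarith
qed

text \<open>Since \<open>f = (R ^^ n) f\<close>, letting \<open>n\<close> grow removes the
  oscillation term of \<open>pow_modulus\<close>: uniform continuity improves to a Lipschitz
  bound.\<close>

lemma fixed_lipschitz:
  assumes f: "f \<in> E" and Rf: "R f = f"
  shows "norm (f x - f y) \<le> lip_const * (C * norm f) * dist x y"
proof (rule field_le_epsilon)
  fix e :: real assume e: "0 < e"
  define e' where "e' = e / (C + 1)"
  have e': "0 < e'" "C * e' \<le> e" using e C_nonneg by (auto simp: e'_def field_simps)
  obtain d where d: "d > 0" "\<And>(x :: 'x) y. dist x y \<le> d \<Longrightarrow> norm (f x - f y) \<le> e'"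
    using uniformly_continuous[OF f e'(1)] by blast
  have "(\<lambda>n. \<theta> ^ n * dist x y) \<longlonglongrightarrow> 0"
    using \<theta> by (intro tendsto_mult_left_zero LIMSEQ_power_zero) auto
  then have "eventually (\<lambda>n. \<theta> ^ n * dist x y < d) sequentially"
    using d(1) by (rule order_tendstoD)
  then obtain n where n: "\<theta> ^ n * dist x y < d"
    by (auto simp: eventually_sequentially)
  have "norm ((R ^^ n) f x - (R ^^ n) f y) \<le> C * e' + lip_const * (C * norm f) * dist x y"
    using n d e' by (intro pow_modulus f) auto
  then show "norm (f x - f y) \<le> lip_const * (C * norm f) * dist x y + e"
    using e' by (simp add: R_pow_fixed[OF Rf])
qed

section \<open>Compactness of the averages\<close>

lemma cesaro_equicontinuous:
  assumes f: "f \<in> E" and e: "0 < e"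
  shows "\<exists>d>0. \<forall>n x y. dist x y \<le> d \<longrightarrow> norm (cesaro n f x - cesaro n f y) \<le> e"
proof -
  define e' where "e' = e / (2 * (C + 1))"
  have e': "0 < e'" "C * e' \<le> e / 2" using e C_nonneg by (auto simp: e'_def field_simps)
  obtain d where d: "d > 0" "\<And>(x :: 'x) y. dist x y \<le> d \<Longrightarrow> norm (f x - f y) \<le> e'"
    using uniformly_continuous[OF f e'(1)] by blast
  define K where "K = lip_const * (C * norm f)"
  have K: "0 \<le> K" using lip_const_nonneg C_nonneg by (simp add: K_def)
  define d' where "d' = min d (e / (2 * (K + 1)))"
  have d': "0 < d'" "d' \<le> d" "K * d' \<le> e / 2"
  proof -
    show "0 < d'" "d' \<le> d" using d e K by (auto simp: d'_def)
    have "K * d' \<le> K * (e / (2 * (K + 1)))"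
      using K by (intro mult_left_mono) (auto simp: d'_def)
    also have "\<dots> \<le> e / 2" using K e by (simp add: field_simps)
    finally show "K * d' \<le> e / 2" .
  qed
  have pow: "norm ((R ^^ n) f x - (R ^^ n) f y) \<le> e" if xy: "dist x y \<le> d'" for n x y
  proof -
    have le: "\<theta> ^ n * d' \<le> 1 * d'"
      using \<theta> d' by (intro mult_right_mono power_le_one) auto
    have "norm ((R ^^ n) f x - (R ^^ n) f y) \<le> C * e' + K * d'"
      unfolding K_def using d'(2) e' xy le by (intro pow_modulus f d(2)) auto
    then show ?thesis using e' d' by simp
  qed
  have "norm (cesaro n f x - cesaro n f y) \<le> e" if xy: "dist x y \<le> d'" for n x y
  proof (cases "n = 0")
    case False
    have "cesaro n f x - cesaro n f y = (1 / real n) *\<^sub>R (\<Sum>j=1..n. (R ^^ j) f x - (R ^^ j) f y)"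
      by (simp add: cesaro_def apply_bcontfun_sum sum_subtractf scaleR_right_diff_distrib)
    moreover have "norm (\<Sum>j=1..n. (R ^^ j) f x - (R ^^ j) f y) \<le> real (card {1..n}) * e"
      by (intro sum_norm_bound pow xy)
    ultimately show ?thesis using False by (simp add: field_simps)
  qed (use e in \<open>simp add: cesaro_def\<close>)
  then show ?thesis using d' by blast
qed

text \<open>Arzela-Ascoli over a noncompact space. Values at \<open>x\<close> cannot be compared
  with those at its translate \<open>x'\<close>, but the difference \<open>F n - F m\<close> lies in
  \<open>E\<close>, so its norm can; hence closeness on the finite net is enough.\<close>

lemma equicontinuous_subsequence:
  fixes F :: "nat \<Rightarrow> 'x \<Rightarrow>\<^sub>C ('v \<Rightarrow>\<^sub>L 'v)"
  assumes F: "\<And>n. F n \<in> E" and M: "\<And>n. norm (F n) \<le> M"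
    and equi: "\<And>e. 0 < e \<Longrightarrow> \<exists>d>0. \<forall>n x y. dist x y \<le> d \<longrightarrow> norm (F n x - F n y) \<le> e"
  shows "\<exists>s g. strict_mono (s :: nat \<Rightarrow> nat) \<and> (\<lambda>k. F (s k)) \<longlonglongrightarrow> g"
proof -
  have net: "\<exists>N. finite N \<and> (\<forall>n. \<exists>m\<in>N. norm (F n - F m) \<le> e)" if e: "0 < e" for e
  proof -
    obtain d where d: "d > 0" "\<And>n (x :: 'x) y. dist x y \<le> d \<Longrightarrow> norm (F n x - F n y) \<le> e / 4"
      using equi[of "e / 4"] e by auto
    obtain P where P: "finite P"
      "\<And>x. \<exists>y\<in>P. \<exists>x'. dist y x' \<le> d \<and> (\<forall>f\<in>E. norm (f x) = norm (f x'))"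
      using nets[OF d(1)] by blast
    have "compact (cball (0 :: 'v \<Rightarrow>\<^sub>L 'v) M)" by simp
    then obtain Q where Q: "finite Q" "cball (0 :: 'v \<Rightarrow>\<^sub>L 'v) M \<subseteq> (\<Union>q\<in>Q. ball q (e / 4))"
      unfolding compact_eq_totally_bounded using e by (meson zero_less_divide_iff zero_less_numeral)
    have "\<exists>q\<in>Q. dist q (F n y) < e / 4" for n y
      using Q(2) order_trans[OF norm_bounded M] by (force simp: mem_ball)
    then obtain c where c: "\<And>n y. c n y \<in> Q" "\<And>n y. dist (c n y) (F n y) < e / 4"
      by metis
    \<comment> \<open>The approximate values on the net form only finitely many patterns; one index
      per pattern gives the finite set \<open>N\<close>.\<close>
    define c' where "c' n = restrict (c n) P" for n
    have "range c' \<subseteq> P \<rightarrow>\<^sub>E Q" using c(1) by (auto simp: c'_def)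
    then have fin: "finite (range c')"
      using P(1) Q(1) by (meson finite_PiE finite_subset)
    define N where "N = (\<lambda>v. SOME n. c' n = v) ` range c'"
    have "\<exists>m\<in>N. norm (F n - F m) \<le> e" for n
    proof -
      define m where "m = (SOME m. c' m = c' n)"
      have m: "c' m = c' n" unfolding m_def by (rule someI) simp
      have "norm (F n x - F m x) \<le> e" for x
      proof -
        obtain y x' where y: "y \<in> P" "dist y x' \<le> d" and inv: "\<And>f. f \<in> E \<Longrightarrow> norm (f x) = norm (f x')"
          using P(2) by blast
        have "c n y = c m y" using m y(1) by (metis c'_def restrict_apply')
        then have "dist (F n y) (F m y) < e / 4 + e / 4"
          using c(2)[of n y] c(2)[of m y] dist_triangle[of "F n y" "F m y" "c n y"]
          by (simp add: dist_commute)
        then have 1: "norm (F n y - F m y) \<le> e / 2" by (simp add: dist_norm)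
        have "norm (F n x - F m x) = norm (F n x' - F m x')"
          using inv[OF E_diff[OF F F], of n m] by simp
        also have "F n x' - F m x' = (F n y - F m y) - ((F n y - F n x') - (F m y - F m x'))"
          by simp
        also have "norm \<dots> \<le> norm (F n y - F m y) + (norm (F n y - F n x') + norm (F m y - F m x'))"
          by (meson add_left_mono norm_triangle_ineq4 order_trans)
        also have "\<dots> \<le> e / 2 + (e / 4 + e / 4)"
          by (intro add_mono 1 d(2) y(2))
        finally show ?thesis by simp
      qed
      then have "norm (F n - F m) \<le> e"
        by (intro norm_bound) simp
      then show ?thesis unfolding N_def m_def by blast
    qed
    moreover have "finite N" using fin by (simp add: N_def)
    ultimately show ?thesis by blast
  qed
  have "compact (closure (range F))"
    unfolding compact_eq_totally_bounded
  proof (intro conjI allI impI)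
    show "complete (closure (range F))" by (simp add: complete_eq_closed)
    fix e :: real assume e: "0 < e"
    obtain N where N: "finite N" "\<And>n. \<exists>m\<in>N. norm (F n - F m) \<le> e / 2"
      using net[of "e / 2"] e by auto
    have "range F \<subseteq> (\<Union>m\<in>N. cball (F m) (e / 2))"
    proof (clarify)
      fix n
      from N(2)[of n] show "F n \<in> (\<Union>m\<in>N. cball (F m) (e / 2))"
        by (auto simp: dist_norm norm_minus_commute)
    qed
    then have "closure (range F) \<subseteq> (\<Union>m\<in>N. cball (F m) (e / 2))"
      using N(1) by (intro closure_minimal closed_UN) auto
    also have "\<dots> \<subseteq> (\<Union>g\<in>F ` N. ball g e)"
      using e by force
    finally show "\<exists>k. finite k \<and> closure (range F) \<subseteq> (\<Union>g\<in>k. ball g e)"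
      using N(1) by blast
  qed
  then have "seq_compact (closure (range F))"
    by (rule compact_imp_seq_compact)
  then obtain l r where "strict_mono (r :: nat \<Rightarrow> nat)" "(F \<circ> r) \<longlonglongrightarrow> l"
    unfolding seq_compact_def by (metis closure_subset rangeI subset_iff)
  then show ?thesis by (auto simp: o_def)
qed

lemma cesaro_subsequence:
  "f \<in> E \<Longrightarrow> \<exists>s g. strict_mono (s :: nat \<Rightarrow> nat) \<and> (\<lambda>k. cesaro (s k) f) \<longlonglongrightarrow> g"
  by (rule equicontinuous_subsequence[OF cesaro_in cesaro_norm cesaro_equicontinuous])

sublocale mean_ergodic E R C
  by unfold_locales (rule cesaro_subsequence)

section \<open>Finite dimension of the space of harmonic functions\<close>

definition fixed :: "('x \<Rightarrow>\<^sub>C ('v \<Rightarrow>\<^sub>L 'v)) set" where "fixed = {f \<in> E. R f = f}"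

lemma subspace_fixed: "subspace fixed"
  by (auto simp: subspace_def fixed_def R_zero R_add R_scaleR E_zero E_add E_scaleR)

lemma finite_dim_fixed: "\<exists>B. finite B \<and> B \<subseteq> fixed \<and> fixed \<subseteq> span B"
proof -
  define K where "K = lip_const * C"
  have K: "0 \<le> K" using lip_const_nonneg C_nonneg by (simp add: K_def)
  \<comment> \<open>With \<open>K * d \<le> 1 / 2\<close>, a fixed function that vanishes on the net
    satisfies \<open>norm f \<le> norm f / 2\<close>.\<close>
  define d where "d = 1 / (2 * (K + 1))"
  have d: "0 < d" "K * d \<le> 1 / 2" using K by (auto simp: d_def field_simps)
  obtain P where P: "finite P"
    "\<And>x. \<exists>y\<in>P. \<exists>x'. dist y x' \<le> d \<and> (\<forall>f\<in>E. norm (f x) = norm (f x'))"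
    using nets[OF d(1)] by blast
  define Ls where "Ls = (\<lambda>(y, b, b') f. inner b' (blinfun_apply (apply_bcontfun f y) b)) ` (P \<times> (Basis :: 'v set) \<times> (Basis :: 'v set))"
  show ?thesis
  proof (rule finite_span_of_separating_functionals[of Ls])
    show "finite Ls" using P(1) by (simp add: Ls_def)
    show "linear l" if "l \<in> Ls" for l
      using that by (auto simp: Ls_def blinfun.add_left inner_add_right blinfun.scaleR_left intro!: linearI)
    show "subspace fixed" by (rule subspace_fixed)
    fix f assume "f \<in> fixed" and 0: "\<forall>l\<in>Ls. l f = 0"
    then have f: "f \<in> E" "R f = f" by (auto simp: fixed_def)
    have fy: "f y = 0" if y: "y \<in> P" for y
    proof (rule blinfun_euclidean_eqI)
      fix b :: 'v assume b: "b \<in> Basis"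
      have "inner b' (f y b) = 0" if "b' \<in> Basis" for b'
        using 0 y b that by (force simp: Ls_def)
      then show "f y b = (0 :: 'v \<Rightarrow>\<^sub>L 'v) b"
        by (metis blinfun.zero_left euclidean_all_zero_iff inner_commute)
    qed
    have "norm f \<le> norm f / 2"
    proof (rule norm_bound)
      fix x
      obtain y x' where y: "y \<in> P" "dist y x' \<le> d" and inv: "norm (f x) = norm (f x')"
        using P(2) f(1) by blast
      have "norm (f x) = norm (f y - f x')"
        by (simp add: inv fy y)
      also have "\<dots> \<le> lip_const * (C * norm f) * dist y x'"
        by (rule fixed_lipschitz[OF f])
      also have "\<dots> \<le> (K * norm f) * d"
        unfolding K_def mult.assoc[of lip_const] using lip_const_nonneg C_nonneg y
        by (intro mult_left_mono) auto
      also have "\<dots> \<le> norm f / 2"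
        using mult_right_mono[OF d(2), of "norm f"] by (simp add: ac_simps)
      finally show "norm (f x) \<le> norm f / 2" .
    qed
    then show "f = 0" by simp
  qed
qed

end

section \<open>The Choi-Effros product on the fixed points\<close>

context contracting_transfer
begin

abbreviation qform :: "nat \<Rightarrow> (nat \<Rightarrow> nat \<Rightarrow> 'x \<Rightarrow>\<^sub>C ('v \<Rightarrow>\<^sub>L 'v)) \<Rightarrow> 'x \<Rightarrow> (nat \<Rightarrow> 'v) \<Rightarrow> real" where
  "qform n f x v \<equiv> (\<Sum>j<n. \<Sum>l<n. inner (v j) (f j l x (v l)))"

text \<open>Only the real quadratic form is constrained and no symmetry is asked for, so a matrix
  with a single off-diagonal corner is admissible.\<close>

definition positive_matrix :: "nat \<Rightarrow> (nat \<Rightarrow> nat \<Rightarrow> 'x \<Rightarrow>\<^sub>C ('v \<Rightarrow>\<^sub>L 'v)) \<Rightarrow> bool" where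
  "positive_matrix n f \<longleftrightarrow> (\<forall>x v. 0 \<le> (qform n f x v))"

text \<open>Complete positivity: each branch compresses all entries by the same operator
  \<open>\<mu> i x\<close>, that is, it evaluates the form at the vectors
  \<open>\<mu> i x (v j)\<close>.\<close>

lemma positive_R:
  assumes "\<And>j l. j < n \<Longrightarrow> l < n \<Longrightarrow> f j l \<in> E" "positive_matrix n f"
  shows "positive_matrix n (\<lambda>j l. R (f j l))"
  unfolding positive_matrix_def
proof (intro allI)
  fix x and v :: "nat \<Rightarrow> 'v"
  have "qform n (\<lambda>j l. R (f j l)) x v =
      (\<Sum>j<n. \<Sum>l<n. \<Sum>i\<in>I. inner (\<mu> i x (v j)) (f j l (\<psi> i x) (\<mu> i x (v l))))"
    using assms(1)
    by (intro sum.cong refl) (simp add: R_apply blinfun.sum_left inner_sum_right adj_inner_right)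
  also have "\<dots> = (\<Sum>j<n. \<Sum>i\<in>I. \<Sum>l<n. inner (\<mu> i x (v j)) (f j l (\<psi> i x) (\<mu> i x (v l))))"
    by (intro sum.cong refl sum.swap)
  also have "\<dots> = (\<Sum>i\<in>I. \<Sum>j<n. \<Sum>l<n. inner (\<mu> i x (v j)) (f j l (\<psi> i x) (\<mu> i x (v l))))"
    by (rule sum.swap)
  also have "\<dots> \<ge> 0"
  proof (rule sum_nonneg)
    fix i
    show "0 \<le> (\<Sum>j<n. \<Sum>l<n. inner (\<mu> i x (v j)) (f j l (\<psi> i x) (\<mu> i x (v l))))"
      using assms(2)[unfolded positive_matrix_def, rule_format, of "\<lambda>j. \<mu> i x (v j)" "\<psi> i x"]
      by simp
  qed
  finally show "0 \<le> qform n (\<lambda>j l. R (f j l)) x v" .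
qed

lemma positive_R_pow:
  assumes "\<And>j l. j < n \<Longrightarrow> l < n \<Longrightarrow> f j l \<in> E" "positive_matrix n f"
  shows "positive_matrix n (\<lambda>j l. (R ^^ k) (f j l))"
proof (induction k)
  case (Suc k)
  then show ?case
    using positive_R[of n "\<lambda>j l. (R ^^ k) (f j l)"] assms(1) by (simp add: R_pow_in)
qed (simp add: assms)

lemma positive_T:
  assumes f: "\<And>j l. j < n \<Longrightarrow> l < n \<Longrightarrow> f j l \<in> E" and pos: "positive_matrix n f"
  shows "positive_matrix n (\<lambda>j l. T (f j l))"
  unfolding positive_matrix_def
proof (intro allI)
  fix x and v :: "nat \<Rightarrow> 'v"
  have apply_lim: "(\<lambda>N. inner u (cesaro N g x w)) \<longlonglongrightarrow> inner u (T g x w)" if "g \<in> E" for g u w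
    by (intro tendsto_inner tendsto_const blinfun.tendsto
        bounded_linear.tendsto[OF bounded_linear_apply_bcontfun] cesaro_T that)
  have "(\<lambda>N. \<Sum>j<n. \<Sum>l<n. inner (v j) (cesaro N (f j l) x (v l)))
      \<longlonglongrightarrow> qform n (\<lambda>j l. T (f j l)) x v"
    by (intro tendsto_sum apply_lim f) auto
  moreover have "0 \<le> qform n (\<lambda>j l. cesaro N (f j l)) x v" for N
  proof -
    have "qform n (\<lambda>j l. cesaro N (f j l)) x v =
        (1 / real N) * (\<Sum>j<n. \<Sum>l<n. \<Sum>i=1..N. inner (v j) ((R ^^ i) (f j l) x (v l)))"
      by (simp add: cesaro_def apply_bcontfun_sum blinfun.scaleR_left blinfun.sum_left
          inner_sum_right sum_distrib_left)
    also have "(\<Sum>j<n. \<Sum>l<n. \<Sum>i=1..N. inner (v j) ((R ^^ i) (f j l) x (v l))) =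
        (\<Sum>j<n. \<Sum>i=1..N. \<Sum>l<n. inner (v j) ((R ^^ i) (f j l) x (v l)))"
      by (intro sum.cong refl sum.swap)
    also have "\<dots> = (\<Sum>i=1..N. \<Sum>j<n. \<Sum>l<n. inner (v j) ((R ^^ i) (f j l) x (v l)))"
      by (rule sum.swap)
    also have "0 \<le> (1 / real N) * \<dots>"
    proof (intro mult_nonneg_nonneg)
      show "0 \<le> (\<Sum>i=1..N. \<Sum>j<n. \<Sum>l<n. inner (v j) ((R ^^ i) (f j l) x (v l)))"
        by (rule sum_nonneg)
          (use positive_R_pow[OF f pos] in \<open>auto simp: positive_matrix_def\<close>)
    qed simp
    finally show ?thesis .
  qed
  ultimately show "0 \<le> qform n (\<lambda>j l. T (f j l)) x v"
    by (intro LIMSEQ_le_const) auto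
qed

lemma R_badj: "f \<in> E \<Longrightarrow> R (badj f) = badj (R f)"
proof (intro bcontfun_eqI)
  fix x assume f: "f \<in> E"
  have "adj (\<Sum>i\<in>I. A i) = (\<Sum>i\<in>I. adj (A i))" for A :: "'i \<Rightarrow> 'v \<Rightarrow>\<^sub>L 'v"
    by (rule Real_Vector_Spaces.linear_sum[OF bounded_linear.linear[OF bounded_linear_adj]])
  then show "R (badj f) x = badj (R f) x"
    by (simp add: R_apply badj_in f adj_compose blinfun_compose_assoc)
qed

lemma T_badj: "f \<in> E \<Longrightarrow> T (badj f) = badj (T f)"
  by (rule T_commute[OF bounded_linear_badj badj_in]) (simp_all add: R_badj)

lemma T_T: "f \<in> E \<Longrightarrow> T (T f) = T f"
  by (intro T_fixed T_in R_T)

lemma T_zero: "T 0 = 0"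
  by (intro T_fixed E_zero R_zero)

end

text \<open>\<open>k\<close> is the inverse of the harmonic \<open>h\<close>, and \<open>s\<close>
  stands for the inverse root of \<open>h\<close> that enters the norm.\<close>

locale harmonic_state = contracting_transfer +
  fixes h k s :: "'a \<Rightarrow>\<^sub>C ('b \<Rightarrow>\<^sub>L 'b)"
  assumes h_in: "h \<in> E" and R_h: "R h = h" and h_adj: "badj h = h"
    and k_in: "k \<in> E" and k_adj: "badj k = k"
    and h_k: "h \<odot> k = bid" and k_h: "k \<odot> h = bid"
    and k_nonneg: "0 \<le> inner v (k x v)"
    and s_in: "s \<in> E" and s_adj: "badj s = s" and s_s: "s \<odot> s = k"
begin

lemma h_sym: "inner u (h x v) = inner (h x u) v"
  and k_sym: "inner u (k x v) = inner (k x u) v"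
  and s_sym: "inner u (s x v) = inner (s x u) v"
  using adj_inner_right[of u "h x" v] badj_apply[of h x] h_adj
    adj_inner_right[of u "k x" v] badj_apply[of k x] k_adj
    adj_inner_right[of u "s x" v] badj_apply[of s x] s_adj by auto

lemma hk_apply: "h x (k x v) = v" and kh_apply: "k x (h x v) = v" and ss_apply: "s x (s x v) = k x v"
  using bcomp_apply[of h k x] bcomp_apply[of k h x] bcomp_apply[of s s x]
  by (metis (no_types) h_k k_h s_s blinfun_apply_blinfun_compose blinfun_apply_id_blinfun const_bcontfun.rep_eq)+

lemma shs_apply: "s x (h x (s x v)) = v"
proof -
  have ks: "k x (s x w) = s x (k x w)" for w by (metis ss_apply)
  have "s x (h x (s x v)) = h x (k x (s x (h x (s x v))))" by (simp only: hk_apply)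
  also have "\<dots> = h x (s x (k x (h x (s x v))))" by (simp only: ks)
  also have "\<dots> = v" by (simp only: kh_apply ss_apply hk_apply)
  finally show ?thesis .
qed

text \<open>The block matrix of \<open>schwarz_T\<close> has Schur complement zero over its corner
  \<open>h\<close>, so its form is a single square with respect to \<open>k\<close>.\<close>

lemma complete_square:
  "inner (h x u + w) (k x (h x u + w)) = inner u (h x u) + 2 * inner u w + inner w (k x w)"
proof -
  have "inner (h x u) (k x w) = inner u w"
    by (metis h_sym hk_apply)
  moreover have "inner w u = inner u w" by (rule inner_commute)
  ultimately show ?thesis
    by (simp add: blinfun.add_right kh_apply inner_add_left inner_add_right inner_commute[of "h x u" u])
qed

lemma E_form: "a \<in> E \<Longrightarrow> b \<in> E \<Longrightarrow> a \<odot> k \<odot> b \<in> E"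
  by (intro bcomp_in k_in)

text \<open>Positivity of \<open>T\<close> on the matrix with blocks \<open>h\<close>, \<open>z\<^sub>l\<close>, \<open>z\<^sub>j\<^sup>*\<close>, \<open>z\<^sub>j\<^sup>* k z\<^sub>l\<close>,
  evaluated at the minimizer of the resulting quadratic form in the first component.\<close>

lemma schwarz_T:
  fixes z :: "nat \<Rightarrow> 'a \<Rightarrow>\<^sub>C ('b \<Rightarrow>\<^sub>L 'b)"
  assumes z: "\<And>j. j < n \<Longrightarrow> z j \<in> E"
  defines "S \<equiv> \<lambda>x v. \<Sum>l<n. T (z l) x (v l)"
  shows "inner (S x v) (k x (S x v)) \<le> qform n (\<lambda>j l. T (badj (z j) \<odot> k \<odot> z l)) x v"
proof -
  \<comment> \<open>The corner \<open>h\<close> takes index \<open>0\<close> and shifts the family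
    \<open>z\<close> by one. A whole family is treated because \<open>T_module_adj\<close> needs the
    inequality for two elements jointly.\<close>
  define f where "f j l = (case j of 0 \<Rightarrow> (case l of 0 \<Rightarrow> h | Suc l' \<Rightarrow> z l')
      | Suc j' \<Rightarrow> (case l of 0 \<Rightarrow> badj (z j') | Suc l' \<Rightarrow> badj (z j') \<odot> k \<odot> z l'))" for j l
  have split: "qform (Suc n) (\<lambda>j l. F (f j l)) x w =
      inner (w 0) (F h x (w 0)) + (\<Sum>l<n. inner (w 0) (F (z l) x (w (Suc l)))) +
      (\<Sum>j<n. inner (w (Suc j)) (F (badj (z j)) x (w 0))) +
      (\<Sum>j<n. \<Sum>l<n. inner (w (Suc j)) (F (badj (z j) \<odot> k \<odot> z l) x (w (Suc l))))" for F :: "('a \<Rightarrow>\<^sub>C ('b \<Rightarrow>\<^sub>L 'b)) \<Rightarrow> ('a \<Rightarrow>\<^sub>C ('b \<Rightarrow>\<^sub>L 'b))" and x and w :: "nat \<Rightarrow> 'b"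
    unfolding sum.lessThan_Suc_shift f_def by (simp add: sum.distrib add.assoc)
  have fE: "f j l \<in> E" if "j < Suc n" "l < Suc n" for j l
    using that z by (auto simp: f_def h_in badj_in E_form split: nat.splits)
  have "positive_matrix (Suc n) f"
    unfolding positive_matrix_def
  proof (intro allI)
    fix x and w :: "nat \<Rightarrow> 'b"
    let ?W = "\<Sum>l<n. z l x (w (Suc l))"
    have WW: "inner ?W (k x ?W) = (\<Sum>j<n. \<Sum>l<n. inner (z j x (w (Suc j))) (k x (z l x (w (Suc l)))))"
      by (subst inner_sum_left) (simp add: blinfun.sum_right inner_sum_right)
    have "qform (Suc n) f x w =
        inner (w 0) (h x (w 0)) + inner (w 0) ?W + inner ?W (w 0) + inner ?W (k x ?W)"
      unfolding split[of w "\<lambda>g. g" x] WW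
      by (simp add: adj_inner_right inner_sum_left inner_sum_right)
    also have "\<dots> = inner (h x (w 0) + ?W) (k x (h x (w 0) + ?W))"
      unfolding complete_square by (simp add: inner_commute)
    also have "\<dots> \<ge> 0" by (rule k_nonneg)
    finally show "0 \<le> qform (Suc n) f x w" .
  qed
  from positive_T[OF fE this] have pos: "0 \<le> qform (Suc n) (\<lambda>j l. T (f j l)) x w" for x w
    by (auto simp: positive_matrix_def)
  define w where "w j = (case j of 0 \<Rightarrow> - k x (S x v) | Suc j' \<Rightarrow> v j')" for j
  have "(\<Sum>j<n. inner (v j) (T (badj (z j)) x u)) = inner (S x v) u" for u
    using z by (simp add: S_def inner_sum_left T_badj adj_inner_right)
  moreover have "(\<Sum>l<n. inner u (T (z l) x (v l))) = inner u (S x v)" for u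
    by (simp add: S_def inner_sum_right)
  ultimately have "0 \<le> inner (k x (S x v)) (S x v) - 2 * inner (k x (S x v)) (S x v) +
      qform n (\<lambda>j l. T (badj (z j) \<odot> k \<odot> z l)) x v"
    using pos[of w x] unfolding split[of w T x]
    by (simp add: w_def T_fixed h_in R_h blinfun.minus_right hk_apply inner_commute sum_negf)
  then show ?thesis
    by (simp add: k_sym[of "S x v"])
qed

text \<open>The defect \<open>T (z\<^sup>* k w) - T (z)\<^sup>* k T (w)\<close> of the Schwarz inequality is a positive form, also after
  applying \<open>T\<close>; then it vanishes at \<open>z = w = c\<close>, hence, by Cauchy-Schwarz, at \<open>z = c\<close> and all \<open>w\<close>.\<close>

lemma T_module_adj:
  assumes c: "c \<in> E" "T c = c" and y: "y \<in> E"
  shows "T (badj c \<odot> k \<odot> y) = T (badj c \<odot> k \<odot> T y)"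
proof -
  define z where "z j = (if j = 0 then c else y)" for j :: nat
  have z: "z j \<in> E" for j using c y by (simp add: z_def)
  define B where "B j l = T (badj (z j) \<odot> k \<odot> z l) - badj (T (z j)) \<odot> k \<odot> T (z l)" for j l
  have zE: "badj (z j) \<odot> k \<odot> z l \<in> E" "badj (T (z j)) \<odot> k \<odot> T (z l) \<in> E" for j l
    by (intro E_form badj_in z T_in)+
  have BE: "B j l \<in> E" for j l
    unfolding B_def by (intro E_diff T_in zE)
  have "positive_matrix 2 B"
    unfolding positive_matrix_def
  proof (intro allI)
    fix x and v :: "nat \<Rightarrow> 'b"
    let ?S = "\<Sum>l<2. T (z l) x (v l)"
    have SS: "inner ?S (k x ?S) = (\<Sum>j<2. \<Sum>l<2. inner (T (z j) x (v j)) (k x (T (z l) x (v l))))"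
      by (subst inner_sum_left) (simp add: blinfun.sum_right inner_sum_right)
    have "qform 2 B x v =
        qform 2 (\<lambda>j l. T (badj (z j) \<odot> k \<odot> z l)) x v - inner ?S (k x ?S)"
      unfolding SS
      by (simp add: B_def blinfun.diff_left inner_diff_right sum_subtractf adj_inner_right)
    then show "0 \<le> qform 2 B x v"
      using schwarz_T[of 2 z x v] z by simp
  qed
  from positive_T[OF BE this]
  have pos: "0 \<le> qform 2 (\<lambda>j l. T (B j l)) x v" for x v
    by (auto simp: positive_matrix_def)
  have TB: "T (B j l) = T (badj (z j) \<odot> k \<odot> z l) - T (badj (T (z j)) \<odot> k \<odot> T (z l))" for j l
    unfolding B_def by (simp add: T_diff T_in zE T_T)
  have T00: "T (B 0 0) = 0"
    by (simp add: TB z_def c)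
  have "badj (B 0 1) = B 1 0"
  proof -
    have "badj (T (badj (z 0) \<odot> k \<odot> z 1)) = T (badj (badj (z 0) \<odot> k \<odot> z 1))"
      by (rule T_badj[symmetric]) (rule zE)
    then show ?thesis
      by (simp add: B_def badj_diff badj_bcomp k_adj bcomp_assoc)
  qed
  then have T10: "T (B 1 0) = badj (T (B 0 1))"
    by (metis T_badj BE)
  have "inner u (T (B 0 1) x w) = 0" for u w x
  proof -
    let ?a = "inner u (T (B 0 1) x w)" and ?d = "inner w (T (B 1 1) x w)"
    \<comment> \<open>\<open>T00\<close> removes the term quadratic in \<open>t\<close>, so an
      affine function of \<open>t\<close> is nonnegative on the whole line and its slope must
      vanish; the value of \<open>t\<close> chosen below would make it \<open>-1\<close>.\<close>
    have nonneg: "0 \<le> 2 * t * ?a + ?d" for t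
    proof -
      have "(\<Sum>j<2. \<Sum>l<2. inner ((\<lambda>j. if j = 0 then t *\<^sub>R u else w) j)
          (T (B j l) x ((\<lambda>j. if j = 0 then t *\<^sub>R u else w) l))) = 2 * t * ?a + ?d"
        by (simp add: numeral_2_eq_2 T00 T10[unfolded One_nat_def] adj_inner_right blinfun.scaleR_right inner_commute)
      then show ?thesis
        using pos[of "\<lambda>j. if j = 0 then t *\<^sub>R u else w" x] by simp
    qed
    show "?a = 0"
    proof (rule ccontr)
      assume "?a \<noteq> 0"
      then show False
        using nonneg[of "- (?d + 1) / (2 * ?a)"] by (simp add: field_simps)
    qed
  qed
  then have "T (B 0 1) = 0"
    by (intro bcontfun_eqI blinfun_inner_eqI) simp
  then show ?thesis
    using TB[of 0 1] by (simp add: z_def c)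
qed

text \<open>\<open>T\<close> behaves like a conditional expectation for the product
  \<open>a \<odot> k \<odot> b\<close>. The right-hand version follows from
  \<open>T_module_adj\<close> by taking adjoints.\<close>

lemma T_module:
  assumes c: "c \<in> fixed" and y: "y \<in> E"
  shows T_module_left: "T (c \<odot> k \<odot> T y) = T (c \<odot> k \<odot> y)"
    and T_module_right: "T (T y \<odot> k \<odot> c) = T (y \<odot> k \<odot> c)"
proof -
  have cE: "c \<in> E" "T c = c" using c by (auto simp: fixed_def T_fixed)
  have c': "badj c \<in> E" "T (badj c) = badj c" using cE by (simp_all add: badj_in T_badj)
  show "T (c \<odot> k \<odot> T y) = T (c \<odot> k \<odot> y)"
    using T_module_adj[OF c' y] by simp
  have adj_form: "badj (T (badj c \<odot> k \<odot> badj w)) = T (w \<odot> k \<odot> c)" if w: "w \<in> E" for w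
  proof -
    have "badj (T (badj c \<odot> k \<odot> badj w)) = T (badj (badj c \<odot> k \<odot> badj w))"
      by (rule T_badj[symmetric]) (intro E_form badj_in cE w)
    then show ?thesis by (simp add: badj_bcomp k_adj bcomp_assoc)
  qed
  have "badj (T (badj c \<odot> k \<odot> badj (T y))) = badj (T (badj c \<odot> k \<odot> badj y))"
    using T_module_adj[OF cE badj_in[OF y]] y by (simp add: T_badj)
  then show "T (T y \<odot> k \<odot> c) = T (y \<odot> k \<odot> c)"
    using y by (simp add: adj_form T_in)
qed

section \<open>The norm twisted by the inverse root of \<open>h\<close>\<close>

definition hnorm where "hnorm a = norm (s \<odot> a \<odot> s)"

text \<open>The substitutions of \<open>s x (h x u)\<close> and of \<open>s x u\<close> for
  \<open>u\<close> are inverse to each other and remove \<open>s\<close>. What remains involves only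
  \<open>h\<close>, which \<open>T\<close> fixes, so the bound can be pushed through
  \<open>T\<close>.\<close>

lemma hnorm_le_iff:
  assumes "0 \<le> c"
  shows "hnorm a \<le> c \<longleftrightarrow> (\<forall>x u v. 2 * inner u (a x v) \<le> c * (inner u (h x u) + inner v (h x v)))"
proof (intro iffI allI)
  fix x u v assume le: "hnorm a \<le> c"
  have s_t: "s x (s x (h x w)) = w" for w by (simp add: ss_apply kh_apply)
  have t_t: "inner (s x (h x w)) (s x (h x w)) = inner w (h x w)" for w
    by (simp add: s_sym s_t ss_apply kh_apply inner_commute flip: s_sym[of "s x (h x w)"])
  let ?A = "(s \<odot> a \<odot> s) x"
  have "norm ?A \<le> c"
    using le norm_bounded[of "s \<odot> a \<odot> s" x] by (simp add: hnorm_def)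
  then have le': "norm ?A * (inner u' u' + inner v' v') \<le> c * (inner u' u' + inner v' v')" for u' v' :: 'b
    by (intro mult_right_mono) auto
  have "inner u (a x v) = inner (s x (h x u)) (?A (s x (h x v)))"
    by (simp add: s_t s_sym)
  then have "2 * inner u (a x v) \<le> 2 * \<bar>inner (s x (h x u)) (?A (s x (h x v)))\<bar>" by simp
  also have "\<dots> \<le> c * (inner (s x (h x u)) (s x (h x u)) + inner (s x (h x v)) (s x (h x v)))"
    by (rule order_trans[OF inner_blinfun_le le'])
  finally show "2 * inner u (a x v) \<le> c * (inner u (h x u) + inner v (h x v))"
    by (simp only: t_t)
next
  assume form: "\<forall>x u v. 2 * inner u (a x v) \<le> c * (inner u (h x u) + inner v (h x v))"
  show "hnorm a \<le> c"
    unfolding hnorm_def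
  proof (intro norm_bound norm_blinfun_le_form)
    fix x u v
    have shs: "inner (s x w) (h x (s x w)) = inner w w" for w
      using s_sym[of w x "h x (s x w)"] by (simp add: shs_apply)
    show "2 * inner u ((s \<odot> a \<odot> s) x v) \<le> c * (inner u u + inner v v)"
      using form[rule_format, of "s x u" x "s x v"] by (simp add: s_sym shs)
  qed fact
qed

lemma hnorm_nonneg: "0 \<le> hnorm a"
  by (simp add: hnorm_def)

text \<open>By \<open>hnorm_le_iff\<close> the norm bound says that the matrix with
  \<open>c *\<^sub>R h\<close> on the diagonal and \<open>(-2) *\<^sub>R a\<close> in one corner is
  positive; \<open>T\<close> preserves positivity and fixes the diagonal.\<close>

lemma hnorm_T:
  assumes a: "a \<in> E" shows "hnorm (T a) \<le> hnorm a"
proof -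
  define c where "c = hnorm a"
  have c: "0 \<le> c" by (simp add: c_def hnorm_nonneg)
  define f where "f j l = (if j = l then c *\<^sub>R h else if j = 0 then (-2) *\<^sub>R a else 0)" for j l :: nat
  have form: "2 * inner u (a x v) \<le> c * (inner u (h x u) + inner v (h x v))" for u x v
    using hnorm_le_iff[OF c, of a] by (simp add: c_def)
  have fE: "f j l \<in> E" for j l
    using a h_in by (auto simp: f_def intro: E_scaleR E_zero E_uminus)
  have sum2: "qform 2 (\<lambda>j l. F (f j l)) x v =
      inner (v 0) (F (c *\<^sub>R h) x (v 0)) + inner (v 0) (F ((-2) *\<^sub>R a) x (v 1)) +
      inner (v 1) (F 0 x (v 0)) + inner (v 1) (F (c *\<^sub>R h) x (v 1))" for F :: "('a \<Rightarrow>\<^sub>C ('b \<Rightarrow>\<^sub>L 'b)) \<Rightarrow> ('a \<Rightarrow>\<^sub>C ('b \<Rightarrow>\<^sub>L 'b))" and x and v :: "nat \<Rightarrow> 'b"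
    by (simp add: numeral_2_eq_2 f_def)
  have "positive_matrix 2 f"
    unfolding positive_matrix_def
  proof (intro allI)
    fix x and v :: "nat \<Rightarrow> 'b"
    show "0 \<le> qform 2 f x v"
      unfolding sum2[of v "\<lambda>g. g" x]
      using form[of "v 0" x "v 1"] by (simp add: blinfun.scaleR_left blinfun.minus_left algebra_simps)
  qed
  from positive_T[OF fE this]
  have pos: "0 \<le> qform 2 (\<lambda>j l. T (f j l)) x v" for x v
    by (auto simp: positive_matrix_def)
  have "hnorm (T a) \<le> c"
    unfolding hnorm_le_iff[OF c]
  proof (intro allI)
    fix x u v
    show "2 * inner u (T a x v) \<le> c * (inner u (h x u) + inner v (h x v))"
      using pos[of "\<lambda>j. if j = 0 then u else v" x] a h_in
      unfolding sum2[of _ T x]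
      by (simp only: T_scaleR T_zero T_fixed[OF h_in R_h])
        (simp add: blinfun.scaleR_left blinfun.minus_left algebra_simps)
  qed
  then show ?thesis by (simp add: c_def)
qed

lemma hnorm_form: "hnorm (a \<odot> k \<odot> b) \<le> hnorm a * hnorm b"
proof -
  have "s \<odot> (a \<odot> k \<odot> b) \<odot> s = (s \<odot> a \<odot> s) \<odot> (s \<odot> b \<odot> s)"
    by (simp add: bcomp_assoc flip: s_s)
  then show ?thesis by (simp add: hnorm_def norm_bcomp)
qed

lemma hnorm_mult: "a \<in> E \<Longrightarrow> b \<in> E \<Longrightarrow> hnorm (T (a \<odot> k \<odot> b)) \<le> hnorm a * hnorm b"
  by (rule order_trans[OF hnorm_T hnorm_form]) (rule E_form)

lemma hnorm_badj: "hnorm (badj a) = hnorm a"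
proof -
  have "s \<odot> badj a \<odot> s = badj (s \<odot> a \<odot> s)"
    by (simp add: badj_bcomp s_adj bcomp_assoc)
  then show ?thesis by (simp add: hnorm_def)
qed

lemma hnorm_cstar:
  assumes a: "a \<in> fixed"
  shows "hnorm (T (badj a \<odot> k \<odot> a)) = (hnorm a)\<^sup>2"
proof (rule antisym)
  have aE: "a \<in> E" "T a = a" using a by (auto simp: fixed_def T_fixed)
  show "hnorm (T (badj a \<odot> k \<odot> a)) \<le> (hnorm a)\<^sup>2"
    using hnorm_mult[OF badj_in[OF aE(1)] aE(1)] by (simp add: hnorm_badj power2_eq_square)
  let ?c = "hnorm (T (badj a \<odot> k \<odot> a))"
  have "hnorm a \<le> sqrt ?c"
    unfolding hnorm_def[of a]
  proof (intro norm_bound norm_blinfun_bound)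
    show "0 \<le> sqrt ?c" by (simp add: hnorm_nonneg)
    fix x v
    let ?w = "a x (s x v)" and ?A = "(s \<odot> T (badj a \<odot> k \<odot> a) \<odot> s) x"
    have "(norm ((s \<odot> a \<odot> s) x v))\<^sup>2 = inner ?w (k x ?w)"
      by (simp add: power2_norm_eq_inner ss_apply flip: s_sym)
    also have "\<dots> \<le> inner (s x v) (T (badj a \<odot> k \<odot> a) x (s x v))"
      using schwarz_T[of 1 "\<lambda>_. a" x "\<lambda>_. s x v"] aE by simp
    also have "\<dots> = inner v (?A v)" by (simp add: s_sym)
    also have "\<dots> \<le> norm ?A * inner v v"
      using inner_blinfun_le[of v ?A v] by simp
    also have "\<dots> \<le> ?c * inner v v"
      by (intro mult_right_mono) (simp_all add: hnorm_def norm_bounded del: bcomp_apply)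
    also have "\<dots> = (sqrt ?c * norm v)\<^sup>2"
      by (simp add: power_mult_distrib hnorm_nonneg dot_square_norm)
    finally show "norm ((s \<odot> a \<odot> s) x v) \<le> sqrt ?c * norm v"
      by (rule power2_le_imp_le) (simp add: hnorm_nonneg)
  qed
  then have "(hnorm a)\<^sup>2 \<le> (sqrt ?c)\<^sup>2"
    by (intro power_mono hnorm_nonneg)
  then show "(hnorm a)\<^sup>2 \<le> ?c" by (simp add: hnorm_nonneg)
qed

text \<open>\<open>h \<odot> s\<close> is a left inverse and \<open>s \<odot> h\<close> a right
  inverse of \<open>s\<close>. Together with \<open>hnorm_le_norm\<close> this makes
  \<open>hnorm\<close> equivalent to the supremum norm, so completeness carries over.\<close>

lemma norm_le_hnorm: "norm a \<le> norm (h \<odot> s) * norm (s \<odot> h) * hnorm a"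
proof -
  have "a = (h \<odot> s) \<odot> (s \<odot> a \<odot> s) \<odot> (s \<odot> h)"
    by (intro bcontfun_eqI blinfun_eqI) (simp add: ss_apply kh_apply hk_apply)
  then have "norm a \<le> norm ((h \<odot> s) \<odot> (s \<odot> a \<odot> s)) * norm (s \<odot> h)"
    by (metis norm_bcomp)
  also have "\<dots> \<le> (norm (h \<odot> s) * norm (s \<odot> a \<odot> s)) * norm (s \<odot> h)"
    by (intro mult_right_mono norm_bcomp norm_ge_zero)
  finally show ?thesis by (simp add: hnorm_def ac_simps)
qed

lemma hnorm_le_norm: "hnorm a \<le> norm s * norm s * norm a"
proof -
  have "hnorm a \<le> norm (s \<odot> a) * norm s"
    unfolding hnorm_def by (rule norm_bcomp)
  also have "\<dots> \<le> (norm s * norm a) * norm s"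
    by (intro mult_right_mono norm_bcomp norm_ge_zero)
  finally show ?thesis by (simp add: ac_simps)
qed

lemma hnorm_eq_0_iff: "hnorm a = 0 \<longleftrightarrow> a = 0"
  using norm_le_hnorm[of a] hnorm_le_norm[of a] hnorm_nonneg[of a] by auto

lemma hnorm_triangle: "hnorm (a + b) \<le> hnorm a + hnorm b"
  by (simp add: hnorm_def bcomp.add_left bcomp.add_right norm_triangle_ineq)

lemma fixed_complete:
  assumes F: "\<And>n::nat. F n \<in> fixed"
    and Cauchy: "\<And>e. 0 < e \<Longrightarrow> \<exists>N. \<forall>m\<ge>N. \<forall>n\<ge>N. hnorm (F m - F n) < e"
  shows "\<exists>l\<in>fixed. (\<lambda>n. hnorm (F n - l)) \<longlonglongrightarrow> 0"
proof -
  let ?K = "norm (h \<odot> s) * norm (s \<odot> h)"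
  have K: "0 < ?K + 1" by (simp add: add_nonneg_pos)
  have "Cauchy F"
  proof (rule CauchyI)
    fix e :: real assume e: "0 < e"
    obtain N where N: "\<And>m n. m \<ge> N \<Longrightarrow> n \<ge> N \<Longrightarrow> hnorm (F m - F n) < e / (?K + 1)"
      using Cauchy[of "e / (?K + 1)"] e K by (metis zero_less_divide_iff)
    have "norm (F m - F n) < e" if "m \<ge> N" "n \<ge> N" for m n
    proof -
      have "norm (F m - F n) \<le> ?K * hnorm (F m - F n)" by (rule norm_le_hnorm)
      also have "\<dots> \<le> (?K + 1) * hnorm (F m - F n)"
        by (intro mult_right_mono hnorm_nonneg) simp
      also have "\<dots> < e" using N[OF that] K by (simp add: field_simps)
      finally show ?thesis .
    qed
    then show "\<exists>M. \<forall>m\<ge>M. \<forall>n\<ge>M. norm (F m - F n) < e" by blast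
  qed
  then obtain l where l: "F \<longlonglongrightarrow> l"
    using Cauchy_convergent_iff convergent_def by blast
  have E: "\<And>n. F n \<in> E" and RF: "\<And>n. R (F n) = F n" using F by (auto simp: fixed_def)
  have "l \<in> E" by (rule E_limit[OF E l])
  moreover have "R l = l"
    using R_tendsto[OF E l] l by (simp add: RF LIMSEQ_unique)
  ultimately have "l \<in> fixed" by (simp add: fixed_def)
  moreover have "(\<lambda>n. norm s * norm s * norm (F n - l)) \<longlonglongrightarrow> 0"
    using l by (intro tendsto_mult_right_zero tendsto_norm_zero) (simp add: LIM_zero_iff)
  then have "(\<lambda>n. hnorm (F n - l)) \<longlonglongrightarrow> 0"
    by (rule Lim_null_comparison[rotated]) (simp add: hnorm_nonneg hnorm_le_norm)
  ultimately show ?thesis by blast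
qed

end

section \<open>Complex scalars and the assembled algebra\<close>

lemma comm_group_add_subspace:
  "subspace V \<Longrightarrow> comm_group \<lparr>carrier = V, monoid.mult = (+), one = (0 :: 'a::real_vector)\<rparr>"
proof (rule comm_groupI)
  assume V: "subspace V"
  fix x assume "x \<in> carrier \<lparr>carrier = V, monoid.mult = (+), one = 0\<rparr>"
  then have "- x \<in> V" using V by (simp add: subspace_neg)
  then show "\<exists>y\<in>carrier \<lparr>carrier = V, monoid.mult = (+), one = 0\<rparr>.
      y \<otimes>\<^bsub>\<lparr>carrier = V, monoid.mult = (+), one = 0\<rparr>\<^esub> x = \<one>\<^bsub>\<lparr>carrier = V, monoid.mult = (+), one = 0\<rparr>\<^esub>"
    by (intro bexI[of _ "- x"]) auto
qed (auto simp: subspace_add subspace_0 add.assoc add.commute)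

lemma finprod_add_subspace:
  fixes V :: "'a::real_vector set"
  assumes "subspace V" "finite B" "\<And>b. b \<in> B \<Longrightarrow> f b \<in> V"
  shows "finprod \<lparr>carrier = V, monoid.mult = (+), one = 0\<rparr> f B = sum f B"
proof -
  let ?V = "\<lparr>carrier = V, monoid.mult = (+), one = (0 :: 'a)\<rparr>"
  interpret comm_group ?V by (rule comm_group_add_subspace) fact
  show ?thesis using assms(2,3)
  proof (induction B rule: finite_induct)
    case empty
    show ?case using finprod_empty[of f] by simp
  next
    case (insert b B)
    then show ?case using finprod_insert[of B b f] by auto
  qed
qed

text \<open>So far all scalars are real. Multiplication by the complex number \<open>c\<close>
  enters as a central element \<open>J c\<close> of \<open>E\<close> that commutes with
  \<open>R\<close>, which keeps the abstract argument free of coordinates.\<close>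

locale complex_harmonic_state = harmonic_state +
  fixes J :: "complex \<Rightarrow> _"
  assumes J_in: "J c \<in> E"
    and J_central: "f \<in> E \<Longrightarrow> f \<odot> J c = J c \<odot> f"
    and J_add: "J (c + d) = J c + J d"
    and J_mult: "J (c * d) = J c \<odot> J d"
    and J_of_real: "J (of_real t) = t *\<^sub>R bid"
    and J_adj: "badj (J c) = J (cnj c)"
    and J_norm: "norm (J c \<odot> f) = cmod c * norm f"
    and R_J: "f \<in> E \<Longrightarrow> R (J c \<odot> f) = J c \<odot> R f"
begin

lemma T_J: "f \<in> E \<Longrightarrow> T (J c \<odot> f) = J c \<odot> T f"
  by (rule T_commute[OF bcomp.bounded_linear_right]) (auto simp: R_J intro: bcomp_in J_in)

lemma J_one: "J 1 = bid" and J_minus_one: "J (- 1) = - bid"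
  using J_of_real[of 1] J_of_real[of "-1"] by simp_all

theorem cstar_algebra_fixed:
  "finite_dim_cstar_algebra_on fixed (+) 0 (\<lambda>c f. J c \<odot> f) (\<lambda>a b. T (a \<odot> k \<odot> b)) badj hnorm"
proof (intro finite_dim_cstar_algebra_on.intro cstar_algebra_on.intro complex_vector_space_on.intro
    cstar_algebra_on_axioms.intro finite_dim_cstar_algebra_on_axioms.intro)
  show "comm_group \<lparr>carrier = fixed, monoid.mult = (+), one = 0\<rparr>"
    by (rule comm_group_add_subspace[OF subspace_fixed])
  have fE: "a \<in> E" if "a \<in> fixed" for a using that by (simp add: fixed_def)
  have add_fixed: "a + b \<in> fixed" if "a \<in> fixed" "b \<in> fixed" for a b
    using that subspace_fixed by (simp add: subspace_add)
  fix a b c and z z' :: complex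
  show "J z \<odot> a \<in> fixed" if "a \<in> fixed"
    using that by (simp add: fixed_def R_J bcomp_in J_in)
  show "J z \<odot> (a + b) = J z \<odot> a + J z \<odot> b"
    by (rule bcomp.add_right)
  show "J (z + z') \<odot> a = J z \<odot> a + J z' \<odot> a"
    by (simp add: J_add bcomp.add_left)
  show "J z \<odot> (J z' \<odot> a) = J (z * z') \<odot> a"
    by (simp add: J_mult bcomp_assoc)
  show "J 1 \<odot> a = a" by (simp add: J_one)
  show "T (a \<odot> k \<odot> b) \<in> fixed" if "a \<in> fixed" "b \<in> fixed"
    using that by (simp add: fixed_def T_in R_T E_form)
  show "T (T (a \<odot> k \<odot> b) \<odot> k \<odot> c) = T (a \<odot> k \<odot> T (b \<odot> k \<odot> c))" if "a \<in> fixed" "b \<in> fixed" "c \<in> fixed"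
    unfolding T_module_right[OF that(3) E_form[OF fE fE, OF that(1,2)]]
      T_module_left[OF that(1) E_form[OF fE fE, OF that(2,3)]] by (simp only: bcomp_assoc)
  show "T ((a + b) \<odot> k \<odot> c) = T (a \<odot> k \<odot> c) + T (b \<odot> k \<odot> c)" if "a \<in> fixed" "b \<in> fixed" "c \<in> fixed"
    using that by (simp add: bcomp.add_left T_add E_form fE)
  show "T (a \<odot> k \<odot> (b + c)) = T (a \<odot> k \<odot> b) + T (a \<odot> k \<odot> c)" if "a \<in> fixed" "b \<in> fixed" "c \<in> fixed"
    using that by (simp add: bcomp.add_right T_add E_form fE)
  show "T ((J z \<odot> a) \<odot> k \<odot> b) = J z \<odot> T (a \<odot> k \<odot> b)" if "a \<in> fixed" "b \<in> fixed"
    using that T_J[OF E_form[OF fE fE]] by (simp add: bcomp_assoc)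
  show "T (a \<odot> k \<odot> (J z \<odot> b)) = J z \<odot> T (a \<odot> k \<odot> b)" if "a \<in> fixed" "b \<in> fixed"
  proof -
    have "a \<odot> k \<odot> (J z \<odot> b) = (a \<odot> k \<odot> J z) \<odot> b" by (simp add: bcomp_assoc)
    also have "\<dots> = J z \<odot> (a \<odot> k \<odot> b)"
      using J_central[OF bcomp_in[OF fE[OF that(1)] k_in]] by (simp add: bcomp_assoc)
    finally show ?thesis using that by (simp add: T_J E_form fE)
  qed
  show "badj a \<in> fixed" if "a \<in> fixed"
    using that by (simp add: fixed_def R_badj badj_in)
  show "badj (badj a) = a" by simp
  show "badj (a + b) = badj a + badj b" by (rule badj_add)
  show "badj (J z \<odot> a) = J (cnj z) \<odot> badj a" if "a \<in> fixed"
    using that by (simp add: badj_bcomp J_adj J_central badj_in fE)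
  show "badj (T (a \<odot> k \<odot> b)) = T (badj b \<odot> k \<odot> badj a)" if "a \<in> fixed" "b \<in> fixed"
    using T_badj[OF E_form[OF fE fE, OF that]] by (simp add: badj_bcomp k_adj bcomp_assoc)
  show "0 \<le> hnorm a" by (rule hnorm_nonneg)
  show "hnorm a = 0 \<longleftrightarrow> a = 0" by (rule hnorm_eq_0_iff)
  show "hnorm (a + b) \<le> hnorm a + hnorm b" by (rule hnorm_triangle)
  show "hnorm (J z \<odot> a) = cmod z * hnorm a"
  proof -
    have "s \<odot> (J z \<odot> a) \<odot> s = J z \<odot> (s \<odot> a \<odot> s)"
      using J_central[OF s_in, of z] by (metis bcomp_assoc)
    then show ?thesis by (simp add: hnorm_def J_norm)
  qed
  show "hnorm (T (a \<odot> k \<odot> b)) \<le> hnorm a * hnorm b" if "a \<in> fixed" "b \<in> fixed"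
    using that by (intro hnorm_mult fE)
  show "hnorm (T (badj a \<odot> k \<odot> a)) = (hnorm a)\<^sup>2" if "a \<in> fixed"
    using that by (rule hnorm_cstar)
next
  fix F assume "\<And>n::nat. F n \<in> fixed"
    and "\<And>e. 0 < e \<Longrightarrow> \<exists>N. \<forall>m\<ge>N. \<forall>n\<ge>N. hnorm (F m + J (- 1) \<odot> F n) < e"
  then show "\<exists>l\<in>fixed. (\<lambda>n. hnorm (F n + J (- 1) \<odot> l)) \<longlonglongrightarrow> 0"
    using fixed_complete[of F] by (simp add: J_minus_one bcomp.minus_left)
next
  obtain B where B: "finite B" "B \<subseteq> fixed" "fixed \<subseteq> span B"
    using finite_dim_fixed by blast
  have "\<exists>c. v = finprod \<lparr>carrier = fixed, monoid.mult = (+), one = 0\<rparr> (\<lambda>b. J (c b) \<odot> b) B"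
    if v: "v \<in> fixed" for v
  proof -
    \<comment> \<open>The spanning set is already a real one, so the complex coefficients can be
      chosen real.\<close>
    obtain t where t: "v = (\<Sum>b\<in>B. t b *\<^sub>R b)"
      using v B(3) by (auto simp: span_finite[OF B(1)])
    have "finprod \<lparr>carrier = fixed, monoid.mult = (+), one = 0\<rparr> (\<lambda>b. J (of_real (t b)) \<odot> b) B =
        (\<Sum>b\<in>B. J (of_real (t b)) \<odot> b)"
      using B subspace_fixed
      by (intro finprod_add_subspace) (auto simp: J_of_real bcomp.scaleR_left subspace_scale)
    also have "\<dots> = v" by (simp add: t J_of_real bcomp.scaleR_left)
    finally show ?thesis by (intro exI[of _ "\<lambda>b. of_real (t b)"]) simp
  qed
  with B show "\<exists>B. finite B \<and> B \<subseteq> fixed \<and> (\<forall>v\<in>fixed. \<exists>c. v =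
      finprod \<lparr>carrier = fixed, monoid.mult = (+), one = 0\<rparr> (\<lambda>b. J (c b) \<odot> b) B)"
    by blast
qed

end

section \<open>Coverings and trivialized bundles\<close>

context expanding_covering
begin

lemma group_G: "group G"
  using action by (simp add: group_action_def group_hom_def)

lemma act_mult: "g \<in> carrier G \<Longrightarrow> g' \<in> carrier G \<Longrightarrow> act (g \<otimes>\<^bsub>G\<^esub> g') x = act g (act g' x)"
  by (rule group_action.composition_rule[OF action]) auto

lemma act_one: "act \<one>\<^bsub>G\<^esub> x = x"
  using group_action.id_eq_one[OF action] by (metis UNIV_I restrict_apply')

lemma act_inv: "g \<in> carrier G \<Longrightarrow> act (inv\<^bsub>G\<^esub> g) (act g x) = x"
  and act_inv': "g \<in> carrier G \<Longrightarrow> act g (act (inv\<^bsub>G\<^esub> g) x) = x"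
  using group_G by (simp_all add: act_one group.l_inv group.r_inv group.inv_closed flip: act_mult)

lemma p_eq_iff: "p x = p y \<longleftrightarrow> (\<exists>g\<in>carrier G. y = act g x)"
  using fibres[of x y] by (auto simp: orbit_def)

lemma p_act: "g \<in> carrier G \<Longrightarrow> p (act g x) = p x"
  using p_eq_iff[of x "act g x"] by auto

lemma p_surj: "\<exists>x. p x = y"
proof -
  have "surj p" using quotient by (simp add: quotient_map_def)
  then show ?thesis by (metis surjD)
qed

lemma continuous_p: "continuous_on UNIV p"
  using quotient_imp_continuous_map[OF quotient] by simp

lemma open_p:
  assumes "open S" shows "open (p ` S)"
proof -
  have "{x. p x \<in> p ` S} = (\<Union>g\<in>carrier G. act (inv\<^bsub>G\<^esub> g) -` S)"
  proof (intro equalityI subsetI)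
    fix x assume "x \<in> {x. p x \<in> p ` S}"
    then obtain s where "s \<in> S" "p s = p x" by auto
    then obtain g where "g \<in> carrier G" "x = act g s" "s \<in> S" by (auto simp: p_eq_iff)
    then show "x \<in> (\<Union>g\<in>carrier G. act (inv\<^bsub>G\<^esub> g) -` S)"
      by (intro UN_I[of g]) (simp_all add: act_inv)
  next
    fix x assume "x \<in> (\<Union>g\<in>carrier G. act (inv\<^bsub>G\<^esub> g) -` S)"
    then obtain g where "g \<in> carrier G" "act (inv\<^bsub>G\<^esub> g) x \<in> S" by auto
    then show "x \<in> {x. p x \<in> p ` S}"
      using p_act[of "inv\<^bsub>G\<^esub> g" x] group_G by (metis group.inv_closed imageI mem_Collect_eq)
  qed
  moreover have "open (act (inv\<^bsub>G\<^esub> g) -` S)" if "g \<in> carrier G" for g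
  proof (rule open_vimage[OF assms])
    have "dist (act (inv\<^bsub>G\<^esub> g) x) (act (inv\<^bsub>G\<^esub> g) y) = dist x y" for x y
      by (intro isometric group.inv_closed group_G that)
    then show "continuous_on UNIV (act (inv\<^bsub>G\<^esub> g))"
      by (auto simp: continuous_on_iff)
  qed
  ultimately have "open {x. p x \<in> p ` S}" by auto
  then show ?thesis
    using quotient by (auto simp: quotient_map_def)
qed

text \<open>Compactness of the base, read upstairs, where the metric lives: the radii may depend on
  the centres, and each point is caught after replacing it by a translate \<open>x'\<close>.\<close>

lemma finite_cover:
  assumes "\<And>x. 0 < e x"
  shows "\<exists>P. finite P \<and> (\<forall>x. \<exists>y\<in>P. \<exists>x'. p x' = p x \<and> dist y x' < e y)"
proof -
  let ?U = "\<lambda>y. p ` ball y (e y)"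
  have "UNIV \<subseteq> (\<Union>y\<in>UNIV. ?U y)"
  proof
    fix b :: 'b
    obtain x where "p x = b" using p_surj by blast
    then show "b \<in> (\<Union>y\<in>UNIV. ?U y)"
      using assms[of x] by (intro UN_I[of x] image_eqI[of _ _ x]) auto
  qed
  then obtain P where P: "finite P" "UNIV \<subseteq> (\<Union>y\<in>P. ?U y)"
    using compactE_image[OF compact_base, of UNIV ?U] open_p by (metis open_ball)
  have "\<exists>y\<in>P. \<exists>x'. p x' = p x \<and> dist y x' < e y" for x
  proof -
    have "p x \<in> (\<Union>y\<in>P. ?U y)" using P(2) by blast
    then obtain y x' where "y \<in> P" "p x = p x'" "dist y x' < e y" by auto
    then show ?thesis by (intro bexI[of _ y] exI[of _ x']) auto
  qed
  with P(1) show ?thesis by blast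
qed

lemma invariant_bounded:
  fixes n :: "'x \<Rightarrow> real"
  assumes inv: "\<And>x x'. p x = p x' \<Longrightarrow> n x = n x'" and cont: "continuous_on UNIV n"
  shows "\<exists>c. \<forall>x. n x \<le> c"
proof -
  have "\<exists>d>0. \<forall>x. dist x y < d \<longrightarrow> dist (n x) (n y) < 1" for y
    using cont unfolding continuous_on_iff by (metis UNIV_I zero_less_one)
  then obtain d where d: "\<And>y. 0 < d y" "\<And>x y. dist x y < d y \<Longrightarrow> dist (n x) (n y) < 1"
    by metis
  obtain P where P: "finite P" "\<And>x. \<exists>y\<in>P. \<exists>x'. p x' = p x \<and> dist y x' < d y"
    using finite_cover[of d] d(1) by blast
  have "n x \<le> Max (n ` P) + 1" for x
  proof -
    obtain y x' where y: "y \<in> P" "p x' = p x" "dist y x' < d y" using P(2) by blast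
    have "n x' < n y + 1" using d(2)[of x' y] y(3) by (simp add: dist_commute dist_real_def)
    moreover have "n y \<le> Max (n ` P)" using P(1) y(1) by simp
    ultimately show ?thesis using inv[OF y(2)] by simp
  qed
  then show ?thesis by blast
qed

section \<open>Inverse branches and the fibres of \<open>r\<close>\<close>

abbreviation \<psi> :: "nat \<Rightarrow> 'x \<Rightarrow> 'x" where "\<psi> \<equiv> inverse_branch act rt gs"

lemma rt_inv: "rt (inv_into UNIV rt y) = y" and inv_rt: "inv_into UNIV rt (rt x) = x"
  using rt_homeo by (auto simp: homeomorphism_def)

lemma rt_\<psi>: "rt (\<psi> i x) = act (gs i) x"
  by (simp add: inverse_branch_def rt_inv)

lemma r_p_\<psi>: "i \<in> {1..q} \<Longrightarrow> r (p (\<psi> i x)) = p x"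
  by (simp add: r rt_\<psi> p_act gs_carrier)

lemma \<psi>_contract: "i \<in> {1..q} \<Longrightarrow> dist (\<psi> i x) (\<psi> i y) \<le> \<theta> * dist x y"
  using expanding[of "\<psi> i x" "\<psi> i y"] by (simp add: rt_\<psi> isometric gs_carrier)

lemma continuous_\<psi>: "i \<in> {1..q} \<Longrightarrow> continuous_on UNIV (\<psi> i)"
proof (rule lipschitz_on_continuous_on)
  show "\<theta>-lipschitz_on UNIV (\<psi> i)" if "i \<in> {1..q}"
    using \<psi>_contract[OF that] \<theta> by (intro lipschitz_onI) auto
qed

lemma A_carrier: "g \<in> carrier G \<Longrightarrow> A g \<in> carrier G"
  using A_hom by (auto simp: hom_def)

lemma free_eq:
  assumes "g \<in> carrier G" "g' \<in> carrier G" "act g x = act g' x" shows "g = g'"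
proof -
  have "act (inv\<^bsub>G\<^esub> g' \<otimes>\<^bsub>G\<^esub> g) x = x"
    using assms group_G by (simp add: act_mult group.inv_closed act_inv)
  then have "inv\<^bsub>G\<^esub> g' \<otimes>\<^bsub>G\<^esub> g = \<one>\<^bsub>G\<^esub>"
    using assms group_G by (intro free) (auto intro: group.is_monoid[THEN monoid.m_closed] group.inv_closed)
  then show ?thesis
    using assms group_G by (metis group.inv_closed group.inv_equality group.inv_inv)
qed

text \<open>If two branches land in one orbit, freeness writes \<open>gs j\<close> as
  \<open>A g\<close> times \<open>gs i\<close>, so their cosets coincide; conversely, a preimage of
  \<open>p x\<close> determines a coset, whose representative yields it. Injectivity matters because
  a sum over branches has to become a sum over the fibre without repetition.\<close>

lemma preimage_bij: "bij_betw (\<lambda>i. p (\<psi> i x)) {1..q} {y. r y = p x}"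
proof -
  interpret group G by (rule group_G)
  let ?H = "A ` carrier G"
  have H: "subgroup ?H G" using A_normal by (simp add: normal_def)
  have Hsub: "?H \<subseteq> carrier G" using H by (rule subgroup.subset)
  show ?thesis
    unfolding bij_betw_def
  proof
    show "inj_on (\<lambda>i. p (\<psi> i x)) {1..q}"
    proof (rule inj_onI)
      fix i j assume ij: "i \<in> {1..q}" "j \<in> {1..q}" "p (\<psi> i x) = p (\<psi> j x)"
      then obtain g where g: "g \<in> carrier G" "\<psi> j x = act g (\<psi> i x)" by (auto simp: p_eq_iff)
      then have "act (gs j) x = act (A g \<otimes>\<^bsub>G\<^esub> gs i) x"
        using equivariant[OF g(1), of "\<psi> i x"] ij by (simp add: rt_\<psi> act_mult A_carrier gs_carrier flip: rt_\<psi>[of j])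
      then have eq: "gs j = A g \<otimes>\<^bsub>G\<^esub> gs i"
        using g ij by (intro free_eq) (auto simp: A_carrier gs_carrier)
      have "gs j \<in> ?H #>\<^bsub>G\<^esub> gs i"
        unfolding eq using g(1) ij Hsub by (intro rcosI) (auto simp: gs_carrier)
      then have "?H #>\<^bsub>G\<^esub> gs i = ?H #>\<^bsub>G\<^esub> gs j"
        using H ij by (intro repr_independence) (auto simp: gs_carrier)
      then show "i = j"
        using bij_betw_imp_inj_on[OF gs_cosets] ij by (meson inj_onD)
    qed
    show "(\<lambda>i. p (\<psi> i x)) ` {1..q} = {y. r y = p x}"
    proof (intro equalityI subsetI)
      fix y assume "y \<in> (\<lambda>i. p (\<psi> i x)) ` {1..q}"
      then show "y \<in> {y. r y = p x}" using r_p_\<psi> by auto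
    next
      fix y assume "y \<in> {y. r y = p x}"
      then have y: "r y = p x" by simp
      obtain z where z: "p z = y" using p_surj by blast
      then have "p x = p (rt z)" using y by (simp flip: r)
      then obtain g where g: "g \<in> carrier G" "rt z = act g x" by (auto simp: p_eq_iff)
      have "?H #>\<^bsub>G\<^esub> g \<in> rcosets\<^bsub>G\<^esub> ?H" using Hsub g by (intro rcosetsI)
      then obtain i where i: "i \<in> {1..q}" "?H #>\<^bsub>G\<^esub> gs i = ?H #>\<^bsub>G\<^esub> g"
        using gs_cosets unfolding bij_betw_def by (metis (no_types, lifting) imageE)
      then have "g \<in> ?H #>\<^bsub>G\<^esub> gs i" using H g by (intro repr_independenceD)
      then obtain k where k: "k \<in> carrier G" "g = A k \<otimes>\<^bsub>G\<^esub> gs i" by (auto simp: r_coset_def)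
      then have "rt z = rt (act k (\<psi> i x))"
        using g i by (simp add: equivariant rt_\<psi> act_mult A_carrier gs_carrier)
      then have "inv_into UNIV rt (rt z) = inv_into UNIV rt (rt (act k (\<psi> i x)))" by simp
      then have "z = act k (\<psi> i x)" by (simp only: inv_rt)
      then have "y = p (\<psi> i x)" using z p_act[OF k(1)] by simp
      then show "y \<in> (\<lambda>i. p (\<psi> i x)) ` {1..q}" using i by blast
    qed
  qed
qed

end

section \<open>Endomorphisms as matrix functions on the cover\<close>

type_synonym 'n cmat = "(complex^'n) \<Rightarrow>\<^sub>L (complex^'n)"
type_synonym ('x, 'n) cmatfun = "'x \<Rightarrow>\<^sub>C 'n cmat"

text \<open>The imaginary part is recovered by multiplying with \<open>\<i>\<close>. This is how
  facts on the real inner product and complex linear maps become facts on the hermitian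
  form.\<close>

lemma cinner_eq: "cinner u v = Complex (inner u v) (- inner u (\<i> *s v))"
  by (simp add: cinner_def complex_eq_iff inner_vec_def inner_complex_def Re_sum Im_sum
      flip: sum_negf)

lemma scaleR_vec_complex: "t *\<^sub>R (v :: complex^'n) = complex_of_real t *s v"
  by (simp add: vec_eq_iff) (simp add: scaleR_conv_of_real)

lemma norm_eq_cinner: "norm v = sqrt (Re (cinner v v))"
  by (simp add: cinner_eq norm_eq_sqrt_inner)

definition clinear :: "('n::finite cmat) \<Rightarrow> bool" where
  "clinear A \<longleftrightarrow> (\<forall>c v. A (c *s v) = c *s A v)"

context lipschitz_pullback_trivialization
begin

definition coord :: "'x \<Rightarrow> 'e \<Rightarrow> complex^'n" where
  "coord x = inv_into UNIV (\<Phi> x)"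

lemma proj_\<Phi> [simp]: "proj \<xi> (\<Phi> x v) = p x"
  using \<Phi>_homeo by (fastforce simp: homeomorphism_def)

lemma \<Phi>_fibre [simp]: "\<Phi> x v \<in> fibre \<xi> (p x)"
  by (simp add: fibre_def)

lemma coord_\<Phi> [simp]: "coord x (\<Phi> x v) = v"
proof -
  obtain k where k: "homeomorphism UNIV {(x, e). proj \<xi> e = p x} (\<lambda>(x, v). (x, \<Phi> x v)) k"
    using \<Phi>_homeo by blast
  have "inj (\<Phi> x)"
  proof (rule injI)
    fix u v assume "\<Phi> x u = \<Phi> x v"
    then have "k (x, \<Phi> x u) = k (x, \<Phi> x v)" by simp
    then show "u = v" using homeomorphism_apply1[OF k, of "(x, u)"] homeomorphism_apply1[OF k, of "(x, v)"] by simp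
  qed
  then show ?thesis by (simp add: coord_def)
qed

lemma \<Phi>_coord [simp]: "proj \<xi> e = p x \<Longrightarrow> \<Phi> x (coord x e) = e"
proof -
  assume e: "proj \<xi> e = p x"
  obtain k where k: "homeomorphism UNIV {(x, e). proj \<xi> e = p x} (\<lambda>(x, v). (x, \<Phi> x v)) k"
    using \<Phi>_homeo by blast
  have "(x, e) \<in> (\<lambda>(x, v). (x, \<Phi> x v)) ` UNIV"
    using e homeomorphism_image1[OF k] by auto
  then obtain v where "e = \<Phi> x v" by auto
  then show ?thesis by simp
qed

lemma \<Phi>_inject: "\<Phi> x u = \<Phi> x v \<longleftrightarrow> u = v"
  by (metis coord_\<Phi>)

lemma continuous_\<Phi>:
  "continuous_on S f \<Longrightarrow> continuous_on S g \<Longrightarrow> continuous_on S (\<lambda>t. \<Phi> (f t) (g t))"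
proof -
  assume fg: "continuous_on S f" "continuous_on S g"
  obtain k where k: "homeomorphism UNIV {(x, e). proj \<xi> e = p x} (\<lambda>(x, v). (x, \<Phi> x v)) k"
    using \<Phi>_homeo by blast
  have "continuous_on S (\<lambda>t. snd ((\<lambda>(x, v). (x, \<Phi> x v)) (f t, g t)))"
    by (intro continuous_on_snd continuous_on_compose2[OF homeomorphism_cont1[OF k]] continuous_on_Pair fg) auto
  then show ?thesis by simp
qed

lemma continuous_coord:
  assumes "continuous_on S f" "continuous_on S g" and fg: "\<And>t. t \<in> S \<Longrightarrow> proj \<xi> (g t) = p (f t)"
  shows "continuous_on S (\<lambda>t. coord (f t) (g t))"
proof -
  obtain k where k: "homeomorphism UNIV {(x, e). proj \<xi> e = p x} (\<lambda>(x, v). (x, \<Phi> x v)) k"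
    using \<Phi>_homeo by blast
  have "continuous_on S (\<lambda>t. snd (k (f t, g t)))"
    by (intro continuous_on_snd continuous_on_compose2[OF homeomorphism_cont2[OF k]] continuous_on_Pair assms)
      (auto simp: fg)
  moreover have "snd (k (f t, g t)) = coord (f t) (g t)" if "t \<in> S" for t
    using homeomorphism_apply1[OF k, of "(f t, coord (f t) (g t))"] fg[OF that] by simp
  ultimately show ?thesis
    using continuous_on_cong by (metis (no_types, lifting))
qed

lemma coord_add: "proj \<xi> e = p x \<Longrightarrow> proj \<xi> f = p x \<Longrightarrow> coord x (vadd \<xi> e f) = coord x e + coord x f"
  by (metis \<Phi>_add \<Phi>_coord coord_\<Phi>)

lemma coord_scale: "proj \<xi> e = p x \<Longrightarrow> coord x (vscale \<xi> c e) = c *s coord x e"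
  by (metis \<Phi>_scale \<Phi>_coord coord_\<Phi>)

lemma fibre_comm_group: "comm_group (fibre_group \<xi> y)"
  using fibre_vector_space[of y] by (simp add: complex_vector_space_on_def fibre_group_def)

lemma \<Phi>_zero: "\<Phi> x 0 = vzero \<xi> (p x)"
proof -
  interpret comm_group "fibre_group \<xi> (p x)" by (rule fibre_comm_group)
  have "\<Phi> x 0 \<otimes>\<^bsub>fibre_group \<xi> (p x)\<^esub> \<Phi> x 0 = \<Phi> x 0"
    by (simp add: fibre_group_def flip: \<Phi>_add)
  then have "\<Phi> x 0 = \<one>\<^bsub>fibre_group \<xi> (p x)\<^esub>"
    using l_cancel_one' by (metis \<Phi>_fibre fibre_group_def l_cancel_one partial_object.select_convs(1))
  then show ?thesis by (simp add: fibre_group_def)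
qed

abbreviation fibre_sum :: "'x \<Rightarrow> ('i \<Rightarrow> 'e) \<Rightarrow> 'i set \<Rightarrow> 'e" where
  "fibre_sum x \<equiv> finprod (fibre_group \<xi> (p x))"

lemma finprod_fibre:
  assumes "finite S"
  shows "fibre_sum x (\<lambda>i. \<Phi> x (f i)) S = \<Phi> x (\<Sum>i\<in>S. f i)"
proof -
  interpret comm_group "fibre_group \<xi> (p x)" by (rule fibre_comm_group)
  show ?thesis using assms
  proof (induction S rule: finite_induct)
    case empty
    have "\<one>\<^bsub>fibre_group \<xi> (p x)\<^esub> = \<Phi> x 0" by (simp add: fibre_group_def \<Phi>_zero)
    then show ?case by simp
  next
    case (insert i S)
    have "\<Phi> x v \<in> carrier (fibre_group \<xi> (p x))" for v by (simp add: fibre_group_def)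
    then show ?case
      using insert finprod_insert[of S i "\<lambda>i. \<Phi> x (f i)"]
      by (simp add: Pi_def) (simp add: fibre_group_def \<Phi>_add)
  qed
qed

lemma norm_\<Phi>: "fibre_norm \<xi> (\<Phi> x v) = norm v"
  by (simp add: fibre_norm_def \<Phi>_isometric norm_eq_cinner)

text \<open>Two lifts are allowed because the same notion has to describe \<open>m\<close>, which
  joins different fibres, and the identity seen in two frames of one fibre.\<close>

definition in_coords :: "'x \<Rightarrow> 'x \<Rightarrow> ('e \<Rightarrow> 'e) \<Rightarrow> 'n cmat" where
  "in_coords x x' F = Blinfun (\<lambda>v. coord x' (F (\<Phi> x v)))"

lemma assumes F: "fibre_linear \<xi> (p x) (p x') F"
  shows in_coords_apply: "in_coords x x' F v = coord x' (F (\<Phi> x v))"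
    and \<Phi>_in_coords: "\<Phi> x' (in_coords x x' F v) = F (\<Phi> x v)"
    and clinear_in_coords: "clinear (in_coords x x' F)"
proof -
  have pF: "proj \<xi> (F (\<Phi> x v)) = p x'" for v
    using F by (auto simp: fibre_linear_def fibre_def)
  have add: "coord x' (F (\<Phi> x (u + v))) = coord x' (F (\<Phi> x u)) + coord x' (F (\<Phi> x v))" for u v
    using F by (simp add: \<Phi>_add fibre_linear_def fibre_def flip: coord_add[OF pF pF])
  have scale: "coord x' (F (\<Phi> x (c *s v))) = c *s coord x' (F (\<Phi> x v))" for c v
    using F by (simp add: \<Phi>_scale fibre_linear_def fibre_def flip: coord_scale[OF pF])
  have "linear (\<lambda>v. coord x' (F (\<Phi> x v)))"
    by (rule linearI) (simp_all add: add scale scaleR_vec_complex)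
  then have "bounded_linear (\<lambda>v. coord x' (F (\<Phi> x v)))"
    by (simp add: linear_conv_bounded_linear)
  then show app: "in_coords x x' F v = coord x' (F (\<Phi> x v))" for v
    by (simp add: in_coords_def bounded_linear_Blinfun_apply)
  show "\<Phi> x' (in_coords x x' F v) = F (\<Phi> x v)"
    by (simp add: app pF)
  show "clinear (in_coords x x' F)"
    by (simp add: clinear_def app scale)
qed

text \<open>This is descent and not invariance: \<open>\<Phi> x\<close> and \<open>\<Phi> x'\<close>
  are different frames of the same fibre, so \<open>g x\<close> and \<open>g x'\<close> are in
  general only conjugate by a unitary.\<close>

definition compatible :: "('x \<Rightarrow> 'n cmat) \<Rightarrow> bool" where
  "compatible g \<longleftrightarrow> (\<forall>x. clinear (g x)) \<and>
    (\<forall>x x' e. p x = p x' \<longrightarrow> proj \<xi> e = p x \<longrightarrow> \<Phi> x (g x (coord x e)) = \<Phi> x' (g x' (coord x' e)))"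

text \<open>The frames are isometric, so the norm descends to the base although the matrices do
  not.\<close>

lemma compatible_norm:
  assumes "compatible g" "p x = p x'" shows "norm (g x) = norm (g x')"
proof -
  have le: "norm (g x) \<le> norm (g x')" if p: "p x = p x'" for x x'
  proof (rule norm_blinfun_bound)
    fix v
    have "norm (g x v) = fibre_norm \<xi> (\<Phi> x (g x (coord x (\<Phi> x v))))" by (simp add: norm_\<Phi>)
    also have "\<dots> = fibre_norm \<xi> (\<Phi> x' (g x' (coord x' (\<Phi> x v))))"
      using assms(1) p by (metis compatible_def proj_\<Phi>)
    also have "\<dots> = norm (g x' (coord x' (\<Phi> x v)))" by (rule norm_\<Phi>)
    also have "\<dots> \<le> norm (g x') * norm (coord x' (\<Phi> x v))" by (rule norm_blinfun)
    also have "norm (coord x' (\<Phi> x v)) = fibre_norm \<xi> (\<Phi> x' (coord x' (\<Phi> x v)))" by (simp only: norm_\<Phi>)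
    also have "\<dots> = norm v" by (simp add: p norm_\<Phi>)
    finally show "norm (g x v) \<le> norm (g x') * norm v" .
  qed simp
  show ?thesis using le[of x x'] le[of x' x] assms(2) by simp
qed

definition E :: "('x, 'n) cmatfun set" where
  "E = {f. compatible (apply_bcontfun f)}"

definition down :: "('x, 'n) cmatfun \<Rightarrow> 'e \<Rightarrow> 'e" where
  "down f e = (let x = SOME x. p x = proj \<xi> e in \<Phi> x (f x (coord x e)))"

end

locale covering_bundle =
  expanding_covering G act p rt \<theta> xt0 A q gs r + lipschitz_pullback_trivialization p \<xi> \<Phi>
  for G :: "'g monoid" and act :: "'g \<Rightarrow> 'x::metric_space \<Rightarrow> 'x"
    and p :: "'x \<Rightarrow> 'b::topological_space"
    and rt :: "'x \<Rightarrow> 'x" and \<theta> :: real and xt0 :: 'x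
    and A :: "'g \<Rightarrow> 'g" and q :: nat and gs :: "nat \<Rightarrow> 'g" and r :: "'b \<Rightarrow> 'b"
    and \<xi> :: "('b, 'e::topological_space, 'n::finite) hbundle"
    and \<Phi> :: "'x \<Rightarrow> complex^'n \<Rightarrow> 'e"
begin

lemma lift_exists: "\<exists>x v. e = \<Phi> x v"
  by (metis p_surj \<Phi>_coord)

text \<open>Openness of \<open>p\<close> passes to the pullback: inside a product box
  \<open>S \<times> T\<close>, the vectors of \<open>T\<close> that lie over the open image of
  \<open>S\<close> form a neighbourhood. Hence continuity on the total space can be tested on the
  product bundle.\<close>

lemma open_\<Phi>:
  assumes "open W" shows "open ((\<lambda>(x, v). \<Phi> x v) ` W)"
proof -
  let ?P = "{(x, e). proj \<xi> e = p x}"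
  obtain k where k: "homeomorphism UNIV ?P (\<lambda>(x, v). (x, \<Phi> x v)) k"
    using \<Phi>_homeo by blast
  have "openin (top_of_set ?P) ((\<lambda>(x, v). (x, \<Phi> x v)) ` W)"
    using homeomorphism_imp_open_map[OF k, of W] assms by simp
  then obtain W' where W': "open W'" "(\<lambda>(x, v). (x, \<Phi> x v)) ` W = ?P \<inter> W'"
    by (auto simp: openin_open)
  have "(\<lambda>(x, v). \<Phi> x v) ` W = snd ` ((\<lambda>(x, v). (x, \<Phi> x v)) ` W)"
    by (force simp: image_image)
  also have "\<dots> = snd ` (?P \<inter> W')" using W' by simp
  also have "open \<dots>"
    unfolding open_subopen[of "snd ` (?P \<inter> W')"]
  proof
    fix e assume "e \<in> snd ` (?P \<inter> W')"
    then obtain x where x: "proj \<xi> e = p x" "(x, e) \<in> W'" by auto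
    then obtain S T where ST: "open S" "open T" "x \<in> S" "e \<in> T" "S \<times> T \<subseteq> W'"
      using open_prod_elim[OF W'(1) x(2)] by (metis mem_Sigma_iff)
    let ?V = "T \<inter> proj \<xi> -` (p ` S)"
    have "open ?V"
      by (intro open_Int ST open_vimage[OF open_p proj_continuous])
    moreover have "e \<in> ?V" using x ST by auto
    moreover have "?V \<subseteq> snd ` (?P \<inter> W')"
    proof
      fix e' assume "e' \<in> ?V"
      then obtain x' where "x' \<in> S" "proj \<xi> e' = p x'" "e' \<in> T" by auto
      then have "(x', e') \<in> ?P \<inter> W'" using ST(5) by auto
      then show "e' \<in> snd ` (?P \<inter> W')" by force
    qed
    ultimately show "\<exists>T. open T \<and> e \<in> T \<and> T \<subseteq> snd ` (?P \<inter> W')" by blast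
  qed
  finally show ?thesis .
qed

lemma continuous_on_down:
  assumes "continuous_on UNIV (\<lambda>(x, v). F (\<Phi> x v))"
  shows "continuous_on UNIV (F :: 'e \<Rightarrow> 'e)"
  unfolding continuous_on_open_vimage[OF open_UNIV]
proof (intro allI impI)
  fix B :: "'e set" assume B: "open B"
  have "open ((\<lambda>(x, v). F (\<Phi> x v)) -` B)"
    by (rule open_vimage[OF B assms])
  moreover have "F -` B = (\<lambda>(x, v). \<Phi> x v) ` ((\<lambda>(x, v). F (\<Phi> x v)) -` B)"
  proof (intro equalityI subsetI)
    fix e assume "e \<in> F -` B"
    moreover obtain x v where "e = \<Phi> x v" using lift_exists by blast
    ultimately show "e \<in> (\<lambda>(x, v). \<Phi> x v) ` ((\<lambda>(x, v). F (\<Phi> x v)) -` B)"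
      by (auto intro!: image_eqI[of _ _ "(x, v)"])
  qed auto
  ultimately show "open (F -` B \<inter> UNIV)"
    using open_\<Phi> by simp
qed

lemma compatible_bcontfun:
  assumes g: "compatible g" "continuous_on UNIV g"
  shows "\<exists>f\<in>E. apply_bcontfun f = g"
proof -
  obtain c where "\<And>x. norm (g x) \<le> c"
    using invariant_bounded[of "\<lambda>x. norm (g x)"] compatible_norm[OF g(1)] continuous_on_norm[OF g(2)]
    by blast
  then have "g \<in> bcontfun" using g(2) by (intro bcontfun_normI)
  then show ?thesis using g(1) by (intro bexI[of _ "Bcontfun g"]) (simp_all add: E_def Bcontfun_inverse)
qed

lemma down_eq:
  assumes f: "f \<in> E" and x: "p x = proj \<xi> e"
  shows "down f e = \<Phi> x (f x (coord x e))"
proof -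
  let ?x = "SOME x. p x = proj \<xi> e"
  have "p ?x = proj \<xi> e" using x by (rule someI)
  moreover have "compatible (apply_bcontfun f)" using f by (simp add: E_def)
  ultimately show ?thesis
    using x unfolding compatible_def down_def Let_def by simp
qed

lemma down_\<Phi>: "f \<in> E \<Longrightarrow> down f (\<Phi> x v) = \<Phi> x (f x v)"
  by (simp add: down_eq[where x = x])

lemma clinear_E: "f \<in> E \<Longrightarrow> f x (c *s v) = c *s f x v"
  by (simp add: E_def compatible_def clinear_def)

lemma norm_E: "f \<in> E \<Longrightarrow> p x = p x' \<Longrightarrow> norm (f x) = norm (f x')"
  by (rule compatible_norm) (simp_all add: E_def)

text \<open>Membership in \<open>E\<close> comes from representing a map \<open>F\<close> of the
  total space, which does not see the lift. The operations of the algebra are transported by this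
  rule.\<close>

lemma E_eqI:
  assumes "\<And>x. clinear (apply_bcontfun g x)" "\<And>x v. \<Phi> x (apply_bcontfun g x v) = F (\<Phi> x v)"
  shows "g \<in> E" "down g = F"
proof -
  have Fe: "\<Phi> x (g x (coord x e)) = F e" if "proj \<xi> e = p x" for x e
    using that assms(2)[of x "coord x e"] by simp
  then show g: "g \<in> E"
    using assms(1) by (auto simp: E_def compatible_def)
  show "down g = F"
  proof
    fix e
    obtain x v where "e = \<Phi> x v" using lift_exists by blast
    then show "down g e = F e" by (simp add: down_\<Phi> g assms(2))
  qed
qed

lemma down_in:
  assumes f: "f \<in> E" shows "down f \<in> bundle_End \<xi>"
proof -
  have "continuous_on UNIV (\<lambda>(x, v). down f (\<Phi> x v))"
    unfolding down_\<Phi>[OF f] split_beta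
    by (intro continuous_\<Phi> continuous_intros blinfun.continuous_on
        continuous_on_compose2[OF continuous_on_apply_bcontfun]) auto
  then have "continuous_on UNIV (down f)" by (rule continuous_on_down)
  moreover have "fibre_linear \<xi> y y (down f)" for y
  proof -
    obtain x where x: "p x = y" using p_surj by blast
    have "proj \<xi> (down f e) = p x" if "proj \<xi> e = p x" for e
      using that by (simp add: down_eq[OF f, of x])
    moreover have "down f (vadd \<xi> e e') = vadd \<xi> (down f e) (down f e')"
      if e: "proj \<xi> e = p x" "proj \<xi> e' = p x" for e e'
    proof -
      obtain u v where "e = \<Phi> x u" "e' = \<Phi> x v" using e by (metis \<Phi>_coord)
      then show ?thesis by (simp add: down_\<Phi>[OF f] blinfun.add_right flip: \<Phi>_add)
    qed
    moreover have "down f (vscale \<xi> c e) = vscale \<xi> c (down f e)"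
      if e: "proj \<xi> e = p x" for e c
    proof -
      obtain u where "e = \<Phi> x u" using e by (metis \<Phi>_coord)
      then show ?thesis by (simp add: down_\<Phi>[OF f] clinear_E[OF f] flip: \<Phi>_scale)
    qed
    ultimately show ?thesis by (simp add: fibre_linear_def fibre_def x)
  qed
  ultimately show ?thesis by (simp add: bundle_End_def)
qed

lemma down_surj:
  assumes F: "F \<in> bundle_End \<xi>" shows "\<exists>f\<in>E. down f = F"
proof -
  have lin: "fibre_linear \<xi> (p x) (p x) F" and cont: "continuous_on UNIV F" for x
    using F by (auto simp: bundle_End_def)
  have pF: "proj \<xi> (F (\<Phi> x v)) = p x" for x v
    using lin[of x] by (auto simp: fibre_linear_def fibre_def)
  define g where "g x = in_coords x x F" for x
  have g: "\<Phi> x (g x v) = F (\<Phi> x v)" for x v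
    unfolding g_def by (rule \<Phi>_in_coords[OF lin])
  have cl: "clinear (g x)" for x
    unfolding g_def by (rule clinear_in_coords[OF lin])
  have "compatible g"
    using g by (auto simp: compatible_def cl)
  moreover have "continuous_on UNIV g"
  proof (rule continuous_on_blinfun_componentwise)
    fix v
    have "continuous_on UNIV (\<lambda>x. coord x (F (\<Phi> x v)))"
      by (intro continuous_coord continuous_on_compose2[OF cont] continuous_\<Phi>)
        (auto simp: pF intro!: continuous_intros)
    then show "continuous_on UNIV (\<lambda>x. g x v)"
      by (simp add: g_def in_coords_apply[OF lin])
  qed
  ultimately obtain f where "f \<in> E" "apply_bcontfun f = g"
    using compatible_bcontfun by blast
  then show ?thesis using E_eqI[of f F] g cl by auto
qed

lemma inj_down: "inj_on down E"
proof (rule inj_onI)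
  fix f g assume fg: "f \<in> E" "g \<in> E" "down f = down g"
  show "f = g"
  proof (intro bcontfun_eqI blinfun_eqI)
    fix x v
    have "\<Phi> x (f x v) = \<Phi> x (g x v)"
      using fg by (simp flip: down_\<Phi>)
    then show "f x v = g x v" by (simp add: \<Phi>_inject)
  qed
qed

end

section \<open>Lipschitz transition functions\<close>

lemma inner_scale_right: "inner u (c *s v) = inner (cnj c *s u) v"
  for u v :: "complex^'n::finite"
  by (simp add: inner_vec_def inner_complex_def algebra_simps)

lemma clinearD: "clinear A \<Longrightarrow> A (c *s v) = c *s A v"
  by (simp add: clinear_def)

lemma clinear_adj: "clinear A \<Longrightarrow> clinear (adj A)"
  unfolding clinear_def
proof (intro allI)
  fix c v assume A: "\<forall>c v. A (c *s v) = c *s A v"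
  have "inner u (adj A (c *s v)) = inner u (c *s adj A v)" for u
    using A by (simp add: adj_inner_right inner_scale_right)
  then show "adj A (c *s v) = c *s adj A v"
    using vector_eq_ldot by metis
qed

lemma cinner_adj: "clinear A \<Longrightarrow> cinner (adj A u) v = cinner u (A v)"
  by (simp add: cinner_eq adj_inner_left clinearD)

lemma clinear_compose: "clinear A \<Longrightarrow> clinear B \<Longrightarrow> clinear (A o\<^sub>L B)"
  by (simp add: clinear_def)

lemma clinear_add: "clinear A \<Longrightarrow> clinear B \<Longrightarrow> clinear (A + B)"
  by (simp add: clinear_def blinfun.add_left vector_add_ldistrib)

lemma clinear_0: "clinear 0"
  by (simp add: clinear_def)

lemma clinear_sum: "(\<And>i. i \<in> I \<Longrightarrow> clinear (A i)) \<Longrightarrow> clinear (sum A I)"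
  by (induction I rule: infinite_finite_induct) (auto simp: clinear_0 clinear_add)

lemma norm_scale_vec: "norm (c *s v) = cmod c * norm v" for v :: "complex^'n::finite"
  by (simp add: norm_vec_def L2_set_def norm_mult power_mult_distrib real_sqrt_mult flip: sum_distrib_left)

definition cmul :: "complex \<Rightarrow> 'n::finite cmat" where
  "cmul c = Blinfun (\<lambda>v. c *s v)"

lemma cmul_apply [simp]: "cmul c v = c *s v" for v :: "complex^'n::finite"
proof -
  have "bounded_linear (\<lambda>v :: complex^'n. c *s v)"
    by (rule bounded_linear_intro[where K = "cmod c"])
      (simp_all add: vector_add_ldistrib scaleR_vec_complex norm_scale_vec mult.commute)
  then show ?thesis by (simp add: cmul_def bounded_linear_Blinfun_apply)
qed

definition of_mat :: "complex^'n^'n::finite \<Rightarrow> 'n cmat" where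
  "of_mat M = Blinfun (\<lambda>v. M *v v)"

text \<open>A crude factor between the matrix norm, in which the Lipschitz assumptions are stated,
  and the operator norm.\<close>

definition mat_const :: "'n::finite itself \<Rightarrow> real" where
  "mat_const _ = real CARD('n) * real CARD('n)"

lemma norm_matrix_vector: "norm (M *v v) \<le> mat_const TYPE('n) * norm M * norm v"
  for M :: "complex^'n^'n::finite"
proof -
  have "norm ((M *v v) $ i) \<le> real CARD('n) * (norm M * norm v)" for i
  proof -
    have "norm ((M *v v) $ i) \<le> (\<Sum>j\<in>UNIV. norm (M $ i $ j * v $ j))"
      unfolding matrix_vector_mult_def by (simp add: norm_sum)
    also have "\<dots> \<le> (\<Sum>j\<in>(UNIV :: 'n set). norm M * norm v)"
      unfolding norm_mult
      by (intro sum_mono mult_mono Finite_Cartesian_Product.norm_nth_le norm_ge_zero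
          order_trans[OF Finite_Cartesian_Product.norm_nth_le[of "M $ i" for i]])
    finally show ?thesis by simp
  qed
  then have "(\<Sum>i\<in>UNIV. norm ((M *v v) $ i)) \<le> (\<Sum>i\<in>(UNIV :: 'n set). real CARD('n) * (norm M * norm v))"
    by (rule sum_mono)
  then show ?thesis
    using L2_set_le_sum[of UNIV "\<lambda>i. norm ((M *v v) $ i)"]
    by (simp add: norm_vec_def[of "M *v v"] mat_const_def ac_simps)
qed

lemma of_mat_apply [simp]: "of_mat M v = M *v v" for M :: "complex^'n^'n::finite"
proof -
  have "bounded_linear (\<lambda>v. M *v v)"
    by (rule bounded_linear_intro[where K = "mat_const TYPE('n) * norm M"])
      (simp_all add: matrix_vector_right_distrib scaleR_vec_complex vector_scalar_commute
        order_trans[OF norm_matrix_vector] mult.commute)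
  then show ?thesis by (simp add: of_mat_def bounded_linear_Blinfun_apply)
qed

lemma mat_const_nonneg: "0 \<le> mat_const T"
  by (simp add: mat_const_def)

lemma norm_of_mat: "norm (of_mat M) \<le> mat_const TYPE('n) * norm M" for M :: "complex^'n^'n::finite"
  by (rule norm_blinfun_bound) (simp_all add: norm_matrix_vector mat_const_nonneg)

lemma of_mat_diff: "of_mat (M - N) = of_mat M - of_mat N"
  by (rule blinfun_eqI) (simp add: blinfun.diff_left matrix_vector_mult_diff_rdistrib)

lemma of_mat_lipschitz:
  fixes M :: "'x::metric_space \<Rightarrow> complex^'n^'n::finite"
  assumes "C-lipschitz_on S M" "x \<in> S" "y \<in> S"
  shows "norm (of_mat (M x) - of_mat (M y)) \<le> mat_const TYPE('n) * C * dist x y"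
proof -
  have "norm (of_mat (M x) - of_mat (M y)) \<le> mat_const TYPE('n) * norm (M x - M y)"
    unfolding of_mat_diff[symmetric] by (rule norm_of_mat)
  also have "\<dots> \<le> mat_const TYPE('n) * (C * dist x y)"
    using lipschitz_onD[OF assms] by (intro mult_left_mono mat_const_nonneg) (simp add: dist_norm)
  finally show ?thesis by (simp add: ac_simps)
qed

section \<open>Adjoints and frame changes\<close>

context lipschitz_pullback_trivialization
begin

lemma fibre_adjoint_coords:
  assumes T: "fibre_linear \<xi> (p x) (p x') T" and e: "proj \<xi> e = p x'"
  shows "fibre_adjoint \<xi> (p x) T e = \<Phi> x (adj (in_coords x x' T) (coord x' e))"
  unfolding fibre_adjoint_def
proof (rule the_equality)
  let ?B = "in_coords x x' T"
  have herm_T: "herm \<xi> e (T (\<Phi> x v)) = cinner (adj ?B (coord x' e)) v" for v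
  proof -
    have "herm \<xi> e (T (\<Phi> x v)) = herm \<xi> (\<Phi> x' (coord x' e)) (\<Phi> x' (?B v))"
      by (simp add: e \<Phi>_in_coords[OF T])
    then show ?thesis
      by (simp add: \<Phi>_isometric cinner_adj[OF clinear_in_coords[OF T]])
  qed
  have fibre_ex: "\<exists>v. f = \<Phi> x v" if "f \<in> fibre \<xi> (p x)" for f
  proof
    show "f = \<Phi> x (coord x f)" using that by (simp add: fibre_def)
  qed
  show "\<Phi> x (adj ?B (coord x' e)) \<in> fibre \<xi> (p x) \<and>
      (\<forall>f\<in>fibre \<xi> (p x). herm \<xi> (\<Phi> x (adj ?B (coord x' e))) f = herm \<xi> e (T f))"
  proof (intro conjI ballI)
    fix f assume "f \<in> fibre \<xi> (p x)"
    then obtain v where "f = \<Phi> x v" using fibre_ex by blast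
    then show "herm \<xi> (\<Phi> x (adj ?B (coord x' e))) f = herm \<xi> e (T f)"
      by (simp add: herm_T \<Phi>_isometric)
  qed simp
  fix u assume u: "u \<in> fibre \<xi> (p x) \<and> (\<forall>f\<in>fibre \<xi> (p x). herm \<xi> u f = herm \<xi> e (T f))"
  then obtain w where w: "u = \<Phi> x w" using fibre_ex by blast
  have "cinner w v = cinner (adj ?B (coord x' e)) v" for v
  proof -
    have "herm \<xi> (\<Phi> x w) (\<Phi> x v) = herm \<xi> e (T (\<Phi> x v))"
      using u \<Phi>_fibre[of x v] unfolding w by blast
    then show ?thesis by (simp add: herm_T \<Phi>_isometric)
  qed
  then have "inner w v = inner (adj ?B (coord x' e)) v" for v
    by (simp add: cinner_eq)
  then show "u = \<Phi> x (adj ?B (coord x' e))"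
    unfolding w by (metis vector_eq_rdot)
qed

text \<open>For two lifts of one point this is the change of frame, a unitary cocycle by
  \<open>glue_adj\<close> and \<open>glue_trans\<close>. Its values at \<open>x' = act g x\<close>
  measure how far lifts are from being invariant.\<close>

definition glue :: "'x \<Rightarrow> 'x \<Rightarrow> 'n cmat" where
  "glue x x' = in_coords x x' (\<lambda>e. e)"

lemma assumes "p x = p x'"
  shows \<Phi>_glue: "\<Phi> x' (glue x x' v) = \<Phi> x v"
    and glue_apply: "glue x x' v = coord x' (\<Phi> x v)"
    and norm_glue_apply: "norm (glue x x' v) = norm v"
proof -
  have lin: "fibre_linear \<xi> (p x) (p x') (\<lambda>e. e)" by (simp add: fibre_linear_def assms)
  show 1: "\<Phi> x' (glue x x' v) = \<Phi> x v"
    using \<Phi>_in_coords[OF lin] by (simp add: glue_def)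
  show "glue x x' v = coord x' (\<Phi> x v)"
    using in_coords_apply[OF lin] by (simp add: glue_def)
  show "norm (glue x x' v) = norm v"
    by (metis 1 norm_\<Phi>)
qed

lemma norm_glue: "p x = p x' \<Longrightarrow> norm (glue x x') \<le> 1"
  by (rule norm_blinfun_bound) (simp_all add: norm_glue_apply)

lemma glue_adj: "p x = p x' \<Longrightarrow> adj (glue x x') = glue x' x"
proof (rule adj_eqI)
  fix u v assume p: "p x = p x'"
  have "cinner (glue x x' u) v = herm \<xi> (\<Phi> x u) (\<Phi> x' v)"
    by (simp add: p \<Phi>_glue flip: \<Phi>_isometric[of x'])
  also have "\<dots> = cinner u (glue x' x v)"
    by (simp add: p \<Phi>_glue flip: \<Phi>_isometric[of x])
  finally show "inner u (glue x' x v) = inner (glue x x' u) v"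
    by (simp add: cinner_eq)
qed

lemma glue_trans: "p x = p x' \<Longrightarrow> p x' = p x'' \<Longrightarrow> glue x' x'' o\<^sub>L glue x x' = glue x x''"
  by (rule blinfun_eqI) (simp add: glue_apply)

end

section \<open>Operations under \<open>down\<close> and uniform Lipschitz bounds\<close>

context covering_bundle
begin

abbreviation deck :: "'g \<Rightarrow> 'x \<Rightarrow> 'n cmat" where
  "deck g x \<equiv> glue x (act g x)"

lemma down_add: "f \<in> E \<Longrightarrow> g \<in> E \<Longrightarrow> f + g \<in> E \<and> down (f + g) = End_add \<xi> (down f) (down g)"
  by (intro conjI E_eqI[where F = "End_add \<xi> (down f) (down g)"])
    (auto simp: clinear_def blinfun.add_left clinear_E vector_add_ldistrib
      End_add_def down_\<Phi> \<Phi>_add)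

lemma down_zero: "0 \<in> E \<and> down 0 = End_zero \<xi>"
  by (intro conjI E_eqI[where F = "End_zero \<xi>"])
    (auto simp: clinear_def End_zero_def \<Phi>_zero)

definition J :: "complex \<Rightarrow> ('x, 'n) cmatfun" where
  "J c = const_bcontfun (cmul c)"

lemma down_scale: "f \<in> E \<Longrightarrow> J c \<odot> f \<in> E \<and> down (J c \<odot> f) = End_scale \<xi> c (down f)"
  by (intro conjI E_eqI[where F = "End_scale \<xi> c (down f)"])
    (auto simp: clinear_def J_def clinear_E End_scale_def down_\<Phi> \<Phi>_scale
      vector_smult_assoc mult.commute)

lemma down_comp: "f \<in> E \<Longrightarrow> g \<in> E \<Longrightarrow> f \<odot> g \<in> E \<and> down (f \<odot> g) = down f \<circ> down g"
  by (intro conjI E_eqI[where F = "down f \<circ> down g"])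
    (auto simp: clinear_def clinear_E down_\<Phi>)

lemma down_id: "bid \<in> E \<and> down bid = id"
  by (intro conjI E_eqI[where F = id]) (auto simp: clinear_def)

lemma in_coords_down: "f \<in> E \<Longrightarrow> in_coords x x (down f) = f x"
proof (rule blinfun_eqI)
  fix v assume f: "f \<in> E"
  have "fibre_linear \<xi> (p x) (p x) (down f)"
    using down_in[OF f] by (simp add: bundle_End_def)
  then show "in_coords x x (down f) v = f x v"
    by (simp add: in_coords_apply down_\<Phi> f)
qed

lemma down_adj: "f \<in> E \<Longrightarrow> badj f \<in> E \<and> down (badj f) = End_adjoint \<xi> (down f)"
proof -
  assume f: "f \<in> E"
  have "fibre_linear \<xi> (p x) (p x) (down f)" for x
    using down_in[OF f] by (simp add: bundle_End_def)
  from fibre_adjoint_coords[OF this]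
  have "End_adjoint \<xi> (down f) (\<Phi> x v) = \<Phi> x (badj f x v)" for x v
    by (simp add: End_adjoint_def in_coords_down f)
  moreover have "clinear (f x)" for x
    using clinear_E[OF f] by (simp add: clinear_def)
  then have "clinear (badj f x)" for x
    by (simp add: clinear_adj)
  ultimately show ?thesis
    by (intro conjI E_eqI[where F = "End_adjoint \<xi> (down f)"]) auto
qed

lemma E_compatible:
  "f \<in> E \<Longrightarrow> p x = p x' \<Longrightarrow> proj \<xi> e = p x \<Longrightarrow> \<Phi> x (f x (coord x e)) = \<Phi> x' (f x' (coord x' e))"
  unfolding E_def compatible_def by blast

lemma J_in: "J c \<in> E"
  using down_scale[of bid c] down_id by simp

lemma J_of_real: "J (of_real t) = t *\<^sub>R bid"
  by (intro bcontfun_eqI blinfun_eqI) (simp add: J_def blinfun.scaleR_left scaleR_vec_complex)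

lemma subspace_E: "subspace E"
  unfolding subspace_def
proof (intro conjI ballI allI)
  fix f and t :: real assume "f \<in> E"
  then show "t *\<^sub>R f \<in> E"
    using down_scale[of f "of_real t"] by (simp add: J_of_real bcomp.scaleR_left)
qed (simp_all add: down_add down_zero)

lemma closed_E: "closed E"
  unfolding closed_sequential_limits
proof (intro allI impI)
  fix F :: "nat \<Rightarrow> ('x, 'n) cmatfun" and f
  assume "(\<forall>n. F n \<in> E) \<and> F \<longlonglongrightarrow> f"
  then have F: "\<And>n. F n \<in> E" and lim: "F \<longlonglongrightarrow> f" by auto
  have ap: "(\<lambda>n. F n x v) \<longlonglongrightarrow> f x v" for x v
    by (intro blinfun.tendsto tendsto_const bounded_linear.tendsto[OF bounded_linear_apply_bcontfun] lim)
  have "f x (c *s v) = c *s f x v" for x c v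
  proof (rule LIMSEQ_unique[OF ap])
    have "(\<lambda>n. cmul c (F n x v)) \<longlonglongrightarrow> cmul c (f x v)"
      by (intro blinfun.tendsto tendsto_const ap)
    then show "(\<lambda>n. F n x (c *s v)) \<longlonglongrightarrow> c *s f x v"
      by (simp add: clinear_E F)
  qed
  moreover have "\<Phi> x (f x (coord x e)) = \<Phi> x' (f x' (coord x' e))"
    if p: "p x = p x'" "proj \<xi> e = p x" for x x' e
  proof -
    \<comment> \<open>Written with \<open>glue\<close>, compatibility becomes an equation between
      vectors of one fixed space and passes to the limit.\<close>
    have "glue x x' (F n x (coord x e)) = F n x' (coord x' e)" for n
    proof -
      have "\<Phi> x (F n x (coord x e)) = \<Phi> x' (F n x' (coord x' e))"
        by (rule E_compatible[OF F p])
      then show ?thesis using p by (simp add: glue_apply)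
    qed
    moreover have "(\<lambda>n. glue x x' (F n x (coord x e))) \<longlonglongrightarrow> glue x x' (f x (coord x e))"
      by (intro blinfun.tendsto tendsto_const ap)
    ultimately have "glue x x' (f x (coord x e)) = f x' (coord x' e)"
      using LIMSEQ_unique[OF _ ap] by simp
    then show ?thesis using \<Phi>_glue[OF p(1)] by metis
  qed
  ultimately show "f \<in> E"
    unfolding E_def compatible_def clinear_def by blast
qed

text \<open>Both points are translated by the same \<open>g\<close>: this preserves their distance,
  and the two values of a function of \<open>E\<close> are conjugated by frame changes of one group
  element.\<close>

definition in_cover :: "('x \<Rightarrow> real) \<Rightarrow> 'x set \<Rightarrow> 'x \<Rightarrow> 'x \<Rightarrow> bool" where
  "in_cover \<rho> P x y \<longleftrightarrow> (\<exists>x0\<in>P. \<exists>g\<in>carrier G. \<exists>x' y'.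
    x = act g x' \<and> y = act g y' \<and> dist x' y' = dist x y \<and> dist x0 x' < \<rho> x0 \<and> dist x0 y' < \<rho> x0)"

text \<open>A Lebesgue number argument: \<open>x\<close> is caught by a ball of half the radius, and
  \<open>d\<close> is less than the other half, which leaves room for \<open>y\<close>.\<close>

lemma pair_cover:
  assumes "\<And>x. 0 < \<rho> x"
  shows "\<exists>d P. 0 < d \<and> finite P \<and> (\<forall>x y. dist x y \<le> d \<longrightarrow> in_cover \<rho> P x y)"
proof -
  obtain P where P: "finite P" "\<And>x. \<exists>x0\<in>P. \<exists>x'. p x' = p x \<and> dist x0 x' < \<rho> x0 / 2"
    using finite_cover[of "\<lambda>x. \<rho> x / 2"] assms by auto
  define d where "d = Min (\<rho> ` P) / 3"
  have "P \<noteq> {}" using P(2) by blast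
  then have Min: "0 < Min (\<rho> ` P)" using P(1) assms by simp
  then have d: "0 < d" by (simp add: d_def)
  have d2: "d < \<rho> x0 / 2" if "x0 \<in> P" for x0
  proof -
    have "Min (\<rho> ` P) \<le> \<rho> x0" using P(1) that by simp
    with Min show ?thesis by (simp add: d_def)
  qed
  have "in_cover \<rho> P x y" if xy: "dist x y \<le> d" for x y
  proof -
    obtain x0 x' where x': "x0 \<in> P" "p x' = p x" "dist x0 x' < \<rho> x0 / 2" using P(2) by blast
    then obtain g where g: "g \<in> carrier G" "x = act g x'" by (auto simp: p_eq_iff)
    define y' where "y' = act (inv\<^bsub>G\<^esub> g) y"
    have y: "y = act g y'" using g by (simp add: y'_def act_inv')
    have dist: "dist x' y' = dist x y" using isometric[OF g(1), of x' y'] g(2) y by simp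
    have "dist x0 y' < \<rho> x0"
      using dist_triangle[of x0 y' x'] x' dist xy d2[OF x'(1)] by linarith
    moreover have "dist x0 x' < \<rho> x0" using x'(3) assms[of x0] by linarith
    ultimately show ?thesis unfolding in_cover_def using x' g y dist by blast
  qed
  with d P(1) show ?thesis by blast
qed

text \<open>In a chart with fibre coordinate \<open>\<phi>\<close>, the transition from \<open>x\<close> to \<open>g x\<close> is \<open>N (g x) M (x)\<close>. The
  operators \<open>N (g x)\<close> and \<open>N (x)\<close> have the same norm, so that the Lipschitz constant does not depend on \<open>g\<close>.\<close>

lemma glue_locally_lipschitz:
  "\<exists>\<rho>>0. \<exists>c\<ge>0. \<forall>g\<in>carrier G. \<forall>x\<in>ball x0 \<rho>. \<forall>y\<in>ball x0 \<rho>.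
    norm (deck g x - deck g y) \<le> c * dist x y"
proof -
  have "p x0 \<in> (\<Union>(U, \<phi>)\<in>atlas \<xi>. U)"
    unfolding atlas_cover by (rule UNIV_I)
  then obtain U \<phi> where U: "(U, \<phi>) \<in> atlas \<xi>" "p x0 \<in> U"
    by (elim UN_E) (simp split: prod.splits)
  obtain M N C where MN: "\<And>x v. x \<in> p -` U \<Longrightarrow> \<phi> (\<Phi> x v) = M x *v v"
      "\<And>x v. x \<in> p -` U \<Longrightarrow> N x *v \<phi> (\<Phi> x v) = v"
    and lip: "C-lipschitz_on (p -` U) (M :: 'x \<Rightarrow> complex^'n^'n)" "C-lipschitz_on (p -` U) (N :: 'x \<Rightarrow> complex^'n^'n)"
    using \<Phi>_lipschitz[OF U(1)] by blast
  have C: "0 \<le> C" using lip(1) by (rule lipschitz_on_nonneg)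
  have "open (p -` U)" by (rule open_vimage[OF chart_open[OF U(1)] continuous_p])
  then obtain \<rho>0 where \<rho>0: "0 < \<rho>0" "ball x0 \<rho>0 \<subseteq> p -` U"
    using U(2) openE[of "p -` U" x0] by auto
  \<comment> \<open>A radius of at most \<open>1\<close> turns the Lipschitz bounds into bounds for
    the matrices on the ball.\<close>
  define \<rho> where "\<rho> = min \<rho>0 1"
  have \<rho>: "0 < \<rho>" "\<rho> \<le> 1" "ball x0 \<rho> \<subseteq> p -` U" using \<rho>0 by (auto simp: \<rho>_def)
  have x0: "x0 \<in> p -` U" using U(2) by simp
  define K where "K = mat_const TYPE('n) * C"
  have K: "0 \<le> K" using C by (simp add: K_def mat_const_nonneg)
  define b where "b = max (norm (of_mat (M x0))) (norm (of_mat (N x0))) + K"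
  have b: "norm (of_mat (M x)) \<le> b" "norm (of_mat (N x)) \<le> b" if x: "x \<in> ball x0 \<rho>" for x
  proof -
    have "K * dist x x0 \<le> K * 1"
      using K x \<rho> by (intro mult_left_mono) (auto simp: dist_commute)
    moreover have "x \<in> p -` U" using x \<rho> by blast
    ultimately have "norm (of_mat (M x) - of_mat (M x0)) \<le> K" "norm (of_mat (N x) - of_mat (N x0)) \<le> K"
      using of_mat_lipschitz[OF lip(1) _ x0, of x] of_mat_lipschitz[OF lip(2) _ x0, of x]
      by (auto simp: K_def)
    then show "norm (of_mat (M x)) \<le> b" "norm (of_mat (N x)) \<le> b"
      using norm_triangle_sub[of "of_mat (M x)" "of_mat (M x0)"] norm_triangle_sub[of "of_mat (N x)" "of_mat (N x0)"]
      by (auto simp: b_def)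
  qed
  have b0: "0 \<le> b" using b(1)[of x0] \<rho> norm_ge_zero order_trans by (metis centre_in_ball)
  have eq: "deck g x = of_mat (N (act g x)) o\<^sub>L of_mat (M x)"
    if g: "g \<in> carrier G" and x: "x \<in> p -` U" for g x
  proof (rule blinfun_eqI)
    fix v
    have p: "p x = p (act g x)" using g by (simp add: p_act)
    then have "N (act g x) *v \<phi> (\<Phi> (act g x) (deck g x v)) = deck g x v"
      using x by (intro MN) simp
    then show "deck g x v = (of_mat (N (act g x)) o\<^sub>L of_mat (M x)) v"
      using x by (simp add: \<Phi>_glue[OF p] MN)
  qed
  \<comment> \<open>The square matrices \<open>M x\<close> and \<open>N x\<close> are inverse on
    both sides, so \<open>N (act g x)\<close> is \<open>N x\<close> followed by the isometry
    \<open>deck g x\<close>.\<close>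
  have Ng: "norm (of_mat (N (act g x))) \<le> norm (of_mat (N x))"
    if g: "g \<in> carrier G" and x: "x \<in> p -` U" for g x
  proof (rule norm_blinfun_bound)
    fix w
    have "N x ** M x = mat 1"
      unfolding matrix_eq using MN[OF x] by (simp flip: matrix_vector_mul_assoc)
    then have "M x ** N x = mat 1" by (simp add: matrix_left_right_inverse)
    then have w: "w = M x *v (N x *v w)" by (simp add: matrix_vector_mul_assoc)
    have "of_mat (N (act g x)) w = deck g x (N x *v w)"
      by (subst w) (simp add: eq[OF g x])
    then have "norm (of_mat (N (act g x)) w) = norm (of_mat (N x) w)"
      using g by (simp add: norm_glue_apply p_act)
    also have "\<dots> \<le> norm (of_mat (N x)) * norm w" by (rule norm_blinfun)
    finally show "norm (of_mat (N (act g x)) w) \<le> norm (of_mat (N x)) * norm w" .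
  qed simp
  have "norm (deck g x - deck g y) \<le> (2 * b * K) * dist x y"
    if g: "g \<in> carrier G" and x: "x \<in> ball x0 \<rho>" and y: "y \<in> ball x0 \<rho>" for g x y
  proof -
    have U': "x \<in> p -` U" "y \<in> p -` U" "act g x \<in> p -` U" "act g y \<in> p -` U"
      using x y \<rho> g by (auto simp: p_act)
    have "deck g x - deck g y =
        (of_mat (N (act g x)) o\<^sub>L (of_mat (M x) - of_mat (M y))) +
        ((of_mat (N (act g x)) - of_mat (N (act g y))) o\<^sub>L of_mat (M y))"
      unfolding eq[OF g U'(1)] eq[OF g U'(2)]
      by (simp add: blinfun_compose.diff_left blinfun_compose.diff_right)
    also have "norm \<dots> \<le> norm (of_mat (N (act g x))) * norm (of_mat (M x) - of_mat (M y)) +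
        norm (of_mat (N (act g x)) - of_mat (N (act g y))) * norm (of_mat (M y))"
      by (intro norm_triangle_le add_mono norm_blinfun_compose)
    also have "\<dots> \<le> b * (K * dist x y) + (K * dist (act g x) (act g y)) * b"
      unfolding K_def using b0 C
      by (intro add_mono mult_mono of_mat_lipschitz[OF lip(1)] of_mat_lipschitz[OF lip(2)] U'
          order_trans[OF Ng[OF g U'(1)]] b x y) (auto simp: mat_const_nonneg)
    also have "\<dots> = (2 * b * K) * dist x y" by (simp add: isometric g)
    finally show ?thesis .
  qed
  then show ?thesis
    using \<rho>(1) b0 K by (intro exI[of _ \<rho>] conjI exI[of _ "2 * b * K"]) auto
qed

text \<open>For a close pair \<open>act k x'\<close>, \<open>act k y'\<close> the cocycle identity
  factors \<open>deck g\<close> into the frame change of the product of \<open>g\<close> and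
  \<open>k\<close> at a point of the ball and the adjoint of \<open>deck k\<close> there, and the
  local constants hold for every group element. For a distant pair the trivial bound
  \<open>2\<close> for unitaries is enough, whence \<open>2 / d\<close>.\<close>

lemma glue_lipschitz:
  "\<exists>c\<ge>0. \<forall>g\<in>carrier G. \<forall>x y. norm (deck g x - deck g y) \<le> c * dist x y"
proof -
  define Q where "Q x0 \<rho> c \<longleftrightarrow> 0 < \<rho> \<and> (0 :: real) \<le> c \<and> (\<forall>g\<in>carrier G. \<forall>x\<in>ball x0 \<rho>. \<forall>y\<in>ball x0 \<rho>.
    norm (deck g x - deck g y) \<le> c * dist x y)" for x0 \<rho> c
  have "\<exists>\<rho> c. Q x0 \<rho> c" for x0
    using glue_locally_lipschitz[of x0] unfolding Q_def by blast
  then obtain \<rho> c where Q: "\<And>x0. Q x0 (\<rho> x0) (c x0)" by metis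
  have \<rho>: "0 < \<rho> x0" and c: "0 \<le> c x0" for x0 using Q[of x0] by (auto simp: Q_def)
  have lip: "norm (deck g x - deck g y) \<le> c x0 * dist x y"
    if "g \<in> carrier G" "dist x0 x < \<rho> x0" "dist x0 y < \<rho> x0" for x0 g x y
    using Q[of x0] that by (auto simp: Q_def mem_ball)
  obtain d P where d: "0 < d" "finite P" and cover: "\<And>x y. dist x y \<le> d \<Longrightarrow> in_cover \<rho> P x y"
    using pair_cover[of \<rho>] \<rho> by blast
  define K where "K = max (2 / d) (2 * sum c P)"
  have "norm (deck g x - deck g y) \<le> K * dist x y" if g: "g \<in> carrier G" for g x y
  proof (cases "dist x y \<le> d")
    case True
    then obtain x0 k x' y' where x0: "x0 \<in> P" and k: "k \<in> carrier G" and
      xy: "x = act k x'" "y = act k y'" "dist x' y' = dist x y" "dist x0 x' < \<rho> x0" "dist x0 y' < \<rho> x0"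
      using cover unfolding in_cover_def by blast
    have gk: "g \<otimes>\<^bsub>G\<^esub> k \<in> carrier G"
      using g k group_G by (meson group.is_monoid monoid.m_closed)
    have eq: "glue (act k z) (act g (act k z)) =
        glue z (act (g \<otimes>\<^bsub>G\<^esub> k) z) o\<^sub>L adj (deck k z)" for z
      using g k by (simp add: glue_adj glue_trans p_act act_mult)
    let ?a = "\<lambda>z. glue z (act (g \<otimes>\<^bsub>G\<^esub> k) z)" and ?b = "\<lambda>z. adj (deck k z)"
    have "deck g x - deck g y = (?a x' o\<^sub>L (?b x' - ?b y')) + ((?a x' - ?a y') o\<^sub>L ?b y')"
      unfolding xy(1,2) eq by (simp add: blinfun_compose.diff_left blinfun_compose.diff_right)
    also have "norm \<dots> \<le> norm (?a x') * norm (?b x' - ?b y') + norm (?a x' - ?a y') * norm (?b y')"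
      by (intro norm_triangle_le add_mono norm_blinfun_compose)
    also have "\<dots> \<le> 1 * (c x0 * dist x' y') + (c x0 * dist x' y') * 1"
    proof (intro add_mono mult_mono)
      show "norm (?a x') \<le> 1" by (intro norm_glue) (simp only: p_act[OF gk])
      show "norm (?b y') \<le> 1" using k by (simp add: norm_glue p_act)
      show "norm (?a x' - ?a y') \<le> c x0 * dist x' y'" by (rule lip[OF gk xy(4,5)])
      show "norm (?b x' - ?b y') \<le> c x0 * dist x' y'"
        using lip[OF k xy(4,5)] by (simp flip: adj_diff)
    qed (auto simp: c)
    also have "\<dots> = (2 * c x0) * dist x y" by (simp add: xy(3))
    also have "\<dots> \<le> K * dist x y"
      using member_le_sum[of x0 P c] x0 d(2) c by (intro mult_right_mono) (auto simp: K_def)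
    finally show ?thesis .
  next
    case False
    have "norm (deck g x - deck g y) \<le> 1 + 1"
      using g by (intro order_trans[OF norm_triangle_ineq4] add_mono norm_glue) (simp_all add: p_act)
    also have "\<dots> \<le> (2 / d) * dist x y" using False d(1) by (simp add: field_simps)
    also have "\<dots> \<le> K * dist x y" by (intro mult_right_mono) (auto simp: K_def)
    finally show ?thesis .
  qed
  moreover have "0 \<le> K" using d(1) by (auto simp: K_def le_max_iff_disj)
  ultimately show ?thesis by blast
qed

lemma E_translate:
  assumes f: "f \<in> E" and g: "g \<in> carrier G"
  shows "f (act g x) = deck g x o\<^sub>L (f x o\<^sub>L adj (deck g x))"
proof (rule blinfun_eqI)
  fix v
  let ?y = "act g x"
  have p: "p x = p ?y" using g by (simp add: p_act)
  have "\<Phi> ?y (f ?y v) = down f (\<Phi> ?y v)" by (simp add: down_\<Phi> f)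
  also have "\<dots> = down f (\<Phi> x (glue ?y x v))" by (simp only: \<Phi>_glue[OF p[symmetric]])
  also have "\<dots> = \<Phi> ?y (glue x ?y (f x (glue ?y x v)))" by (simp only: down_\<Phi>[OF f] \<Phi>_glue[OF p])
  finally show "f ?y v = (glue x ?y o\<^sub>L (f x o\<^sub>L adj (glue x ?y))) v"
    by (simp add: \<Phi>_inject glue_adj p)
qed

text \<open>Without periodicity, compactness controls \<open>f\<close> only near finitely many
  points. Translating a pair by \<open>k\<close> conjugates the values by \<open>deck k\<close>,
  whose variation is bounded independently of \<open>k\<close>; this costs the term
  \<open>K * dist x y\<close>.\<close>

lemma E_uniformly_continuous:
  assumes f: "f \<in> E" and e: "0 < e"
  shows "\<exists>d>0. \<forall>x y. dist x y \<le> d \<longrightarrow> norm (f x - f y) \<le> e"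
proof -
  have "\<exists>\<rho>>0. \<forall>x y. dist x0 x < \<rho> \<longrightarrow> dist x0 y < \<rho> \<longrightarrow> norm (f x - f y) \<le> e / 2" for x0
  proof -
    have "continuous_on UNIV (apply_bcontfun f)" by simp
    then obtain \<rho> where \<rho>: "0 < \<rho>" "\<And>x. dist x x0 < \<rho> \<Longrightarrow> dist (f x) (f x0) < e / 4"
      unfolding continuous_on_iff using e by (metis UNIV_I zero_less_divide_iff zero_less_numeral)
    have "norm (f x - f y) \<le> e / 2" if "dist x0 x < \<rho>" "dist x0 y < \<rho>" for x y
    proof -
      have "dist (f x) (f x0) < e / 4" "dist (f y) (f x0) < e / 4"
        using \<rho>(2)[of x] \<rho>(2)[of y] that by (simp_all only: dist_commute[of _ x0])
      then show ?thesis using dist_triangle2[of "f x" "f y" "f x0"] by (simp add: dist_norm)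
    qed
    with \<rho>(1) show ?thesis by blast
  qed
  then obtain \<rho> where \<rho>: "\<And>x0. 0 < \<rho> x0"
    "\<And>x0 x y. dist x0 x < \<rho> x0 \<Longrightarrow> dist x0 y < \<rho> x0 \<Longrightarrow> norm (f x - f y) \<le> e / 2"
    by metis
  obtain d P where d: "0 < d" "finite P" and cover: "\<And>x y. dist x y \<le> d \<Longrightarrow> in_cover \<rho> P x y"
    using pair_cover[of \<rho>] \<rho>(1) by blast
  obtain c where c: "0 \<le> c" "\<And>g x y. g \<in> carrier G \<Longrightarrow> norm (deck g x - deck g y) \<le> c * dist x y"
    using glue_lipschitz by blast
  define K where "K = 2 * (c * norm f)"
  have K: "0 \<le> K" using c by (simp add: K_def)
  define d' where "d' = min d (e / (2 * (K + 1)))"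
  have "norm (f x - f y) \<le> e" if xy: "dist x y \<le> d'" for x y
  proof -
    have "dist x y \<le> d" using xy by (simp add: d'_def)
    then obtain x0 k x' y' where x0: "x0 \<in> P" and k: "k \<in> carrier G" and
      xy': "x = act k x'" "y = act k y'" "dist x' y' = dist x y" "dist x0 x' < \<rho> x0" "dist x0 y' < \<rho> x0"
      using cover unfolding in_cover_def by blast
    let ?u = "\<lambda>z. deck k z"
    have u: "norm (?u z) \<le> 1" for z using k by (intro norm_glue) (simp add: p_act)
    have lip: "norm (?u x' - ?u y') \<le> c * dist x y" using c(2)[OF k, of x' y'] xy'(3) by simp
    have "f x - f y = (?u x' o\<^sub>L ((f x' - f y') o\<^sub>L adj (?u x'))) +
        ((?u x' - ?u y') o\<^sub>L (f y' o\<^sub>L adj (?u x'))) +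
        (?u y' o\<^sub>L (f y' o\<^sub>L adj (?u x' - ?u y')))"
      unfolding xy' E_translate[OF f k]
      by (simp add: blinfun_compose.diff_left blinfun_compose.diff_right adj_diff)
    also have "norm \<dots> \<le> 1 * (e / 2 * 1) + (c * dist x y) * (norm f * 1) + 1 * (norm f * (c * dist x y))"
      by (intro norm_triangle_le add_mono norm_compose3_le \<rho>(2)[OF xy'(4,5)] lip norm_bounded)
        (simp_all add: u lip)
    also have "\<dots> = e / 2 + K * dist x y" by (simp add: K_def)
    also have "K * dist x y \<le> K * (e / (2 * (K + 1)))"
      using K xy by (intro mult_left_mono) (auto simp: d'_def)
    also have "\<dots> \<le> e / 2" using K e by (simp add: field_simps)
    finally show ?thesis by simp
  qed
  moreover have "0 < d'" using d e K by (simp add: d'_def)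
  ultimately show ?thesis by blast
qed

lemma E_nets:
  assumes "0 < d"
  shows "\<exists>P. finite P \<and> (\<forall>x. \<exists>y\<in>P. \<exists>x'. dist y x' \<le> d \<and> (\<forall>f\<in>E. norm (f x) = norm (f x')))"
proof -
  obtain P where P: "finite P" "\<And>x. \<exists>y\<in>P. \<exists>x'. p x' = p x \<and> dist y x' < d"
    using finite_cover[of "\<lambda>_. d"] assms by blast
  have "\<exists>y\<in>P. \<exists>x'. dist y x' \<le> d \<and> (\<forall>f\<in>E. norm (f x) = norm (f x'))" for x
    using P(2)[of x] norm_E by (metis less_imp_le)
  with P(1) show ?thesis by blast
qed

end

section \<open>Transport to bundle endomorphisms\<close>

text \<open>All axioms are relative to the carrier, so an injection respecting the operations there
  carries the whole structure. In the dimension axiom the index set \<open>B\<close> moves along,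
  with coefficients read off through the inverse of \<open>D\<close> on \<open>B\<close>.\<close>

lemma finite_dim_cstar_algebra_transport:
  fixes V :: "'v set" and W :: "'w set" and scale :: "complex \<Rightarrow> 'v \<Rightarrow> 'v" and D :: "'v \<Rightarrow> 'w"
    and add mult :: "'v \<Rightarrow> 'v \<Rightarrow> 'v" and zero :: 'v and star :: "'v \<Rightarrow> 'v" and nrm :: "'v \<Rightarrow> real"
    and add' mult' :: "'w \<Rightarrow> 'w \<Rightarrow> 'w" and zero' :: 'w and star' :: "'w \<Rightarrow> 'w" and nrm' :: "'w \<Rightarrow> real"
    and scale' :: "complex \<Rightarrow> 'w \<Rightarrow> 'w"
  assumes alg: "finite_dim_cstar_algebra_on V add zero scale mult star nrm"
    and inj: "inj_on D V" and W: "W = D ` V"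
    and add': "\<And>a b. a \<in> V \<Longrightarrow> b \<in> V \<Longrightarrow> add' (D a) (D b) = D (add a b)"
    and zero': "zero' = D zero"
    and scale': "\<And>c a. a \<in> V \<Longrightarrow> scale' c (D a) = D (scale c a)"
    and mult': "\<And>a b. a \<in> V \<Longrightarrow> b \<in> V \<Longrightarrow> mult' (D a) (D b) = D (mult a b)"
    and star': "\<And>a. a \<in> V \<Longrightarrow> star' (D a) = D (star a)"
    and nrm': "\<And>a. a \<in> V \<Longrightarrow> nrm' (D a) = nrm a"
  shows "finite_dim_cstar_algebra_on W add' zero' scale' mult' star' nrm'"
proof -
  interpret finite_dim_cstar_algebra_on V add zero scale mult star nrm by (rule alg)
  let ?V = "\<lparr>carrier = V, monoid.mult = add, one = zero\<rparr>"
  let ?W = "\<lparr>carrier = W, monoid.mult = add', one = zero'\<rparr>"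
  interpret V: comm_group ?V by (rule add_group)
  have zero: "zero \<in> V" using V.one_closed by simp
  have add: "add a b \<in> V" if "a \<in> V" "b \<in> V" for a b using V.m_closed that by simp
  have W_ex: "\<exists>a\<in>V. w = D a" if "w \<in> W" for w using that W by auto
  have DW: "D a \<in> W" if "a \<in> V" for a using that W by auto
  have W_group: "comm_group ?W"
  proof (rule comm_groupI)
    fix x assume "x \<in> carrier ?W"
    then obtain a where a: "a \<in> V" "x = D a" using W_ex by auto
    obtain b where "b \<in> V" "add b a = zero" using V.l_inv_ex a by auto
    then show "\<exists>y\<in>carrier ?W. y \<otimes>\<^bsub>?W\<^esub> x = \<one>\<^bsub>?W\<^esub>"
      using a by (intro bexI[of _ "D b"]) (simp_all add: add' zero' DW)
    show "\<one>\<^bsub>?W\<^esub> \<otimes>\<^bsub>?W\<^esub> x = x"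
      using a zero V.l_one by (simp add: add' zero')
  next
    fix x y assume "x \<in> carrier ?W" "y \<in> carrier ?W"
    then obtain a b where ab: "a \<in> V" "x = D a" "b \<in> V" "y = D b" using W_ex by (metis partial_object.select_convs(1))
    then show "x \<otimes>\<^bsub>?W\<^esub> y \<in> carrier ?W" by (simp add: add' DW add)
    show "x \<otimes>\<^bsub>?W\<^esub> y = y \<otimes>\<^bsub>?W\<^esub> x"
      using ab V.m_comm by (simp add: add')
    fix z assume "z \<in> carrier ?W"
    then obtain c where "c \<in> V" "z = D c" using W_ex by auto
    then show "x \<otimes>\<^bsub>?W\<^esub> y \<otimes>\<^bsub>?W\<^esub> z = x \<otimes>\<^bsub>?W\<^esub> (y \<otimes>\<^bsub>?W\<^esub> z)"
      using ab V.m_assoc by (simp add: add' add)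
  qed (simp add: zero' DW zero)
  interpret W: comm_group ?W by (rule W_group)
  have prod: "finprod ?W (\<lambda>b. D (f b)) B = D (finprod ?V f B)" if "finite B" "\<And>b. b \<in> B \<Longrightarrow> f b \<in> V" for f B
    using that
  proof (induction B rule: finite_induct)
    case empty
    show ?case using V.finprod_empty[of f] W.finprod_empty[of "\<lambda>b. D (f b)"] by (simp add: zero')
  next
    case (insert b B)
    have "finprod ?V f B \<in> carrier ?V"
      by (rule V.finprod_closed) (use insert in auto)
    then show ?case
      using insert V.finprod_insert[of B b f] W.finprod_insert[of B b "\<lambda>b. D (f b)"]
      by (simp add: Pi_def DW add')
  qed
  have eq: "D a = D b \<longleftrightarrow> a = b" if "a \<in> V" "b \<in> V" for a b
    using inj that by (auto dest: inj_onD)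
  show ?thesis
  proof (intro finite_dim_cstar_algebra_on.intro cstar_algebra_on.intro complex_vector_space_on.intro
      cstar_algebra_on_axioms.intro finite_dim_cstar_algebra_on_axioms.intro)
    show "comm_group ?W" by (rule W_group)
    note ops = add' scale' mult' star' nrm' zero' DW add zero scale_closed mult_closed star_closed
    fix x y z and c c' :: complex
    {
      assume "x \<in> W" then obtain a where a: "a \<in> V" "x = D a" using W_ex by blast
      show "scale' c x \<in> W" "scale' (c + c') x = add' (scale' c x) (scale' c' x)"
        "scale' c (scale' c' x) = scale' (c * c') x" "scale' 1 x = x"
        "star' x \<in> W" "star' (star' x) = x" "star' (scale' c x) = scale' (cnj c) (star' x)"
        "0 \<le> nrm' x" "(nrm' x = 0) = (x = zero')" "nrm' (scale' c x) = cmod c * nrm' x"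
        "nrm' (mult' (star' x) x) = (nrm' x)\<^sup>2"
        using a by (simp_all add: ops scale_add_left scale_scale scale_one star_star star_scale
            norm_nonneg norm_eq_zero norm_scale cstar_identity eq)
      assume "y \<in> W" then obtain b where b: "b \<in> V" "y = D b" using W_ex by blast
      show "scale' c (add' x y) = add' (scale' c x) (scale' c y)" "mult' x y \<in> W"
        "mult' (scale' c x) y = scale' c (mult' x y)" "mult' x (scale' c y) = scale' c (mult' x y)"
        "star' (add' x y) = add' (star' x) (star' y)" "star' (mult' x y) = mult' (star' y) (star' x)"
        "nrm' (add' x y) \<le> nrm' x + nrm' y" "nrm' (mult' x y) \<le> nrm' x * nrm' y"
        using a b by (simp_all add: ops scale_add_right mult_scale_left mult_scale_right star_add star_mult
            norm_triangle norm_mult)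
      assume "z \<in> W" then obtain d where d: "d \<in> V" "z = D d" using W_ex by blast
      show "mult' (mult' x y) z = mult' x (mult' y z)"
        "mult' (add' x y) z = add' (mult' x z) (mult' y z)"
        "mult' x (add' y z) = add' (mult' x y) (mult' x z)"
        using a b d by (simp_all add: ops mult_assoc mult_add_left mult_add_right)
    }
  next
    fix s assume s: "\<And>n::nat. s n \<in> W"
      and Cauchy: "\<And>e. 0 < e \<Longrightarrow> \<exists>N. \<forall>m\<ge>N. \<forall>n\<ge>N. nrm' (add' (s m) (scale' (- 1) (s n))) < e"
    have "\<exists>a. a \<in> V \<and> s n = D a" for n using W_ex[OF s[of n]] by blast
    then obtain a where "\<And>n. a n \<in> V \<and> s n = D (a n)" by metis
    then have a: "\<And>n. a n \<in> V" "\<And>n. s n = D (a n)" by auto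
    have nrm_eq: "nrm' (add' (D u) (scale' (- 1) (D v))) = nrm (add u (scale (- 1) v))"
      if "u \<in> V" "v \<in> V" for u v
      using that by (simp add: add' scale' nrm' add scale_closed)
    have "\<exists>l\<in>V. (\<lambda>n. nrm (add (a n) (scale (- 1) l))) \<longlonglongrightarrow> 0"
      using a(1) Cauchy by (intro norm_complete) (simp_all add: a nrm_eq)
    then obtain l where "l \<in> V" "(\<lambda>n. nrm (add (a n) (scale (- 1) l))) \<longlonglongrightarrow> 0" by blast
    then show "\<exists>l\<in>W. (\<lambda>n. nrm' (add' (s n) (scale' (- 1) l))) \<longlonglongrightarrow> 0"
      by (intro bexI[of _ "D l"]) (simp_all add: a nrm_eq DW)
  next
    obtain B where B: "finite B" "B \<subseteq> V"
      "\<And>v. v \<in> V \<Longrightarrow> \<exists>c. v = finprod ?V (\<lambda>b. scale (c b) b) B"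
      using finite_dim by blast
    have injB: "inj_on D B" using inj B(2) by (rule inj_on_subset)
    have "\<exists>c. w = finprod ?W (\<lambda>b. scale' (c b) b) (D ` B)" if "w \<in> W" for w
    proof -
      obtain v where v: "v \<in> V" "w = D v" using \<open>w \<in> W\<close> W_ex by blast
      obtain c where c: "v = finprod ?V (\<lambda>b. scale (c b) b) B" using B(3) v by blast
      define c' where "c' = (\<lambda>w. c (inv_into B D w))"
      have "finprod ?W (\<lambda>b. scale' (c' b) b) (D ` B) = finprod ?W (\<lambda>b. scale' (c' (D b)) (D b)) B"
        using B(2) by (intro W.finprod_reindex injB) (auto simp: scale' DW scale_closed subset_iff)
      also have "\<dots> = finprod ?W (\<lambda>b. D (scale (c b) b)) B"
        using B(2) injB by (intro W.finprod_cong') (auto simp: c'_def scale' DW scale_closed subset_iff)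
      also have "\<dots> = D v"
        unfolding c using B by (intro prod) (auto simp: scale_closed)
      finally show ?thesis using v by metis
    qed
    then show "\<exists>B. finite B \<and> B \<subseteq> W \<and> (\<forall>v\<in>W. \<exists>c. v = finprod ?W (\<lambda>b. scale' (c b) b) B)"
      using B W by (intro exI[of _ "D ` B"]) auto
  qed
qed

text \<open>Polarization with \<open>\<i>\<close>. Thus positivity of endomorphisms, stated through
  the hermitian form, contains the symmetry that a real quadratic form does not detect.\<close>

lemma complex_selfadjoint_iff:
  assumes A: "clinear A"
  shows "adj A = A \<longleftrightarrow> (\<forall>v. Im (cinner v (A v)) = 0)"
proof
  have Im: "Im (cinner v (A v)) = - inner v (\<i> *s A v)" for v by (simp add: cinner_eq)
  have ii: "\<i> *s (\<i> *s v) = - v" for v :: "complex^'a" by (simp add: vec_eq_iff)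
  {
    assume sa: "adj A = A"
    show "\<forall>v. Im (cinner v (A v)) = 0"
    proof
      fix v
      have "inner v (\<i> *s A v) = inner v (A (\<i> *s v))" by (simp add: clinearD[OF A])
      also have "\<dots> = inner (A v) (\<i> *s v)" using adj_inner_right[of v A "\<i> *s v"] sa by simp
      also have "\<dots> = inner (- (\<i> *s A v)) v"
        unfolding inner_scale_right by simp
      finally show "Im (cinner v (A v)) = 0" by (simp add: Im inner_commute)
    qed
  }
  assume "\<forall>v. Im (cinner v (A v)) = 0"
  then have 0: "inner v (\<i> *s A v) = 0" for v by (simp add: Im)
  have anti: "inner u (\<i> *s A v) + inner v (\<i> *s A u) = 0" for u v
    using 0[of "u + v"] 0[of u] 0[of v]
    by (simp add: blinfun.add_right vector_add_ldistrib inner_add_left inner_add_right)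
  have "inner u (A v) = inner v (A u)" for u v
  proof -
    have "inner (\<i> *s u) (\<i> *s A v) = inner u (A v)"
      by (simp add: inner_scale_right vector_smult_assoc)
    then show ?thesis
      using anti[of "\<i> *s u" v] by (simp add: clinearD[OF A] ii)
  qed
  then show "adj A = A"
    by (intro adj_eqI) (metis inner_commute)
qed

section \<open>Positivity, norm and scalars of endomorphisms\<close>

context covering_bundle
begin

lemma down_inject: "down f = down g \<Longrightarrow> f \<in> E \<Longrightarrow> g \<in> E \<Longrightarrow> f = g"
  by (rule inj_onD[OF inj_down])

lemma herm_down: "f \<in> E \<Longrightarrow> herm \<xi> (\<Phi> x v) (down f (\<Phi> x v)) = cinner v (f x v)"
  by (simp add: down_\<Phi> \<Phi>_isometric)

lemma clinear_E': "f \<in> E \<Longrightarrow> clinear (f x)"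
  by (simp add: clinear_def clinear_E)

lemma Re_cinner: "Re (cinner u v) = inner u v"
  by (simp add: cinner_eq)

lemma selfadjoint_iff: "f \<in> E \<Longrightarrow> badj f = f \<longleftrightarrow> (\<forall>x v. Im (cinner v (f x v)) = 0)"
proof -
  assume f: "f \<in> E"
  have "badj f = f \<longleftrightarrow> (\<forall>x. adj (f x) = f x)"
    by (metis badj_apply bcontfun_eqI)
  then show ?thesis by (simp add: complex_selfadjoint_iff clinear_E' f)
qed

lemma nonneg_iff:
  assumes f: "f \<in> E"
  shows "End_nonneg \<xi> (down f) \<longleftrightarrow> badj f = f \<and> (\<forall>x v. 0 \<le> inner v (f x v))"
proof -
  have "End_nonneg \<xi> (down f) \<longleftrightarrow> (\<forall>x v. Im (cinner v (f x v)) = 0 \<and> 0 \<le> Re (cinner v (f x v)))"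
    unfolding End_nonneg_def
  proof (intro iffI allI)
    fix e assume "\<forall>x v. Im (cinner v (f x v)) = 0 \<and> 0 \<le> Re (cinner v (f x v))"
    moreover obtain x v where "e = \<Phi> x v" using lift_exists by blast
    ultimately show "Im (herm \<xi> e (down f e)) = 0 \<and> 0 \<le> Re (herm \<xi> e (down f e))"
      by (simp add: herm_down f)
  next
    fix x v assume "\<forall>e. Im (herm \<xi> e (down f e)) = 0 \<and> 0 \<le> Re (herm \<xi> e (down f e))"
    then show "Im (cinner v (f x v)) = 0 \<and> 0 \<le> Re (cinner v (f x v))"
      by (metis herm_down f)
  qed
  then show ?thesis by (auto simp: selfadjoint_iff f Re_cinner)
qed

lemma strictly_pos_imp_nonneg:
  assumes f: "f \<in> E" and pos: "End_strictly_pos \<xi> (down f)"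
  shows "badj f = f" "0 \<le> inner v (f x v)"
proof -
  have "Im (cinner v (f x v)) = 0 \<and> 0 \<le> Re (cinner v (f x v))" for x v
  proof (cases "v = 0")
    case False
    then have "\<Phi> x v \<noteq> vzero \<xi> (proj \<xi> (\<Phi> x v))"
      by (simp add: \<Phi>_inject flip: \<Phi>_zero)
    then show ?thesis
      using pos unfolding End_strictly_pos_def by (metis herm_down f less_imp_le)
  qed (simp add: cinner_def blinfun.zero_right)
  then show "badj f = f" "0 \<le> inner v (f x v)"
    by (auto simp: selfadjoint_iff f Re_cinner)
qed

lemma End_norm_down:
  assumes f: "f \<in> E" shows "End_norm \<xi> (down f) = norm f"
proof -
  have fibre_sup: "(SUP e\<in>{e \<in> fibre \<xi> (p x). fibre_norm \<xi> e \<le> 1}. fibre_norm \<xi> (down f e)) = norm (f x)" for x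
  proof -
    have "{e \<in> fibre \<xi> (p x). fibre_norm \<xi> e \<le> 1} = \<Phi> x ` {v. norm v \<le> 1}"
    proof (intro equalityI subsetI)
      fix e assume "e \<in> {e \<in> fibre \<xi> (p x). fibre_norm \<xi> e \<le> 1}"
      then have e: "proj \<xi> e = p x" "fibre_norm \<xi> e \<le> 1" by (auto simp: fibre_def)
      then have "e = \<Phi> x (coord x e)" "norm (coord x e) \<le> 1"
        by (simp, metis \<Phi>_coord norm_\<Phi>)
      then show "e \<in> \<Phi> x ` {v. norm v \<le> 1}" by blast
    qed (auto simp: norm_\<Phi>)
    then have "(SUP e\<in>{e \<in> fibre \<xi> (p x). fibre_norm \<xi> e \<le> 1}. fibre_norm \<xi> (down f e)) =
        (SUP v\<in>{v. norm v \<le> 1}. norm (f x v))"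
      by (simp add: image_image down_\<Phi> f norm_\<Phi>)
    also have "\<dots> = norm (f x)"
    proof (rule antisym)
      have le: "norm (f x v) \<le> norm (f x)" if "norm v \<le> 1" for v
        using norm_blinfun[of "f x" v] mult_left_mono[OF that norm_ge_zero[of "f x"]] by simp
      then show "(SUP v\<in>{v. norm v \<le> 1}. norm (f x v)) \<le> norm (f x)"
        by (intro cSUP_least) (auto intro: exI[of _ 0])
      let ?S = "SUP v\<in>{v. norm v \<le> 1}. norm (f x v)"
      have S: "norm (f x v) \<le> ?S" if "norm v \<le> 1" for v
        using le that by (intro cSUP_upper bdd_aboveI[of _ "norm (f x)"]) auto
      show "norm (f x) \<le> ?S"
      proof (rule norm_blinfun_bound)
        show "0 \<le> ?S" using S[of 0] by (simp add: blinfun.zero_right)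
        fix v
        show "norm (f x v) \<le> ?S * norm v"
        proof (cases "v = 0")
          case False
          have "norm (f x ((1 / norm v) *\<^sub>R v)) \<le> ?S" using False by (intro S) simp
          then show ?thesis using False by (simp add: blinfun.scaleR_right field_simps)
        qed (simp add: blinfun.zero_right)
      qed
    qed
    finally show ?thesis .
  qed
  let ?N = "\<lambda>y. SUP e\<in>{e \<in> fibre \<xi> y. fibre_norm \<xi> e \<le> 1}. fibre_norm \<xi> (down f e)"
  have le: "?N y \<le> norm f" for y
  proof -
    obtain x where "p x = y" using p_surj by blast
    then show ?thesis using fibre_sup[of x] norm_bounded[of f x] by simp
  qed
  have "(SUP y. ?N y) = norm f"
  proof (rule antisym)
    show "(SUP y. ?N y) \<le> norm f" by (intro cSUP_least le) simp
    have "norm (f x) \<le> (SUP y. ?N y)" for x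
      unfolding fibre_sup[of x, symmetric]
      by (intro cSUP_upper bdd_aboveI[of _ "norm f"]) (use le in auto)
    then show "norm f \<le> (SUP y. ?N y)" by (rule norm_bound)
  qed
  then show ?thesis by (simp add: End_norm_def)
qed

lemma down_sum:
  assumes "finite S" "\<And>i. i \<in> S \<Longrightarrow> f i \<in> E"
  shows "sum f S \<in> E" "down (sum f S) e = finprod (fibre_group \<xi> (proj \<xi> e)) (\<lambda>i. down (f i) e) S"
proof -
  show fS: "sum f S \<in> E" using subspace_E assms by (intro subspace_sum)
  obtain x v where e: "e = \<Phi> x v" using lift_exists by blast
  have "fibre_sum x (\<lambda>i. down (f i) e) S =
      fibre_sum x (\<lambda>i. \<Phi> x (f i x v)) S"
    using assms(2) fibre_comm_group[of "p x"]
    by (intro comm_monoid.finprod_cong') (auto simp: e down_\<Phi> fibre_group_def comm_group_def)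
  also have "\<dots> = \<Phi> x (\<Sum>i\<in>S. f i x v)" by (rule finprod_fibre[OF assms(1)])
  also have "\<dots> = down (sum f S) e"
    by (simp add: e down_\<Phi> fS apply_bcontfun_sum blinfun.sum_left)
  finally show "down (sum f S) e = finprod (fibre_group \<xi> (proj \<xi> e)) (\<lambda>i. down (f i) e) S"
    by (simp add: e)
qed

lemma J_central: "f \<in> E \<Longrightarrow> f \<odot> J c = J c \<odot> f"
  by (intro bcontfun_eqI blinfun_eqI) (simp add: J_def clinear_E)

lemma J_adj: "badj (J c) = J (cnj c)"
  by (intro bcontfun_eqI) (auto simp: J_def inner_scale_right intro!: adj_eqI)

lemma J_add: "J (c + d) = J c + J d"
  by (intro bcontfun_eqI blinfun_eqI) (simp add: J_def blinfun.add_left vector_sadd_rdistrib)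

lemma J_mult: "J (c * d) = J c \<odot> J d"
  by (intro bcontfun_eqI blinfun_eqI) (simp add: J_def vector_smult_assoc)

lemma J_norm: "norm (J c \<odot> f) = cmod c * norm f"
proof (rule antisym)
  have le: "norm (J c \<odot> f) \<le> cmod c * norm f" for c f
  proof (rule norm_bound)
    fix x
    show "norm ((J c \<odot> f) x) \<le> cmod c * norm f"
    proof (rule norm_blinfun_bound)
      fix v
      have "norm (f x v) \<le> norm f * norm v"
        by (rule order_trans[OF norm_blinfun]) (intro mult_right_mono norm_bounded norm_ge_zero)
      then show "norm ((J c \<odot> f) x v) \<le> cmod c * norm f * norm v"
        by (simp add: J_def norm_scale_vec mult_left_mono mult.assoc)
    qed simp
  qed
  show "norm (J c \<odot> f) \<le> cmod c * norm f" by (rule le)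
  show "cmod c * norm f \<le> norm (J c \<odot> f)"
  proof (cases "c = 0")
    case False
    have "f = J (inverse c) \<odot> (J c \<odot> f)"
      using False J_of_real[of 1] by (simp flip: J_mult bcomp_assoc)
    then have "norm f \<le> cmod (inverse c) * norm (J c \<odot> f)"
      using le[of "inverse c" "J c \<odot> f"] by simp
    then show ?thesis using False by (simp add: norm_divide field_simps)
  qed simp
qed

end

section \<open>The transfer operator in coordinates\<close>

locale bundle_transfer =
  covering_bundle G act p rt \<theta> xt0 A q gs r \<xi> \<Phi> + lipschitz_bundle_map p rt r \<xi> \<Phi> m
  for G :: "'g monoid" and act :: "'g \<Rightarrow> 'x::metric_space \<Rightarrow> 'x"
    and p :: "'x \<Rightarrow> 'b::topological_space"
    and rt :: "'x \<Rightarrow> 'x" and \<theta> :: real and xt0 :: 'x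
    and A :: "'g \<Rightarrow> 'g" and q :: nat and gs :: "nat \<Rightarrow> 'g" and r :: "'b \<Rightarrow> 'b"
    and \<xi> :: "('b, 'e::topological_space, 'n::finite) hbundle"
    and \<Phi> :: "'x \<Rightarrow> complex^'n \<Rightarrow> 'e"
    and m :: "'b \<Rightarrow> 'e \<Rightarrow> 'e"
begin

abbreviation R :: "('e \<Rightarrow> 'e) \<Rightarrow> 'e \<Rightarrow> 'e" where "R \<equiv> transfer \<xi> p r q \<psi> m"

definition mt :: "'x \<Rightarrow> 'n cmat" where
  "mt x = in_coords (rt x) x (m (p x))"

lemma m_linear': "fibre_linear \<xi> (p (rt x)) (p x) (m (p x))"
  using m_linear[of "p x"] by (simp add: r)

lemma \<Phi>_mt: "\<Phi> x (mt x v) = m (p x) (\<Phi> (rt x) v)"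
  unfolding mt_def by (rule \<Phi>_in_coords[OF m_linear'])

lemma of_mat_pullback: "of_mat (pullback_matrix \<Phi> p rt m x) = mt x"
proof -
  have cl: "clinear (mt x)" unfolding mt_def by (rule clinear_in_coords[OF m_linear'])
  have "Vector_Spaces.linear (*s) (*s) (blinfun_apply (mt x))"
    by unfold_locales (simp_all add: clinearD[OF cl] blinfun.add_right)
  moreover have "pullback_matrix \<Phi> p rt m x = matrix (blinfun_apply (mt x))"
    unfolding pullback_matrix_def mt_def
    by (rule arg_cong[where f = matrix]) (auto simp: in_coords_apply[OF m_linear'] coord_def)
  ultimately show ?thesis
    by (intro blinfun_eqI) (simp add: matrix_works)
qed

lemma mt_lipschitz: "\<exists>c\<ge>0. \<forall>x y. norm (mt x - mt y) \<le> c * dist x y"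
proof -
  obtain C where C: "C-lipschitz_on UNIV (pullback_matrix \<Phi> p rt m)" using m_lipschitz by blast
  have "norm (mt x - mt y) \<le> mat_const TYPE('n) * C * dist x y" for x y
    using of_mat_lipschitz[OF C, of x y] by (simp add: of_mat_pullback)
  then show ?thesis
    using lipschitz_on_nonneg[OF C]
    by (intro exI[of _ "mat_const TYPE('n) * C"] conjI mult_nonneg_nonneg mat_const_nonneg) auto
qed

text \<open>Lipschitz continuity alone gives no bound on a noncompact cover. The norm descends to
  the compact base because \<open>p x\<close> determines \<open>p (rt x)\<close> through
  \<open>r\<close>.\<close>

lemma mt_bounded: "\<exists>c. \<forall>x. norm (mt x) \<le> c"
proof (rule invariant_bounded)
  have le: "norm (mt x) \<le> norm (mt x')" if px: "p x = p x'" for x x'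
  proof (rule norm_blinfun_bound)
    fix v
    have "p (rt x) = p (rt x')" using px by (metis r)
    then obtain w where w: "\<Phi> (rt x) v = \<Phi> (rt x') w" "norm w = norm v"
      using \<Phi>_glue norm_glue_apply by metis
    have "norm (mt x v) = fibre_norm \<xi> (\<Phi> x' (mt x' w))"
      by (simp add: \<Phi>_mt px flip: norm_\<Phi>[of x] w(1))
    also have "\<dots> = norm (mt x' w)" by (rule norm_\<Phi>)
    also have "\<dots> \<le> norm (mt x') * norm v" using norm_blinfun[of "mt x'" w] w(2) by simp
    finally show "norm (mt x v) \<le> norm (mt x') * norm v" .
  qed simp
  show "norm (mt x) = norm (mt x')" if "p x = p x'" for x x'
    using le[of x x'] le[of x' x] that by simp
  obtain c where "0 \<le> c" "\<And>x y. norm (mt x - mt y) \<le> c * dist x y" using mt_lipschitz by blast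
  then have "c-lipschitz_on UNIV mt" by (intro lipschitz_onI) (auto simp: dist_norm)
  then show "continuous_on UNIV (\<lambda>x. norm (mt x))"
    by (intro continuous_on_norm lipschitz_on_continuous_on)
qed

text \<open>\<open>mt\<close> at \<open>\<psi> i x\<close> starts from the frame at
  \<open>rt (\<psi> i x)\<close>, which is \<open>act (gs i) x\<close>; \<open>glue\<close> first
  leads there from the frame at \<open>x\<close>, so that all branches start from one frame.\<close>

definition \<mu> :: "nat \<Rightarrow> 'x \<Rightarrow> 'n cmat" where
  "\<mu> i x = mt (\<psi> i x) o\<^sub>L glue x (act (gs i) x)"

lemma \<Phi>_\<mu>: "i \<in> {1..q} \<Longrightarrow> \<Phi> (\<psi> i x) (\<mu> i x v) = m (p (\<psi> i x)) (\<Phi> x v)"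
  by (simp add: \<mu>_def \<Phi>_mt rt_\<psi> \<Phi>_glue p_act gs_carrier)

lemma m_linear_\<psi>: "i \<in> {1..q} \<Longrightarrow> fibre_linear \<xi> (p x) (p (\<psi> i x)) (m (p (\<psi> i x)))"
  using m_linear[of "p (\<psi> i x)"] by (simp add: r_p_\<psi>)

lemma in_coords_m: "i \<in> {1..q} \<Longrightarrow> in_coords x (\<psi> i x) (m (p (\<psi> i x))) = \<mu> i x"
  by (rule blinfun_eqI) (simp add: in_coords_apply[OF m_linear_\<psi>] flip: \<Phi>_\<mu>)

lemma clinear_\<mu>: "i \<in> {1..q} \<Longrightarrow> clinear (\<mu> i x)"
  using clinear_in_coords[OF m_linear_\<psi>] by (simp add: in_coords_m)

lemma \<mu>_bounds:
  "\<exists>L\<ge>0. \<forall>i\<in>{1..q}. \<forall>x y. norm (\<mu> i x) \<le> L \<and> norm (\<mu> i x - \<mu> i y) \<le> L * dist x y"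
proof -
  obtain b where b: "\<And>x. norm (mt x) \<le> b" using mt_bounded by blast
  obtain c where c: "0 \<le> c" "\<And>x y. norm (mt x - mt y) \<le> c * dist x y" using mt_lipschitz by blast
  obtain c' where c': "0 \<le> c'" "\<And>g x y. g \<in> carrier G \<Longrightarrow> norm (deck g x - deck g y) \<le> c' * dist x y"
    using glue_lipschitz by blast
  have b0: "0 \<le> b" using b norm_ge_zero order_trans by blast
  let ?u = "\<lambda>i x. glue x (act (gs i) x)"
  have u: "norm (?u i x) \<le> 1" if "i \<in> {1..q}" for i x
    using that by (intro norm_glue) (simp add: p_act gs_carrier)
  have bound: "norm (\<mu> i x) \<le> b" if i: "i \<in> {1..q}" for i x
  proof -
    have "norm (\<mu> i x) \<le> b * 1"
      unfolding \<mu>_def by (rule order_trans[OF norm_blinfun_compose]) (intro mult_mono b u i b0 norm_ge_zero)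
    then show ?thesis by simp
  qed
  have lip: "norm (\<mu> i x - \<mu> i y) \<le> (b * c' + c) * dist x y" if i: "i \<in> {1..q}" for i x y
  proof -
    have eq: "\<mu> i x - \<mu> i y = (mt (\<psi> i x) o\<^sub>L (?u i x - ?u i y)) + ((mt (\<psi> i x) - mt (\<psi> i y)) o\<^sub>L ?u i y)"
      by (simp add: \<mu>_def blinfun_compose.diff_left blinfun_compose.diff_right)
    have "norm (\<mu> i x - \<mu> i y) \<le>
        norm (mt (\<psi> i x)) * norm (?u i x - ?u i y) + norm (mt (\<psi> i x) - mt (\<psi> i y)) * norm (?u i y)"
      unfolding eq by (intro norm_triangle_le add_mono norm_blinfun_compose)
    also have "\<dots> \<le> b * (c' * dist x y) + (c * dist x y) * 1"
    proof (intro add_mono mult_mono b u i)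
      show "norm (?u i x - ?u i y) \<le> c' * dist x y" using i by (intro c' gs_carrier)
      have "dist (\<psi> i x) (\<psi> i y) \<le> 1 * dist x y"
        using \<theta> by (intro order_trans[OF \<psi>_contract[OF i]] mult_right_mono) auto
      then show "norm (mt (\<psi> i x) - mt (\<psi> i y)) \<le> c * dist x y"
        using c(1) by (intro order_trans[OF c(2)] mult_left_mono) auto
    qed (auto simp: b0 c)
    finally show ?thesis by (simp add: algebra_simps)
  qed
  have "norm (\<mu> i x) \<le> b + (b * c' + c)" "norm (\<mu> i x - \<mu> i y) \<le> (b + (b * c' + c)) * dist x y"
    if i: "i \<in> {1..q}" for i x y
  proof -
    show "norm (\<mu> i x) \<le> b + (b * c' + c)" using bound[OF i, of x] b0 c c' by (simp add: add_increasing2)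
    show "norm (\<mu> i x - \<mu> i y) \<le> (b + (b * c' + c)) * dist x y"
      using b0 by (intro order_trans[OF lip[OF i]] mult_right_mono) auto
  qed
  then show ?thesis
    using b0 c c' by (intro exI[of _ "b + (b * c' + c)"]) auto
qed

definition R_fun :: "('x, 'n) cmatfun \<Rightarrow> 'x \<Rightarrow> 'n cmat" where
  "R_fun f x = (\<Sum>i\<in>{1..q}. adj (\<mu> i x) o\<^sub>L (f (\<psi> i x) o\<^sub>L \<mu> i x))"

text \<open>The sum defining \<open>R\<close> is a sum over the fibre \<open>r -` {p x}\<close>, hence independent of the lift \<open>x\<close>.\<close>

lemma transfer_\<Phi>:
  assumes f: "f \<in> E" shows "R (down f) (\<Phi> x v) = \<Phi> x (R_fun f x v)"
proof -
  define e where "e = \<Phi> x v"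
  define t where "t y = fibre_adjoint \<xi> (r y) (m y) (down f (m y e))" for y
  have t: "t (p (\<psi> i x')) = \<Phi> x' (adj (\<mu> i x') (f (\<psi> i x') (\<mu> i x' (coord x' e))))"
    if i: "i \<in> {1..q}" and x': "p x' = p x" for i x'
  proof -
    have e': "e = \<Phi> x' (coord x' e)" by (simp add: e_def x')
    have "m (p (\<psi> i x')) e = \<Phi> (\<psi> i x') (\<mu> i x' (coord x' e))"
      by (subst e') (simp add: \<Phi>_\<mu>[OF i])
    then have 1: "down f (m (p (\<psi> i x')) e) = \<Phi> (\<psi> i x') (f (\<psi> i x') (\<mu> i x' (coord x' e)))"
      by (simp add: down_\<Phi> f)
    have 2: "r (p (\<psi> i x')) = p x'" using i by (rule r_p_\<psi>)
    show ?thesis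
      unfolding t_def 1 2
      by (subst fibre_adjoint_coords[OF m_linear_\<psi>[OF i]]) (simp_all add: in_coords_m[OF i])
  qed
  define x0 where "x0 = (SOME x'. p x' = proj \<xi> e)"
  have x0: "p x0 = p x" unfolding x0_def by (rule someI[of _ x, THEN trans]) (simp_all add: e_def)
  have "R (down f) e = finprod (fibre_group \<xi> (p x0)) (\<lambda>i. t (p (\<psi> i x0))) {1..q}"
    by (simp add: transfer_def Let_def t_def x0_def)
  moreover have reindex: "fibre_sum x (\<lambda>i. t (p (\<psi> i x'))) {1..q} =
      fibre_sum x t {y. r y = p x}" if x': "p x' = p x" for x'
  proof -
    interpret comm_group "fibre_group \<xi> (p x)" by (rule fibre_comm_group)
    have bij: "bij_betw (\<lambda>i. p (\<psi> i x')) {1..q} {y. r y = p x}"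
      using preimage_bij[of x'] x' by simp
    have "t \<in> (\<lambda>i. p (\<psi> i x')) ` {1..q} \<rightarrow> carrier (fibre_group \<xi> (p x))"
      using t[OF _ x'] x' by (auto simp: fibre_group_def fibre_def)
    from finprod_reindex[OF this bij_betw_imp_inj_on[OF bij]] show ?thesis
      unfolding bij_betw_imp_surj_on[OF bij] by (rule sym)
  qed
  ultimately have "R (down f) e = fibre_sum x (\<lambda>i. t (p (\<psi> i x))) {1..q}"
    using x0 reindex[OF x0] reindex[OF refl] by simp
  also have "\<dots> = fibre_sum x
      (\<lambda>i. \<Phi> x (adj (\<mu> i x) (f (\<psi> i x) (\<mu> i x v)))) {1..q}"
    using fibre_comm_group[of "p x"]
    by (intro comm_monoid.finprod_cong') (auto simp: t fibre_group_def comm_group_def e_def)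
  also have "\<dots> = \<Phi> x (R_fun f x v)"
    by (simp add: finprod_fibre R_fun_def blinfun.sum_left)
  finally show ?thesis by (simp add: e_def)
qed

definition R_up :: "('x, 'n) cmatfun \<Rightarrow> ('x, 'n) cmatfun" where
  "R_up f = Bcontfun (R_fun f)"

lemma assumes f: "f \<in> E"
  shows R_up_apply: "R_up f x = R_fun f x" and R_up_in: "R_up f \<in> E"
    and down_R_up: "down (R_up f) = R (down f)"
proof -
  have cl: "clinear (R_fun f x)" for x
    unfolding R_fun_def
    by (intro clinear_sum clinear_compose clinear_adj clinear_\<mu> clinear_E' f)
  have "\<Phi> x (R_fun f x (coord x e)) = R (down f) e" if "proj \<xi> e = p x" for x e
    using that by (simp flip: transfer_\<Phi>[OF f])
  then have "compatible (R_fun f)"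
    unfolding compatible_def by (simp add: cl)
  moreover have "continuous_on UNIV (R_fun f)"
    unfolding R_fun_def
  proof (intro continuous_on_sum)
    fix i assume i: "i \<in> {1..q}"
    obtain L where "0 \<le> L" "\<And>x y. norm (\<mu> i x - \<mu> i y) \<le> L * dist x y" using \<mu>_bounds i by blast
    then have "L-lipschitz_on UNIV (\<mu> i)" by (intro lipschitz_onI) (auto simp: dist_norm)
    then have "continuous_on UNIV (\<mu> i)" by (rule lipschitz_on_continuous_on)
    then show "continuous_on UNIV (\<lambda>x. adj (\<mu> i x) o\<^sub>L (f (\<psi> i x) o\<^sub>L \<mu> i x))"
      by (intro blinfun_compose.continuous_on bounded_linear.continuous_on[OF bounded_linear_adj]
          continuous_on_compose2[OF continuous_on_apply_bcontfun continuous_\<psi>[OF i]]) auto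
  qed
  ultimately obtain g where g: "g \<in> E" "apply_bcontfun g = R_fun f"
    using compatible_bcontfun by blast
  then have R_up: "R_up f = g" by (simp add: R_up_def apply_bcontfun_inverse flip: g(2))
  with g show "R_up f x = R_fun f x" "R_up f \<in> E" by auto
  show "down (R_up f) = R (down f)"
    using cl by (intro E_eqI(2)) (auto simp: R_up g transfer_\<Phi> f)
qed

lemma down_R_up_pow: "f \<in> E \<Longrightarrow> (R_up ^^ n) f \<in> E \<and> down ((R_up ^^ n) f) = (R ^^ n) (down f)"
  by (induction n) (auto simp: R_up_in down_R_up)

lemma contracting_transfer_R_up:
  assumes "power_bounded \<xi> R"
  shows "\<exists>C L. contracting_transfer E R_up C {1..q} \<psi> \<mu> \<theta> L"
proof -
  obtain C where C: "\<And>k F. F \<in> bundle_End \<xi> \<Longrightarrow> End_norm \<xi> ((R ^^ k) F) \<le> C * End_norm \<xi> F"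
    using assms by (auto simp: power_bounded_def)
  obtain L where L: "0 \<le> L" "\<And>i x. i \<in> {1..q} \<Longrightarrow> norm (\<mu> i x) \<le> L"
    "\<And>i x y. i \<in> {1..q} \<Longrightarrow> norm (\<mu> i x - \<mu> i y) \<le> L * dist x y"
    using \<mu>_bounds by blast
  \<comment> \<open>The constant of \<open>power_bounded\<close> comes without a sign, hence the
    maximum with \<open>0\<close>.\<close>
  have "contracting_transfer E R_up (max C 0) {1..q} \<psi> \<mu> \<theta> L"
  proof (intro contracting_transfer.intro power_bounded_operator.intro contracting_transfer_axioms.intro)
    fix f g assume f: "f \<in> E"
    show "R_up f \<in> E" using f by (rule R_up_in)
    show "R_up f x = (\<Sum>i\<in>{1..q}. adj (\<mu> i x) o\<^sub>L (f (\<psi> i x) o\<^sub>L \<mu> i x))" for x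
      by (simp add: R_up_apply f R_fun_def)
    show "R_up (c *\<^sub>R f) = c *\<^sub>R R_up f" for c
      using f subspace_E
      by (intro bcontfun_eqI) (simp add: R_up_apply subspace_scale R_fun_def blinfun_compose.scaleR_left
          blinfun_compose.scaleR_right scaleR_sum_right)
    show "norm ((R_up ^^ n) f) \<le> max C 0 * norm f" for n
    proof -
      have "norm ((R_up ^^ n) f) \<le> C * norm f"
        using C[OF down_in[OF f], of n] down_R_up_pow[OF f, of n] by (metis End_norm_down f)
      also have "\<dots> \<le> max C 0 * norm f" by (intro mult_right_mono) auto
      finally show ?thesis .
    qed
    show "\<exists>d>0. \<forall>x y. dist x y \<le> d \<longrightarrow> norm (f x - f y) \<le> e" if "0 < e" for e
      using f that by (rule E_uniformly_continuous)
    show "badj f \<in> E" using down_adj[OF f] ..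
    assume g: "g \<in> E"
    show "R_up (f + g) = R_up f + R_up g"
      using f g subspace_E
      by (intro bcontfun_eqI) (simp add: R_up_apply subspace_add R_fun_def blinfun_compose.add_left
          blinfun_compose.add_right sum.distrib)
    show "f \<odot> g \<in> E" using down_comp[OF f g] ..
  qed (use L \<theta> subspace_E closed_E down_id \<psi>_contract E_nets in auto)
  then show ?thesis by blast
qed

lemma R_up_J: "f \<in> E \<Longrightarrow> R_up (J c \<odot> f) = J c \<odot> R_up f"
proof (intro bcontfun_eqI blinfun_eqI)
  fix x v assume f: "f \<in> E"
  have Jf: "J c \<odot> f \<in> E" using down_scale[OF f] ..
  have "adj (\<mu> i x) (c *s w) = c *s adj (\<mu> i x) w" if "i \<in> {1..q}" for i w
    using clinear_adj[OF clinear_\<mu>[OF that]] by (simp add: clinear_def)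
  then show "R_up (J c \<odot> f) x v = (J c \<odot> R_up f) x v"
    unfolding R_up_apply[OF Jf]
    by (simp add: R_up_apply f R_fun_def blinfun.sum_left J_def vec.scale_sum_right)
qed

end

theorem theorem4p2:
  fixes G :: "'g monoid" and act :: "'g \<Rightarrow> 'x::metric_space \<Rightarrow> 'x"
    and p :: "'x \<Rightarrow> 'b::topological_space"
    and rt :: "'x \<Rightarrow> 'x" and \<theta> :: real and xt0 :: 'x
    and A :: "'g \<Rightarrow> 'g" and q :: nat and gs :: "nat \<Rightarrow> 'g" and r :: "'b \<Rightarrow> 'b"
    and \<xi> :: "('b, 'e::topological_space, 'n::finite) hbundle"
    and \<Phi> :: "'x \<Rightarrow> complex^'n \<Rightarrow> 'e"
    and m :: "'b \<Rightarrow> 'e \<Rightarrow> 'e"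
    and R :: "('e \<Rightarrow> 'e) \<Rightarrow> 'e \<Rightarrow> 'e"
    and h :: "'e \<Rightarrow> 'e"
  assumes "expanding_covering G act p rt \<theta> xt0 A q gs r"
    and "lipschitz_pullback_trivialization p \<xi> \<Phi>"
    and "lipschitz_bundle_map p rt r \<xi> \<Phi> m"
    and "R = transfer \<xi> p r q (inverse_branch act rt gs) m"
    and "power_bounded \<xi> R"
    and "h \<in> bundle_End \<xi>" and "End_strictly_pos \<xi> h" and "End_invertible \<xi> h"
    and "R h = h"
  shows "finite_dim_cstar_algebra_on (harmonic \<xi> R) (End_add \<xi>) (End_zero \<xi>) (End_scale \<xi>)
           (\<lambda>h1 h2. ergodic_limit \<xi> R (h1 \<circ> End_inverse h \<circ> h2))
           (End_adjoint \<xi>)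
           (\<lambda>a. End_norm \<xi> (End_sqrt \<xi> (End_inverse h) \<circ> a \<circ> End_sqrt \<xi> (End_inverse h)))"
proof -
  interpret bundle_transfer G act p rt \<theta> xt0 A q gs r \<xi> \<Phi> m
    using assms(1-3) by (simp add: bundle_transfer_def covering_bundle_def)
  note R = assms(4)
  obtain C L where "contracting_transfer E R_up C {1..q} \<psi> \<mu> \<theta> L"
    using contracting_transfer_R_up assms(5) unfolding R by blast
  then interpret CT: contracting_transfer E R_up C "{1..q}" \<psi> \<mu> \<theta> L .
  obtain h0 where h0: "h0 \<in> E" "down h0 = h" using down_surj[OF assms(6)] by blast
  obtain K where K: "K \<in> bundle_End \<xi>" "K \<circ> h = id" "h \<circ> K = id"
    using assms(8) by (auto simp: End_invertible_def)
  have inv: "End_inverse h = K"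
  proof
    fix e
    have "bij h" using K by (metis o_bij)
    then show "End_inverse h e = K e"
      using K(2,3) unfolding End_inverse_def by (metis bij_inv_eq_iff comp_apply id_apply)
  qed
  obtain k where k: "k \<in> E" "down k = K" using down_surj[OF K(1)] by blast
  have hk: "h0 \<odot> k = bid" "k \<odot> h0 = bid"
    using down_comp[OF h0(1) k(1)] down_comp[OF k(1) h0(1)] down_id K
    by (auto intro!: down_inject simp: h0 k)
  have R_h0: "R_up h0 = h0"
    using assms(9) by (intro down_inject R_up_in h0) (simp add: down_R_up h0 R)
  have h0_adj: "badj h0 = h0" and h0_nonneg: "0 \<le> inner v (h0 x v)" for x v
    using strictly_pos_imp_nonneg[OF h0(1)] assms(7) h0(2) by auto
  have k_adj: "badj k = k"
  proof -
    have "badj k \<odot> h0 = bid" using hk(1) by (metis badj_bcomp badj_bid h0_adj)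
    then have "badj k \<odot> (h0 \<odot> k) = k" by (simp flip: bcomp_assoc)
    then show ?thesis by (simp add: hk)
  qed
  have kh_apply: "k x (h0 x v) = v" and hk_apply: "h0 x (k x v) = v" for x v
    using hk bcomp_apply[of k h0 x] bcomp_apply[of h0 k x] by (metis blinfun_apply_blinfun_compose
        blinfun_apply_id_blinfun const_bcontfun.rep_eq)+
  have k_sym: "inner u (k x v) = inner (k x u) v" for u v x
    using adj_inner_right[of u "k x" v] badj_apply[of k x] k_adj by simp
  have k_nonneg: "0 \<le> inner v (k x v)" for v x
    using h0_nonneg[of "k x v" x] by (simp add: hk_apply inner_commute)
  \<comment> \<open>\<open>positive_sqrt\<close> requires a positive lower bound for
    \<open>k\<close>. Since \<open>t * norm h0 \<le> 1\<close>, the inverse of \<open>h0\<close> is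
    at least \<open>t\<close>; the added \<open>1\<close> avoids a division by zero.\<close>
  define t where "t = 1 / (norm h0 + 1)"
  have t: "0 < t" "t * norm h0 \<le> 1" by (auto simp: t_def field_simps add_pos_nonneg)
  have form_le: "inner v (f x v) \<le> norm f * inner v v"
    for f :: "('x, 'n) cmatfun" and x v
  proof -
    have "norm (f x) * (inner v v + inner v v) \<le> norm f * (inner v v + inner v v)"
      by (intro mult_right_mono norm_bounded) auto
    from order_trans[OF inner_blinfun_le this] show ?thesis by simp
  qed
  have lower: "t * inner v v \<le> inner v (k x v)" for x v
  proof -
    \<comment> \<open>The form of \<open>k\<close> is nonnegative at this vector; the last term of
      its expansion, \<open>t\<^sup>2\<close> times the form of \<open>h0\<close>, is at most
      \<open>t * inner v v\<close> and cancels half of the middle term.\<close>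
    let ?w = "v - t *\<^sub>R h0 x v"
    have "inner (h0 x v) (k x v) = inner v v" by (metis k_sym kh_apply)
    then have "inner ?w (k x ?w) = inner v (k x v) - 2 * t * inner v v + t * (t * inner v (h0 x v))"
      by (simp add: blinfun.diff_right blinfun.scaleR_right kh_apply inner_diff_left inner_diff_right
          inner_commute[of "h0 x v" v] algebra_simps)
    moreover have "t * (t * inner v (h0 x v)) \<le> t * (1 * inner v v)"
    proof (intro mult_left_mono)
      have "t * inner v (h0 x v) \<le> t * (norm h0 * inner v v)"
        using t by (intro mult_left_mono form_le) auto
      also have "\<dots> = (t * norm h0) * inner v v" by simp
      also have "\<dots> \<le> 1 * inner v v" using t by (intro mult_right_mono) auto
      finally show "t * inner v (h0 x v) \<le> 1 * inner v v" .
    qed (use t in auto)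
    ultimately show ?thesis using k_nonneg[of ?w x] by simp
  qed
  \<comment> \<open>The maximum with \<open>t\<close> secures that the upper bound dominates the
    lower one.\<close>
  have upper: "inner v (k x v) \<le> max (norm k) t * inner v v" for x v
    using form_le[of v k x] by (rule order_trans) (intro mult_right_mono, auto)
  have bcomp_in: "f \<odot> g \<in> E" if "f \<in> E" "g \<in> E" for f g using down_comp[OF that] ..
  have bidE: "bid \<in> E" using down_id ..
  have "t \<le> max (norm k) t" by simp
  from positive_sqrt[OF subspace_E closed_E bidE bcomp_in k(1) k_adj lower upper t(1) this]
  obtain s where s: "s \<in> E" "badj s = s" "\<And>x v. 0 \<le> inner v (s x v)" "s \<odot> s = k"
    and s_unique: "\<And>s'. badj s' = s' \<Longrightarrow> (\<And>x v. 0 \<le> inner v (s' x v)) \<Longrightarrow> s' \<odot> s' = k \<Longrightarrow> s' = s"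
    by blast
  have sqrt: "End_sqrt \<xi> K = down s"
    unfolding End_sqrt_def
  proof (rule the_equality)
    show "down s \<in> bundle_End \<xi> \<and> End_nonneg \<xi> (down s) \<and> down s \<circ> down s = K"
      using s k down_comp[OF s(1) s(1)] by (simp add: down_in nonneg_iff)
    fix S assume S: "S \<in> bundle_End \<xi> \<and> End_nonneg \<xi> S \<and> S \<circ> S = K"
    \<comment> \<open>Any competing root lifts to \<open>E\<close>, where \<open>nonneg_iff\<close>
      supplies the self-adjointness that the uniqueness statement asks for.\<close>
    then obtain s' where s': "s' \<in> E" "down s' = S" using down_surj by blast
    have "down (s' \<odot> s') = down k" using S s' k down_comp[OF s'(1) s'(1)] by simp
    then have "s' \<odot> s' = k" by (intro down_inject bcomp_in s'(1) k(1))
    moreover have "badj s' = s' \<and> (\<forall>x v. 0 \<le> inner v (s' x v))"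
      using S s' by (simp flip: nonneg_iff[OF s'(1)])
    ultimately have "s' = s" by (intro s_unique) blast+
    then show "S = down s" using s' by simp
  qed
  interpret H: complex_harmonic_state E R_up C "{1..q}" \<psi> \<mu> \<theta> L h0 k s J
    by (intro complex_harmonic_state.intro harmonic_state.intro harmonic_state_axioms.intro
        complex_harmonic_state_axioms.intro CT.contracting_transfer_axioms h0(1) R_h0 h0_adj k(1) k_adj hk
        k_nonneg s(1,2,4) J_in J_central J_add J_mult J_of_real J_adj J_norm R_up_J)
  have cesaro: "down (CT.cesaro n f) = cesaro_mean \<xi> R n (down f)" if f: "f \<in> E" for n f
  proof -
    let ?S = "\<Sum>j=1..n. (R_up ^^ j) f"
    have S: "?S \<in> E" "down ?S e = finprod (fibre_group \<xi> (proj \<xi> e)) (\<lambda>j. (R ^^ j) (down f) e) {1..n}" for e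
      using down_sum(1)[of "{1..n}" "\<lambda>j. (R_up ^^ j) f"]
        down_sum(2)[of "{1..n}" "\<lambda>j. (R_up ^^ j) f" e] down_R_up_pow[OF f] by (simp_all add: R)
    have "CT.cesaro n f = J (1 / of_nat n) \<odot> ?S"
      using J_of_real[of "1 / real n"] by (simp add: CT.cesaro_def bcomp.scaleR_left)
    then show ?thesis
      using down_scale[OF S(1)] S(2) by (simp add: cesaro_mean_def End_scale_def)
  qed
  have diff: "End_add \<xi> (down f) (End_scale \<xi> (-1) (down g)) = down (f - g)" "f - g \<in> E"
    if "f \<in> E" "g \<in> E" for f g
    using that down_scale[OF that(2), of "-1"] down_add[OF that(1), of "J (-1) \<odot> g"] H.J_minus_one
    by (simp_all add: bcomp.minus_left)
  have limit: "ergodic_limit \<xi> R (down f) = down (CT.T f)" if f: "f \<in> E" for f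
    unfolding ergodic_limit_def
  proof (rule the_equality)
    have norm_eq: "End_norm \<xi> (End_add \<xi> (cesaro_mean \<xi> R n (down f)) (End_scale \<xi> (-1) (down g))) =
        norm (CT.cesaro n f - g)" if "g \<in> E" for g n
      using that f by (simp add: diff End_norm_down CT.cesaro_in flip: cesaro)
    show "down (CT.T f) \<in> bundle_End \<xi> \<and>
        (\<lambda>n. End_norm \<xi> (End_add \<xi> (cesaro_mean \<xi> R n (down f)) (End_scale \<xi> (-1) (down (CT.T f))))) \<longlonglongrightarrow> 0"
      using CT.cesaro_T[OF f] by (simp add: norm_eq CT.T_in f down_in LIM_zero_iff tendsto_norm_zero_iff)
    fix F assume F: "F \<in> bundle_End \<xi> \<and>
        (\<lambda>n. End_norm \<xi> (End_add \<xi> (cesaro_mean \<xi> R n (down f)) (End_scale \<xi> (-1) F))) \<longlonglongrightarrow> 0"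
    \<comment> \<open>Any other candidate for the limit lifts to \<open>E\<close>, where
      \<open>down\<close> preserves the norm and limits are unique.\<close>
    then obtain g where g: "g \<in> E" "down g = F" using down_surj by blast
    then have "(\<lambda>n. norm (CT.cesaro n f - g)) \<longlonglongrightarrow> 0"
      using F by (auto simp: norm_eq)
    then have "(\<lambda>n. CT.cesaro n f) \<longlonglongrightarrow> g"
      by (simp add: tendsto_norm_zero_iff LIM_zero_iff)
    then have "g = CT.T f" using CT.cesaro_T[OF f] by (rule LIMSEQ_unique)
    then show "F = down (CT.T f)" using g by simp
  qed
  have E: "f \<in> E" if "f \<in> CT.fixed" for f using that by (simp add: CT.fixed_def)
  show ?thesis
    unfolding inv sqrt
  proof (rule finite_dim_cstar_algebra_transport[OF H.cstar_algebra_fixed, of down])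
    show "inj_on down CT.fixed"
      using inj_down by (rule inj_on_subset) (auto simp: CT.fixed_def)
    show "harmonic \<xi> R = down ` CT.fixed"
    proof (intro equalityI subsetI)
      fix F assume F: "F \<in> harmonic \<xi> R"
      then obtain f where f: "f \<in> E" "down f = F" using down_surj by (auto simp: harmonic_def)
      have "down (R_up f) = down f" using F f by (simp add: harmonic_def R down_R_up)
      then have "R_up f = f" by (intro down_inject f R_up_in)
      then show "F \<in> down ` CT.fixed" using f by (auto simp: CT.fixed_def)
    next
      fix F assume "F \<in> down ` CT.fixed"
      then show "F \<in> harmonic \<xi> R"
        by (auto simp: harmonic_def CT.fixed_def down_in R simp flip: down_R_up)
    qed
    show "End_zero \<xi> = down 0" using down_zero by simp
    fix a b c assume a: "a \<in> CT.fixed"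
    show "End_scale \<xi> c (down a) = down (J c \<odot> a)" using down_scale[OF E[OF a]] by simp
    show "End_adjoint \<xi> (down a) = down (badj a)" using down_adj[OF E[OF a]] by simp
    show "End_norm \<xi> (down s \<circ> down a \<circ> down s) = H.hnorm a"
      using down_comp[OF bcomp_in[OF s(1) E[OF a]] s(1)] down_comp[OF s(1) E[OF a]]
      by (metis H.hnorm_def End_norm_down)
    assume b: "b \<in> CT.fixed"
    show "End_add \<xi> (down a) (down b) = down (a + b)" using down_add[OF E[OF a] E[OF b]] by simp
    have "down a \<circ> K \<circ> down b = down (a \<odot> k \<odot> b)"
      using down_comp[OF bcomp_in[OF E[OF a] k(1)] E[OF b]] down_comp[OF E[OF a] k(1)] k(2) by simp
    then show "ergodic_limit \<xi> R (down a \<circ> K \<circ> down b) = down (CT.T (a \<odot> k \<odot> b))"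
      using a b k by (simp add: limit bcomp_in E)
  qed
qed

end
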